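(* Consider the stochastic cash balance problem with two-sided base-stock policies described in the context, under assumptions (B1)–(B4) there. Stochastic policy gradient methods obtain an $\epsilon$-optimal policy with sample complexity $\tilde{\mathcal O}(\epsilon^{-1}\mathrm{poly}(T))$. Precisely: let $\hat g(\theta,\Gamma)$ be a stochastic gradient computed from a simulated trajectory $\Gamma=(s_1,D_1,\dots,D_T)$ with $\mathbb E_\Gamma[\hat g(\theta,\Gamma)]=\nabla l(\theta)$ and $\mathbb E_\Gamma\|\hat g(\theta,\Gamma)-\nabla l(\theta)\|_2^2\le\sigma^2$ for all $\theta\in\Theta$. There is a polynomial $p$ in $(T,\sigma^2)$, whose coefficients depend only on the model parameters $\underline B,\bar B,\alpha,\mu_D,L_D,L_\rho,k,q,\min_t(h_t+b_t),\max_t\max\{h_t,b_t\}$, such that for every $\epsilon\in(0,1/2]$ and every $\theta^0\in\Theta$ there are a stepsize $\gamma>0$, a batch size $N$ and a number of iterations $K$ with $NK\le p(T,\sigma^2)\,\epsilon^{-1}\log(1/\epsilon)$ for which the iteration $$\theta^{j+1}=\mathrm{Proj}_\Theta\Big(\theta^j-\gamma\,\frac1N\sum_{r=1}^N\hat g(\theta^j,\Gamma_j^{(r)})\Big),$$ with independent fresh trajectories $\Gamma_j^{(r)}$, satisfies $\mathbb E[l(\theta^K)]-l(\theta^* )\le\epsilon$.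
   Context: Stochastic cash balance problem: $[T]=\{1,\dots,T\}$; $s_1$ has CDF $\rho$; real-valued (possibly negative) i.i.d. demands $D_t$ have CDF $F_D$. The decision maker moves the inventory from $s_t$ to $y_t$ (up or down), pays the transaction cost $c(y,s)=k(y-s)$ if $y\ge s$ and $c(y,s)=q(s-y)$ if $y<s$, where $k$ is the unit ordering cost, and $k+q\ge0$, and the cost $L_t(y)=\mathbb E[h_t(y-D_t)^++b_t(y-D_t)^-]$ with $h_t,b_t\ge0$, $h_t+b_t>0$, $z^-=\max\{-z,0\}$; then $s_{t+1}=y_t-D_t$. Two-sided base-stock policy with $\theta_t=(\underline\theta_t,\bar\theta_t)$: $y_t=(s_t\vee\underline\theta_t)\wedge\bar\theta_t$. $\Theta_t=\{(\underline\theta_t,\bar\theta_t):\underline B\le\underline\theta_t\le\bar\theta_t\le\bar B\}$, $\Theta=\Theta_1\times\dots\times\Theta_T$; $\mathrm{Proj}_\Theta$ is Euclidean projection. Objective $l(\theta)=\mathbb E\big[\sum_{t=1}^T\big(c((s_t\vee\underline\theta_t)\wedge\bar\theta_t,s_t)+L_t((s_t\vee\underline\theta_t)\wedge\bar\theta_t)\big)\big]$. All expectations are understood to be finite; gradients at boundary points of $\Theta$ are understood as one-sided (equivalently, continuous extensions from the interior). Standing assumption: the policy class with $\theta\in\Theta$ contains an optimal policy; with $V^*_{T+1}=0$, $f_t(y)=L_t(y)+\mathbb E[V^*_{t+1}(y-D_t)]$, $V_t^*(s)=\min_y\{c(y,s)+f_t(y)\}$, the optimal parameters $\theta_t^*=(\underline\theta_t^*,\bar\theta_t^*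 )\in\Theta_t$ are minimizers of $ky+f_t(y)$ and $-qy+f_t(y)$ respectively. Assumptions. (B1) $s_1,D_1,\dots,D_T$ are independent. (B2) $\rho$ is $L_\rho$-Lipschitz and $F_D$ is $L_D$-Lipschitz. (B3) there is $\alpha>0$ with $\rho(\underline B)\ge\alpha$, $\rho(\bar B)\le1-\alpha$, $\mathbb P(D_t\ge\bar B-\underline B)\ge\alpha$, $\mathbb P(D_t\le\underline B-\bar B)\ge\alpha$ for all $t$. (B4) the density of $D_t$ is bounded below by $\mu_D>0$ on $[\underline B,\bar B]$. *)

theory Defs
  imports "HOL-Probability.Probability" "HOL-Computational_Algebra.Polynomial"
begin

text \<open>
  A trajectory \<open>(s\<^sub>1, D\<^sub>1, \<dots>, D\<^sub>T)\<close> is a function \<open>\<omega> \<in> {0..T} \<rightarrow>\<^sub>E UNIV\<close> with \<open>\<omega> 0 = s\<^sub>1\<close> and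
  \<open>\<omega> t = D\<^sub>t\<close> for \<open>t \<in> {1..T}\<close>. Everything depends on the random data only through the
  joint law of the trajectory, so that law is taken as the underlying probability space.
  The horizon must be able to vary under a quantifier, hence parameters
  \<open>\<theta> = (lower\<^sub>t, upper\<^sub>t)\<close> are functions on \<open>{1..T}\<close> (extensional, i.e. \<open>undefined\<close> elsewhere)
  rather than elements of a Euclidean space type.
\<close>

type_synonym trajectory = "nat \<Rightarrow> real"
type_synonym params = "nat \<Rightarrow> real \<times> real"

record cash_problem =
  horizon :: nat
  law :: "trajectory measure"
  holding :: "nat \<Rightarrow> real"
  backlog :: "nat \<Rightarrow> real"
  up_cost :: real
  down_cost :: real
  lo_bound :: real
  hi_bound :: real

definition trans_cost :: "cash_problem \<Rightarrow> real \<Rightarrow> real \<Rightarrow> real" where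
  "trans_cost C y s = (if s \<le> y then up_cost C * (y - s) else down_cost C * (s - y))"

definition mismatch_cost :: "cash_problem \<Rightarrow> nat \<Rightarrow> real \<Rightarrow> real \<Rightarrow> real" where
  "mismatch_cost C t y d = holding C t * max (y - d) 0 + backlog C t * max (- (y - d)) 0"

definition L_cost :: "cash_problem \<Rightarrow> nat \<Rightarrow> real \<Rightarrow> real" where
  "L_cost C t y = (\<integral>\<omega>. mismatch_cost C t y (\<omega> t) \<partial>law C)"


subsection \<open>Two-sided base-stock policies\<close>

definition Theta_stage :: "cash_problem \<Rightarrow> (real \<times> real) set" where
  "Theta_stage C = {(a, b). lo_bound C \<le> a \<and> a \<le> b \<and> b \<le> hi_bound C}"

definition Theta :: "cash_problem \<Rightarrow> params set" where
  "Theta C = (\<Pi>\<^sub>E t\<in>{1..horizon C}. Theta_stage C)"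

definition base_stock :: "real \<times> real \<Rightarrow> real \<Rightarrow> real" where
  "base_stock ab s = min (max s (fst ab)) (snd ab)"

text \<open>Periods are numbered from 1; the value of \<open>stock\<close> at 0 is irrelevant.\<close>

fun stock :: "params \<Rightarrow> trajectory \<Rightarrow> nat \<Rightarrow> real" where
  "stock \<theta> \<omega> 0 = undefined"
| "stock \<theta> \<omega> (Suc 0) = \<omega> 0"
| "stock \<theta> \<omega> (Suc (Suc n)) = base_stock (\<theta> (Suc n)) (stock \<theta> \<omega> (Suc n)) - \<omega> (Suc n)"

definition stage_cost :: "cash_problem \<Rightarrow> params \<Rightarrow> trajectory \<Rightarrow> nat \<Rightarrow> real" where
  "stage_cost C \<theta> \<omega> t =
     (let s = stock \<theta> \<omega> t; y = base_stock (\<theta> t) s in trans_cost C y s + L_cost C t y)"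

definition objective :: "cash_problem \<Rightarrow> params \<Rightarrow> real" where
  "objective C \<theta> = (\<integral>\<omega>. (\<Sum>t=1..horizon C. stage_cost C \<theta> \<omega> t) \<partial>law C)"


subsection \<open>Dynamic programming\<close>

definition post_cost :: "cash_problem \<Rightarrow> (nat \<Rightarrow> real \<Rightarrow> real) \<Rightarrow> nat \<Rightarrow> real \<Rightarrow> real" where
  "post_cost C V t y = L_cost C t y + (\<integral>\<omega>. V (Suc t) (y - \<omega> t) \<partial>law C)"

text \<open>The Bellman recursion determines \<open>V t\<close> for \<open>t \<in> {1..T+1}\<close>; the minima are attained.\<close>

definition optimal_value :: "cash_problem \<Rightarrow> (nat \<Rightarrow> real \<Rightarrow> real) \<Rightarrow> bool" where
  "optimal_value C V \<longleftrightarrow>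
     (\<forall>s. V (Suc (horizon C)) s = 0) \<and>
     (\<forall>t\<in>{1..horizon C}. \<forall>s. \<exists>y.
        is_arg_min (\<lambda>y. trans_cost C y s + post_cost C V t y) (\<lambda>_. True) y \<and>
        V t s = trans_cost C y s + post_cost C V t y)"

text \<open>Optimality of the base-stock policy \<open>\<theta>\<close> among all policies follows from this.\<close>

definition optimal_params :: "cash_problem \<Rightarrow> (nat \<Rightarrow> real \<Rightarrow> real) \<Rightarrow> params \<Rightarrow> bool" where
  "optimal_params C V \<theta> \<longleftrightarrow> \<theta> \<in> Theta C \<and>
     (\<forall>t\<in>{1..horizon C}.
        is_arg_min (\<lambda>y. up_cost C * y + post_cost C V t y) (\<lambda>_. True) (fst (\<theta> t)) \<and>
        is_arg_min (\<lambda>y. - down_cost C * y + post_cost C V t y) (\<lambda>_. True) (snd (\<theta> t)))"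

definition finite_expectations :: "cash_problem \<Rightarrow> (nat \<Rightarrow> real \<Rightarrow> real) \<Rightarrow> bool" where
  "finite_expectations C V \<longleftrightarrow> (\<forall>t\<in>{1..horizon C}.
     (\<forall>y. integrable (law C) (\<lambda>\<omega>. mismatch_cost C t y (\<omega> t))) \<and>
     (\<forall>y. integrable (law C) (\<lambda>\<omega>. V (Suc t) (y - \<omega> t))) \<and>
     (\<forall>\<theta>\<in>Theta C. integrable (law C) (\<lambda>\<omega>. stage_cost C \<theta> \<omega> t)))"


subsection \<open>Assumptions on the model\<close>

definition cash_model :: "cash_problem \<Rightarrow> (real \<Rightarrow> real) \<Rightarrow> (real \<Rightarrow> real) \<Rightarrow> bool" where
  "cash_model C \<rho> F \<longleftrightarrow>
     1 \<le> horizon C \<and>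
     prob_space (law C) \<and>
     sets (law C) = sets (\<Pi>\<^sub>M i\<in>{0..horizon C}. (borel :: real measure)) \<and>
     cdf (distr (law C) borel (\<lambda>\<omega>. \<omega> 0)) = \<rho> \<and>
     (\<forall>t\<in>{1..horizon C}. cdf (distr (law C) borel (\<lambda>\<omega>. \<omega> t)) = F) \<and>
     0 \<le> up_cost C + down_cost C \<and>
     (\<forall>t\<in>{1..horizon C}. 0 \<le> holding C t \<and> 0 \<le> backlog C t \<and> 0 < holding C t + backlog C t)"

definition assumption_B1 :: "cash_problem \<Rightarrow> bool" where
  "assumption_B1 C \<longleftrightarrow>
     prob_space.indep_vars (law C) (\<lambda>_. borel) (\<lambda>i \<omega>. \<omega> i) {0..horizon C}"

definition assumption_B2 :: "(real \<Rightarrow> real) \<Rightarrow> (real \<Rightarrow> real) \<Rightarrow> real \<Rightarrow> real \<Rightarrow> bool" where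
  "assumption_B2 \<rho> F L\<^sub>\<rho> L\<^sub>D \<longleftrightarrow> lipschitz_on L\<^sub>\<rho> UNIV \<rho> \<and> lipschitz_on L\<^sub>D UNIV F"

definition assumption_B3 :: "cash_problem \<Rightarrow> (real \<Rightarrow> real) \<Rightarrow> real \<Rightarrow> bool" where
  "assumption_B3 C \<rho> \<alpha> \<longleftrightarrow>
     0 < \<alpha> \<and> \<alpha> \<le> \<rho> (lo_bound C) \<and> \<rho> (hi_bound C) \<le> 1 - \<alpha> \<and>
     (\<forall>t\<in>{1..horizon C}.
        \<alpha> \<le> \<P>(\<omega> in law C. \<omega> t \<ge> hi_bound C - lo_bound C) \<and>
        \<alpha> \<le> \<P>(\<omega> in law C. \<omega> t \<le> lo_bound C - hi_bound C))"

definition assumption_B4 :: "cash_problem \<Rightarrow> real \<Rightarrow> bool" where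
  "assumption_B4 C \<mu>\<^sub>D \<longleftrightarrow> 0 < \<mu>\<^sub>D \<and>
     (\<forall>t\<in>{1..horizon C}. \<exists>f. distributed (law C) lborel (\<lambda>\<omega>. \<omega> t) f \<and>
        (\<forall>x\<in>{lo_bound C..hi_bound C}. ennreal \<mu>\<^sub>D \<le> f x))"


subsection \<open>Euclidean structure of the parameter space, gradients and projection\<close>

text \<open>
  The type \<open>real \<times> real\<close> carries the Euclidean metric, so \<open>pdist\<close> is the Euclidean distance
  on \<open>2T\<close>-dimensional parameter vectors.
\<close>

definition pdist :: "nat \<Rightarrow> params \<Rightarrow> params \<Rightarrow> real" where
  "pdist T u v = L2_set (\<lambda>t. dist (u t) (v t)) {1..T}"

text \<open>
  Frechet differentiability relative to \<open>Theta C\<close>: the ordinary gradient at interior points,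
  the one-sided one on the boundary. It is unique if \<open>Theta C\<close> has nonempty interior; otherwise
  \<open>Theta C\<close> is a single point.
\<close>

definition has_gradient :: "cash_problem \<Rightarrow> (params \<Rightarrow> real) \<Rightarrow> params \<Rightarrow> params \<Rightarrow> bool" where
  "has_gradient C l \<theta> g \<longleftrightarrow> (\<forall>e>0. \<exists>d>0. \<forall>\<theta>'\<in>Theta C. pdist (horizon C) \<theta>' \<theta> < d \<longrightarrow>
     \<bar>l \<theta>' - l \<theta> - (\<Sum>t=1..horizon C. g t \<bullet> (\<theta>' t - \<theta> t))\<bar> \<le> e * pdist (horizon C) \<theta>' \<theta>)"

definition grad :: "cash_problem \<Rightarrow> params \<Rightarrow> params" where
  "grad C \<theta> = (SOME g. has_gradient C (objective C) \<theta> g)"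

definition proj_Theta :: "cash_problem \<Rightarrow> params \<Rightarrow> params" where
  "proj_Theta C x = arg_min (pdist (horizon C) x) (\<lambda>\<theta>. \<theta> \<in> Theta C)"


subsection \<open>Stochastic policy gradient\<close>

text \<open>
  Joint measurability of the estimator is what makes the random iterates measurable.
\<close>

definition stochastic_gradient ::
    "cash_problem \<Rightarrow> (params \<Rightarrow> trajectory \<Rightarrow> params) \<Rightarrow> real \<Rightarrow> bool" where
  "stochastic_gradient C g \<sigma> \<longleftrightarrow>
     (\<forall>t\<in>{1..horizon C}. (\<lambda>(\<theta>, \<omega>). g \<theta> \<omega> t) \<in> borel_measurable
        (restrict_space (\<Pi>\<^sub>M t\<in>{1..horizon C}. borel) (Theta C) \<Otimes>\<^sub>M law C)) \<and>
     (\<forall>\<theta>\<in>Theta C.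
        (\<forall>t\<in>{1..horizon C}. has_bochner_integral (law C) (\<lambda>\<omega>. g \<theta> \<omega> t) (grad C \<theta> t)) \<and>
        integrable (law C) (\<lambda>\<omega>. (pdist (horizon C) (g \<theta> \<omega>) (grad C \<theta>))\<^sup>2) \<and>
        (\<integral>\<omega>. (pdist (horizon C) (g \<theta> \<omega>) (grad C \<theta>))\<^sup>2 \<partial>law C) \<le> \<sigma>\<^sup>2)"

text \<open>\<open>\<xi> (j, r)\<close> is the \<open>r\<close>-th trajectory simulated at iteration \<open>j\<close>.\<close>

primrec spg_iterate :: "cash_problem \<Rightarrow> (params \<Rightarrow> trajectory \<Rightarrow> params) \<Rightarrow> real \<Rightarrow> nat \<Rightarrow>
    params \<Rightarrow> (nat \<times> nat \<Rightarrow> trajectory) \<Rightarrow> nat \<Rightarrow> params" where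
  "spg_iterate C g \<gamma> N \<theta>\<^sub>0 \<xi> 0 = \<theta>\<^sub>0"
| "spg_iterate C g \<gamma> N \<theta>\<^sub>0 \<xi> (Suc j) =
     (let \<theta> = spg_iterate C g \<gamma> N \<theta>\<^sub>0 \<xi> j in
      proj_Theta C (\<lambda>t\<in>{1..horizon C}.
        \<theta> t - \<gamma> *\<^sub>R ((1 / real N) *\<^sub>R (\<Sum>r=1..N. g \<theta> (\<xi> (j, r)) t))))"

definition fresh_trajectories :: "cash_problem \<Rightarrow> nat \<Rightarrow> nat \<Rightarrow> (nat \<times> nat \<Rightarrow> trajectory) measure"
  where "fresh_trajectories C N K = (\<Pi>\<^sub>M jr\<in>{..<K} \<times> {1..N}. law C)"

text \<open>Value at \<open>(x, y)\<close> of a bivariate polynomial, seen as a polynomial in \<open>y\<close> over \<open>\<real>[x]\<close>.\<close>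

definition poly2 :: "real poly poly \<Rightarrow> real \<Rightarrow> real \<Rightarrow> real" where
  "poly2 p x y = poly (poly p [:y:]) x"

end

theory Submission
  imports Defs
begin

text \<open>
  The gradient with respect to the lower level in period \<open>t\<close> is the probability that the stock lies below
  it, at least \<open>\<alpha>\<close> by (B3), times \<open>k\<close> plus the marginal cost-to-go there. Each backward step through a
  demand with a Lipschitz distribution function worsens the Lipschitz constants of the marginal
  cost-to-go by a fixed amount only, so the objective is smooth with a constant polynomial in \<open>T\<close>.

  The optimal cost-to-go is convex and by (B4) strongly convex on the interval of admissible levels.
  An almost stationary level is therefore almost optimal for it, up to the difference \<open>\<delta>\<^sub>t\<close> between
  the marginal cost-to-go of the policy and the optimal one. Where these two disagree because the levels do,
  the disagreement is itself of the size of the residual and lives on an interval of that length,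
  so it enters quadratically: \<open>\<delta>\<^sub>t \<le> \<delta>\<^sub>t\<^sub>+\<^sub>1 + c (r\<^sup>2 + \<delta>\<^sub>t\<^sub>+\<^sub>1\<^sup>2)\<close> with \<open>r\<close> the residual in period
  \<open>t + 1\<close>. If the sum \<open>R\<close> of the squared residuals is at most of order \<open>1/T\<close>, this gives \<open>\<delta>\<^sub>t = O(R)\<close>;
  otherwise the regret is trivially \<open>O(T\<^sup>2 R)\<close> up to the bound on marginal costs. Either way the regret is
  at most a polynomial in \<open>T\<close> times \<open>R\<close>, without exponential growth.

  With smoothness, this gradient domination turns every projected stochastic gradient step into a
  contraction of the expected regret up to the variance of the batch.
\<close>

section \<open>Convolution with a Lipschitz distribution\<close>

text \<open>The obstacle is the dependence on \<open>T\<close>. Comparing marginal costs uniformly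
  would bound the error in one period by the error \<open>d\<close> of the next period plus a level
  deviation of at most \<open>r / \<alpha> + d\<close>, so it would double per period. What avoids
  this is that a deviation is felt only by stocks between the two levels, and averaging over a
  demand with Lipschitz distribution function turns an interval into a factor of the size of its
  length. The same averaging makes costs with kinks at the levels differentiable.

  The rate comes from applying the domination inequality at the new iterate. There the variational
  inequality of the projection bounds the residual by step length, change of the gradient and noise,
  and the descent estimate pays for the squared step length. With stepsize \<open>1 / S\<close> the
  regret contracts by \<open>1 + 1 / (18 * S * C\<^sub>K)\<close> up to noise, and the stationary
  noise level \<open>18 * C\<^sub>K * \<sigma>\<^sup>2 / N\<close> is free of \<open>S\<close>.
  Hence the batch size carries the factor \<open>1 / \<epsilon>\<close> and the number of iterations
  only the logarithm.\<close>

locale lipschitz_distribution = real_distribution M for M :: "real measure" +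
  fixes L :: real
  assumes lip: "lipschitz_on L UNIV (cdf M)"
begin

lemma L_nonneg: "0 \<le> L"
  using lip by (rule lipschitz_on_nonneg)

lemma cdf_lipschitz: "\<bar>cdf M x - cdf M y\<bar> \<le> L * \<bar>x - y\<bar>"
  using lipschitz_onD[OF lip, of x y] by (simp add: dist_real_def)

lemma prob_UNIV: "measure M UNIV = 1"
  using prob_space by simp

lemma measure_singleton_zero: "measure M {x} = 0"
proof -
  have "isCont (cdf M) x"
    using lipschitz_on_continuous_on[OF lip] by (simp add: continuous_on_eq_continuous_at)
  then show ?thesis by (simp add: isCont_cdf)
qed

lemma measure_Icc_le:
  assumes "a \<le> b" shows "measure M {a..b} \<le> L * (b - a)"
proof -
  have "measure M {a..b} = measure M ({a} \<union> {a<..b})"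
    using assms by (intro arg_cong[where f = "measure M"]) auto
  also have "\<dots> \<le> measure M {a} + measure M {a<..b}"
    by (rule measure_Un_le) auto
  also have "\<dots> = measure M {a<..b}" by (simp add: measure_singleton_zero)
  also have "\<dots> = cdf M b - cdf M a"
    using assms cdf_diff_eq[of a b] by (cases "a = b") auto
  also have "\<dots> \<le> L * (b - a)"
    using cdf_lipschitz[of b a] assms by (simp add: abs_le_iff)
  finally show ?thesis .
qed

lemma prob_lt_eq_cdf: "measure M {..<x} = cdf M x"
proof -
  have "cdf M x = measure M ({..<x} \<union> {x})"
    unfolding cdf_def by (intro arg_cong[where f = "measure M"]) auto
  also have "\<dots> = measure M {..<x} + measure M {x}"
    by (rule finite_measure_Union) auto
  finally show ?thesis by (simp add: measure_singleton_zero)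
qed

lemma prob_ge: "measure M {x..} = 1 - cdf M x"
proof -
  have "measure M {x..} = 1 - measure M {..<x}"
    using prob_compl[of "{..<x}"] by (simp add: Compl_eq_Diff_UNIV[symmetric] Compl_lessThan)
  then show ?thesis by (simp add: prob_lt_eq_cdf)
qed

lemma AE_neq: "AE x in M. x \<noteq> c"
proof -
  have "emeasure M {c} = 0"
    using measure_singleton_zero[of c] by (simp add: emeasure_eq_measure)
  then have "{c} \<in> null_sets M" by auto
  then show ?thesis by (auto dest: AE_not_in)
qed

text \<open>As a function of the demand \<open>x\<close> the indicator is that of
  \<open>{y - b..y - a}\<close>, an interval of the same length. Disagreements that are confined to
  an interval of stocks are averaged with this estimate.\<close>

lemma integral_between:
  assumes "a \<le> b"
  shows "integrable M (\<lambda>x. indicat_real {a..b} (y - x))"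
    "(\<integral>x. indicat_real {a..b} (y - x) \<partial>M) \<le> L * (b - a)"
proof -
  have *: "indicat_real {a..b} (y - x) = indicat_real {y - b..y - a} x" for x
    by (auto simp: indicator_def)
  show "integrable M (\<lambda>x. indicat_real {a..b} (y - x))"
    unfolding * by (rule integrable_real_indicator) (auto simp: emeasure_eq_measure)
  show "(\<integral>x. indicat_real {a..b} (y - x) \<partial>M) \<le> L * (b - a)"
    unfolding * using measure_Icc_le[of "y - b" "y - a"] assms by simp
qed

lemma integrable_shift_bounded:
  fixes w :: "real \<Rightarrow> real"
  assumes [measurable]: "w \<in> borel_measurable borel" and "\<And>z. \<bar>w z\<bar> \<le> B"
  shows "integrable M (\<lambda>x. w (y - x))"
  by (rule integrable_const_bound[where B = B]) (use assms in auto)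

text \<open>Two shifts of a Lipschitz function differ by a bounded function, so integrability at one
  shift gives it at all of them.\<close>

lemma integrable_shift:
  fixes w :: "real \<Rightarrow> real"
  assumes [measurable]: "w \<in> borel_measurable borel"
    and w: "\<And>z z'. \<bar>w z - w z'\<bar> \<le> K * \<bar>z - z'\<bar>"
    and int: "integrable M (\<lambda>x. w (y - x))"
  shows "integrable M (\<lambda>x. w (y' - x))"
proof -
  have "integrable M (\<lambda>x. w (y' - x) - w (y - x))"
    by (rule integrable_const_bound[where B = "K * \<bar>y' - y\<bar>"])
      (use w[of "y' - x" "y - x" for x] in auto)
  from Bochner_Integration.integrable_add[OF this int] show ?thesis by simp
qed

lemma convolution_lipschitz:
  fixes w :: "real \<Rightarrow> real"
  assumes "\<And>y. integrable M (\<lambda>x. w (y - x))"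
    and w: "\<And>z z'. \<bar>w z - w z'\<bar> \<le> K * \<bar>z - z'\<bar>"
  shows "\<bar>(\<integral>x. w (y - x) \<partial>M) - (\<integral>x. w (y' - x) \<partial>M)\<bar> \<le> K * \<bar>y - y'\<bar>"
proof -
  have "\<bar>(\<integral>x. w (y - x) \<partial>M) - (\<integral>x. w (y' - x) \<partial>M)\<bar> = \<bar>\<integral>x. w (y - x) - w (y' - x) \<partial>M\<bar>"
    using assms(1) by simp
  also have "\<dots> \<le> (\<integral>x. K * \<bar>y - y'\<bar> \<partial>M)"
    using w[of "y - x" "y' - x" for x] assms(1)
    by (intro order_trans[OF integral_abs_bound] integral_mono) auto
  finally show ?thesis by (simp add: prob_UNIV)
qed

text \<open>A jump of size \<open>J c\<close> at \<open>c\<close> is felt by the pair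
  \<open>y\<close>, \<open>y'\<close> only if the demand puts \<open>c\<close> between
  \<open>y - x\<close> and \<open>y' - x\<close>, an event of probability at most \<open>L\<close>
  times the distance. Averaging thus turns jumps into slope, while the Lipschitz part
  \<open>K\<close> passes through unchanged; that \<open>K\<close> is not multiplied keeps the later
  recursions additive.\<close>

lemma convolution_piecewise_lipschitz:
  fixes w :: "real \<Rightarrow> real"
  assumes [measurable]: "w \<in> borel_measurable borel" and bd: "\<And>z. \<bar>w z\<bar> \<le> B"
    and S: "finite S"
    and w: "\<And>z z'. z \<le> z' \<Longrightarrow> \<bar>w z' - w z\<bar> \<le> K * (z' - z) + (\<Sum>c\<in>S. J c * indicat_real {z..z'} c)"
    and J: "\<And>c. c \<in> S \<Longrightarrow> 0 \<le> J c"
  shows "\<bar>(\<integral>x. w (y - x) \<partial>M) - (\<integral>x. w (y' - x) \<partial>M)\<bar> \<le> (K + (\<Sum>c\<in>S. J c) * L) * \<bar>y - y'\<bar>"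
proof -
  have *: "\<bar>(\<integral>x. w (y' - x) \<partial>M) - (\<integral>x. w (y - x) \<partial>M)\<bar> \<le> (K + (\<Sum>c\<in>S. J c) * L) * (y' - y)"
    if "y \<le> y'" for y y'
  proof -
    have ind: "indicat_real {y - x..y' - x} c = indicat_real {y - c..y' - c} x" for x c
      by (auto simp: indicator_def)
    have int: "integrable M (\<lambda>x. w (y - x))" for y
      by (rule integrable_shift_bounded[OF assms(1) bd])
    have "\<bar>(\<integral>x. w (y' - x) \<partial>M) - (\<integral>x. w (y - x) \<partial>M)\<bar> = \<bar>\<integral>x. w (y' - x) - w (y - x) \<partial>M\<bar>"
      using int by simp
    also have "\<dots> \<le> (\<integral>x. K * (y' - y) + (\<Sum>c\<in>S. J c * indicat_real {y - c..y' - c} x) \<partial>M)"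
    proof (intro order_trans[OF integral_abs_bound] integral_mono)
      show "integrable M (\<lambda>x. K * (y' - y) + (\<Sum>c\<in>S. J c * indicat_real {y - c..y' - c} x))"
        by (intro Bochner_Integration.integrable_add Bochner_Integration.integrable_sum integrable_mult_right integrable_real_indicator)
          (auto simp: emeasure_eq_measure)
      show "\<bar>w (y' - x) - w (y - x)\<bar> \<le> K * (y' - y) + (\<Sum>c\<in>S. J c * indicat_real {y - c..y' - c} x)" for x
        using w[of "y - x" "y' - x"] that by (simp add: ind[of x])
    qed (use int in auto)
    also have "\<dots> = K * (y' - y) + (\<Sum>c\<in>S. J c * measure M {y - c..y' - c})"
      by (subst Bochner_Integration.integral_add)
        (auto intro!: Bochner_Integration.integrable_sum integrable_real_indicator simp: prob_UNIV emeasure_eq_measure)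
    also have "\<dots> \<le> K * (y' - y) + (\<Sum>c\<in>S. J c * (L * (y' - y)))"
      using measure_Icc_le[of "y - c" "y' - c" for c] that J
      by (intro add_left_mono sum_mono mult_left_mono) auto
    also have "\<dots> = (K + (\<Sum>c\<in>S. J c) * L) * (y' - y)"
      by (simp only: sum_distrib_right[symmetric]) (simp add: algebra_simps)
    finally show ?thesis .
  qed
  show ?thesis
    using *[of y y'] *[of y' y] by (cases "y \<le> y'") (simp_all add: abs_minus_commute)
qed

text \<open>Dominated convergence: the difference quotients are bounded by \<open>K\<close> and
  converge unless \<open>y - x\<close> is one of the finitely many kinks in \<open>S\<close>, which
  happens with probability zero because there are no atoms. The average is therefore differentiable
  everywhere.\<close>

lemma convolution_has_derivative:
  fixes w w' :: "real \<Rightarrow> real"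
  assumes int: "\<And>y. integrable M (\<lambda>x. w (y - x))"
    and w: "\<And>z z'. \<bar>w z - w z'\<bar> \<le> K * \<bar>z - z'\<bar>"
    and [measurable]: "w' \<in> borel_measurable borel"
    and S: "finite S" and der: "\<And>z. z \<notin> S \<Longrightarrow> (w has_real_derivative w' z) (at z)"
  shows "((\<lambda>y. \<integral>x. w (y - x) \<partial>M) has_real_derivative (\<integral>x. w' (y - x) \<partial>M)) (at y)"
  unfolding has_field_derivative_iff tendsto_at_iff_sequentially comp_def
proof (intro allI impI)
  fix X :: "nat \<Rightarrow> real"
  assume X: "\<forall>i. X i \<in> UNIV - {y}" "X \<longlonglongrightarrow> y"
  have ne: "X i - y \<noteq> 0" for i using X(1) by auto
  have eq: "((\<integral>x. w (X i - x) \<partial>M) - (\<integral>x. w (y - x) \<partial>M)) / (X i - y)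
      = (\<integral>x. (w (X i - x) - w (y - x)) / (X i - y) \<partial>M)" for i
    using int by simp
  have "(\<lambda>i. \<integral>x. (w (X i - x) - w (y - x)) / (X i - y) \<partial>M) \<longlonglongrightarrow> (\<integral>x. w' (y - x) \<partial>M)"
  proof (rule integral_dominated_convergence[where w = "\<lambda>_. K"])
    have "AE x in M. \<forall>c\<in>S. x \<noteq> y - c"
      using S by (intro AE_finite_allI AE_neq) auto
    then show "AE x in M. (\<lambda>i. (w (X i - x) - w (y - x)) / (X i - y)) \<longlonglongrightarrow> w' (y - x)"
    proof (rule AE_mp, intro AE_I2 impI)
      fix x assume "\<forall>c\<in>S. x \<noteq> y - c"
      then have "y - x \<notin> S" by force
      from der[OF this]
      have "((\<lambda>z. (w z - w (y - x)) / (z - (y - x))) \<longlongrightarrow> w' (y - x)) (at (y - x))"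
        by (simp add: has_field_derivative_iff)
      moreover have "\<forall>i. X i - x \<in> UNIV - {y - x}" "(\<lambda>i. X i - x) \<longlonglongrightarrow> y - x"
        using X by (auto intro: tendsto_intros)
      ultimately have "((\<lambda>z. (w z - w (y - x)) / (z - (y - x))) \<circ> (\<lambda>i. X i - x)) \<longlonglongrightarrow> w' (y - x)"
        unfolding tendsto_at_iff_sequentially by (elim allE[where x = "\<lambda>i. X i - x"]) blast
      then show "(\<lambda>i. (w (X i - x) - w (y - x)) / (X i - y)) \<longlonglongrightarrow> w' (y - x)"
        by (simp add: comp_def)
    qed
    show "AE x in M. norm ((w (X i - x) - w (y - x)) / (X i - y)) \<le> K" for i
    proof (intro AE_I2)
      fix x
      have "\<bar>w (X i - x) - w (y - x)\<bar> \<le> K * \<bar>X i - y\<bar>"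
        using w[of "X i - x" "y - x"] by simp
      then show "norm ((w (X i - x) - w (y - x)) / (X i - y)) \<le> K"
        using ne[of i] by (simp add: field_simps abs_divide)
    qed
    show "(\<lambda>x. (w (X i - x) - w (y - x)) / (X i - y)) \<in> borel_measurable M" for i
      using int by (intro borel_measurable_integrable) auto
  qed auto
  then show "(\<lambda>i. ((\<integral>x. w (X i - x) \<partial>M) - (\<integral>x. w (y - x) \<partial>M)) / (X i - y))
      \<longlonglongrightarrow> (\<integral>x. w' (y - x) \<partial>M)"
    unfolding eq .
qed

end

section \<open>Clamping to an interval; variance of sums of independent copies; mismatch
  costs\<close>

lemma base_stock_between:
  assumes "fst ab \<le> snd ab" shows "fst ab \<le> base_stock ab s" "base_stock ab s \<le> snd ab"
  using assms by (auto simp: base_stock_def)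

lemma base_stock_lipschitz:
  assumes "\<bar>fst ab - fst cd\<bar> \<le> e" "\<bar>snd ab - snd cd\<bar> \<le> e" "\<bar>s - s'\<bar> \<le> e"
  shows "\<bar>base_stock ab s - base_stock cd s'\<bar> \<le> e"
proof -
  have "\<bar>max s (fst ab) - max s' (fst cd)\<bar> \<le> e"
    using assms(1,3) by linarith
  then show ?thesis
    using assms(2) unfolding base_stock_def by linarith
qed

text \<open>Expanding the square leaves only the diagonal: off the diagonal the expectation
  factorises and both factors vanish. This is the source of the \<open>1 / N\<close> decay of the
  batch variance.\<close>

lemma pi_sum_sq_integral:
  fixes Z :: "'a \<Rightarrow> real"
  assumes "prob_space M" and J: "finite J"
    and Z: "integrable M (\<lambda>x. (Z x)\<^sup>2)" "integrable M Z" "(\<integral>x. Z x \<partial>M) = 0"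
  shows "integrable (\<Pi>\<^sub>M i\<in>J. M) (\<lambda>\<xi>. (\<Sum>i\<in>J. Z (\<xi> i))\<^sup>2)"
    "(\<integral>\<xi>. (\<Sum>i\<in>J. Z (\<xi> i))\<^sup>2 \<partial>(\<Pi>\<^sub>M i\<in>J. M)) = real (card J) * (\<integral>x. (Z x)\<^sup>2 \<partial>M)"
proof -
  interpret prob_space M by fact
  interpret P: product_prob_space "\<lambda>_. M" J by standard
  have [measurable]: "Z \<in> borel_measurable M" using Z(2) by auto
  have sq: "(\<Sum>i\<in>J. Z (\<xi> i))\<^sup>2 = (\<Sum>i\<in>J. \<Sum>j\<in>J. Z (\<xi> i) * Z (\<xi> j))" for \<xi>
    by (simp add: power2_eq_square sum_product)
  have pr: "integrable (\<Pi>\<^sub>M i\<in>J. M) (\<lambda>\<xi>. Z (\<xi> i) * Z (\<xi> j)) \<and>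
    (\<integral>\<xi>. Z (\<xi> i) * Z (\<xi> j) \<partial>(\<Pi>\<^sub>M i\<in>J. M)) = (if i = j then \<integral>x. (Z x)\<^sup>2 \<partial>M else 0)"
    if ij: "i \<in> J" "j \<in> J" for i j
  proof (cases "i = j")
    case True
    have d: "distr (\<Pi>\<^sub>M i\<in>J. M) M (\<lambda>\<xi>. \<xi> i) = M"
      using distr_PiM_component[of J "\<lambda>_. M" i] ij prob_space_axioms by simp
    have m: "(\<lambda>\<xi>. \<xi> i) \<in> measurable (\<Pi>\<^sub>M i\<in>J. M) M"
      using ij by measurable
    have "integrable (\<Pi>\<^sub>M i\<in>J. M) (\<lambda>\<xi>. (Z (\<xi> i))\<^sup>2)"
      by (rule integrable_distr[OF m, unfolded d]) (rule Z(1))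
    moreover have "(\<integral>\<xi>. (Z (\<xi> i))\<^sup>2 \<partial>(\<Pi>\<^sub>M i\<in>J. M)) = (\<integral>x. (Z x)\<^sup>2 \<partial>M)"
      by (subst integral_distr[OF m, unfolded d]) simp_all
    ultimately show ?thesis
      using True by (simp add: power2_eq_square)
  next
    case False
    \<comment> \<open>Padding with constant factors 1 writes the product of two coordinates as a
      product over all of \<open>J\<close>, the form for which integrals over the product measure
      factorise.\<close>
    define f where "f l = (if l = i \<or> l = j then Z else (\<lambda>_. 1))" for l
    have fi: "integrable M (f l)" for l unfolding f_def using Z(2) by auto
    have prod: "(\<Prod>l\<in>J. f l (\<xi> l)) = Z (\<xi> i) * Z (\<xi> j)" for \<xi>
    proof -
      have "(\<Prod>l\<in>J. f l (\<xi> l)) = (\<Prod>l\<in>{i, j}. f l (\<xi> l))"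
        using ij J by (intro prod.mono_neutral_right) (auto simp: f_def)
      also have "\<dots> = Z (\<xi> i) * Z (\<xi> j)" using False by (simp add: f_def)
      finally show ?thesis .
    qed
    have prod0: "(\<Prod>l\<in>J. integral\<^sup>L M (f l)) = 0"
      using ij J Z(3) by (intro prod_zero) (auto simp: f_def)
    show ?thesis
      using P.product_integrable_prod[where f = f, OF J fi] P.product_integral_prod[where f = f, OF J fi] False
      unfolding prod prod0 by simp
  qed
  show "integrable (\<Pi>\<^sub>M i\<in>J. M) (\<lambda>\<xi>. (\<Sum>i\<in>J. Z (\<xi> i))\<^sup>2)"
    unfolding sq using pr by (intro Bochner_Integration.integrable_sum) auto
  have "(\<integral>\<xi>. (\<Sum>i\<in>J. Z (\<xi> i))\<^sup>2 \<partial>(\<Pi>\<^sub>M i\<in>J. M)) = (\<Sum>i\<in>J. \<Sum>j\<in>J. if i = j then \<integral>x. (Z x)\<^sup>2 \<partial>M else 0)"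
    unfolding sq using pr by (simp add: Bochner_Integration.integral_sum)
  then show "(\<integral>\<xi>. (\<Sum>i\<in>J. Z (\<xi> i))\<^sup>2 \<partial>(\<Pi>\<^sub>M i\<in>J. M)) = real (card J) * (\<integral>x. (Z x)\<^sup>2 \<partial>M)"
    using J by simp
qed

text \<open>The mismatch cost depends on level and demand only through \<open>z = y - d\<close>; in
  this variable \<open>L_cost\<close> is a convolution with the demand law.\<close>

definition mismatch_rate :: "cash_problem \<Rightarrow> nat \<Rightarrow> real \<Rightarrow> real" where
  "mismatch_rate C t z = holding C t * max z 0 + backlog C t * max (- z) 0"

definition mismatch_slope :: "cash_problem \<Rightarrow> nat \<Rightarrow> real \<Rightarrow> real" where
  "mismatch_slope C t z = (if z \<le> 0 then - backlog C t else holding C t)"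

section \<open>Costs and trajectories under base-stock policies\<close>

locale cash_balance =
  fixes C :: cash_problem and L\<^sub>D L\<^sub>\<rho> M :: real
  assumes horizon_pos: "1 \<le> horizon C"
    and prob: "prob_space (law C)"
    and sets_law: "sets (law C) = sets (\<Pi>\<^sub>M i\<in>{0..horizon C}. (borel :: real measure))"
    and identical: "\<And>t. t \<in> {1..horizon C} \<Longrightarrow>
      cdf (distr (law C) borel (\<lambda>\<omega>. \<omega> t)) = cdf (distr (law C) borel (\<lambda>\<omega>. \<omega> 1))"
    and lip_demand: "lipschitz_on L\<^sub>D UNIV (cdf (distr (law C) borel (\<lambda>\<omega>. \<omega> 1)))"
    and lip_initial: "lipschitz_on L\<^sub>\<rho> UNIV (cdf (distr (law C) borel (\<lambda>\<omega>. \<omega> 0)))"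
    and cost_sum: "0 \<le> up_cost C + down_cost C"
    and rates: "\<And>t. t \<in> {1..horizon C} \<Longrightarrow>
      0 \<le> holding C t \<and> holding C t \<le> M \<and> 0 \<le> backlog C t \<and> backlog C t \<le> M"
    and indep: "prob_space.indep_vars (law C) (\<lambda>_. borel) (\<lambda>i \<omega>. \<omega> i) {0..horizon C}"
    and bounds: "lo_bound C \<le> hi_bound C"
    and int_mismatch: "\<And>t y. t \<in> {1..horizon C} \<Longrightarrow>
      integrable (law C) (\<lambda>\<omega>. mismatch_cost C t y (\<omega> t))"
    and int_stage: "\<And>t \<theta>. t \<in> {1..horizon C} \<Longrightarrow> \<theta> \<in> Theta C \<Longrightarrow>
      integrable (law C) (\<lambda>\<omega>. stage_cost C \<theta> \<omega> t)"
begin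

abbreviation "T \<equiv> horizon C"
abbreviation "k \<equiv> up_cost C"
abbreviation "q \<equiv> down_cost C"
abbreviation "B\<^sub>l \<equiv> lo_bound C"
abbreviation "B\<^sub>u \<equiv> hi_bound C"
abbreviation "lo \<theta> t \<equiv> fst (\<theta> t :: real \<times> real)"
abbreviation "hi \<theta> t \<equiv> snd (\<theta> t :: real \<times> real)"
abbreviation "post_stock \<theta> \<omega> t \<equiv> base_stock (\<theta> t) (stock \<theta> \<omega> t)"

definition demand :: "real measure" where
  "demand = distr (law C) borel (\<lambda>\<omega>. \<omega> 1)"

sublocale law: prob_space "law C"
  by (rule prob)

lemma measurable_law_eq: "measurable (law C) N = measurable (\<Pi>\<^sub>M i\<in>{0..T}. (borel :: real measure)) N"
  by (rule measurable_cong_sets[OF sets_law refl])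

lemma coordinate_measurable:
  "t \<in> {0..T} \<Longrightarrow> (\<lambda>\<omega>. \<omega> t) \<in> borel_measurable (law C)"
  unfolding measurable_law_eq by (rule measurable_component_singleton)

sublocale D: lipschitz_distribution demand L\<^sub>D
proof -
  have "real_distribution demand"
    unfolding demand_def using horizon_pos
    by (intro law.real_distribution_distr coordinate_measurable) auto
  then show "lipschitz_distribution demand L\<^sub>D"
    using lip_demand
    by (auto simp: lipschitz_distribution_def lipschitz_distribution_axioms_def demand_def)
qed

lemma distr_demand:
  assumes "t \<in> {1..T}" shows "distr (law C) borel (\<lambda>\<omega>. \<omega> t) = demand"
proof (rule cdf_unique)
  show "real_distribution (distr (law C) borel (\<lambda>\<omega>. \<omega> t))"
    using assms by (intro law.real_distribution_distr coordinate_measurable) auto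
  show "real_distribution demand" by unfold_locales
  show "cdf (distr (law C) borel (\<lambda>\<omega>. \<omega> t)) = cdf demand"
    unfolding demand_def by (rule identical[OF assms])
qed

lemma integral_demand:
  fixes w :: "real \<Rightarrow> real"
  assumes t: "t \<in> {1..T}" and [measurable]: "w \<in> borel_measurable borel"
  shows "(\<integral>\<omega>. w (\<omega> t) \<partial>law C) = (\<integral>x. w x \<partial>demand)"
    "integrable (law C) (\<lambda>\<omega>. w (\<omega> t)) \<longleftrightarrow> integrable demand w"
proof -
  have [measurable]: "(\<lambda>\<omega>. \<omega> t) \<in> borel_measurable (law C)"
    using t by (intro coordinate_measurable) auto
  show "(\<integral>\<omega>. w (\<omega> t) \<partial>law C) = (\<integral>x. w x \<partial>demand)"
    unfolding distr_demand[OF t, symmetric] by (subst integral_distr) auto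
  show "integrable (law C) (\<lambda>\<omega>. w (\<omega> t)) \<longleftrightarrow> integrable demand w"
    unfolding distr_demand[OF t, symmetric] by (subst integrable_distr_eq) auto
qed

lemma M_nonneg: "0 \<le> M"
  using rates[of 1] horizon_pos by force

lemma backward_induct [consumes 2, case_names last step]:
  assumes "1 \<le> t" "t \<le> Suc T" "P (Suc T)"
    and "\<And>t. 1 \<le> t \<Longrightarrow> t \<le> T \<Longrightarrow> P (Suc t) \<Longrightarrow> P t"
  shows "P t"
  using assms(2,1)
proof (induction rule: inc_induct)
  case base show ?case by (rule assms(3))
next
  case (step n) then show ?case using assms(4)[of n] by auto
qed

lemma Theta_D:
  assumes "\<theta> \<in> Theta C" "t \<in> {1..T}"
  shows "B\<^sub>l \<le> lo \<theta> t" "lo \<theta> t \<le> hi \<theta> t" "hi \<theta> t \<le> B\<^sub>u" "\<theta> t \<in> Theta_stage C"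
proof -
  show st: "\<theta> t \<in> Theta_stage C"
    using assms by (auto simp: Theta_def)
  show "B\<^sub>l \<le> lo \<theta> t" "lo \<theta> t \<le> hi \<theta> t" "hi \<theta> t \<le> B\<^sub>u"
    using st by (auto simp: Theta_stage_def)
qed

lemma post_stock_bounds:
  assumes "\<theta> \<in> Theta C" "t \<in> {1..T}"
  shows "B\<^sub>l \<le> base_stock (\<theta> t) s" "base_stock (\<theta> t) s \<le> B\<^sub>u"
  using base_stock_between[OF Theta_D(2)[OF assms], of s] Theta_D[OF assms] by auto

lemma stock_Suc: "1 \<le> t \<Longrightarrow> stock \<theta> \<omega> (Suc t) = post_stock \<theta> \<omega> t - \<omega> t"
  by (cases t) auto

lemma base_stock_measurable [measurable]:
  assumes [measurable]: "f \<in> borel_measurable N" "g \<in> borel_measurable N"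
  shows "(\<lambda>x. base_stock (f x) (g x)) \<in> borel_measurable N"
proof -
  have "fst \<in> borel_measurable (borel :: (real \<times> real) measure)"
    "snd \<in> borel_measurable (borel :: (real \<times> real) measure)"
    by (intro borel_measurable_continuous_onI continuous_intros)+
  then have [measurable]: "(\<lambda>x. fst (f x)) \<in> borel_measurable N" "(\<lambda>x. snd (f x)) \<in> borel_measurable N"
    by (auto intro: measurable_compose[OF assms(1)])
  show ?thesis unfolding base_stock_def by measurable
qed

lemma base_stock_const_measurable [measurable]:
  "g \<in> borel_measurable N \<Longrightarrow> (\<lambda>x. base_stock c (g x)) \<in> borel_measurable N"
  by (rule base_stock_measurable) auto

lemma trans_cost_measurable [measurable]:
  assumes [measurable]: "f \<in> borel_measurable N" "g \<in> borel_measurable N"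
  shows "(\<lambda>x. trans_cost C (f x) (g x)) \<in> borel_measurable N"
  unfolding trans_cost_def by measurable

text \<open>The stock in period \<open>t\<close> is a function of the coordinates below
  \<open>t\<close> alone; measurability with respect to just these is what makes it independent of
  the demand of period \<open>t\<close>.\<close>

lemma stock_measurable_past:
  assumes "1 \<le> t" "{0..<t} \<subseteq> A"
  shows "(\<lambda>\<omega>. stock \<theta> \<omega> t) \<in> borel_measurable (\<Pi>\<^sub>M i\<in>A. borel)"
  using assms
proof (induction t rule: dec_induct)
  case base
  then show ?case by auto
next
  case (step n)
  have [measurable]: "(\<lambda>\<omega>. stock \<theta> \<omega> n) \<in> borel_measurable (\<Pi>\<^sub>M i\<in>A. borel)"
    using step by (intro step.IH) auto
  have [measurable]: "(\<lambda>\<omega>. \<omega> n) \<in> borel_measurable (\<Pi>\<^sub>M i\<in>A. (borel :: real measure))"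
    using step by (intro measurable_component_singleton) auto
  show ?case unfolding stock_Suc[OF step(1)] by measurable
qed

lemma stock_measurable [measurable]:
  "t \<in> {1..Suc T} \<Longrightarrow> (\<lambda>\<omega>. stock \<theta> \<omega> t) \<in> borel_measurable (law C)"
  unfolding measurable_law_eq by (intro stock_measurable_past) auto

lemma stock_restrict:
  assumes "1 \<le> t" "{0..<t} \<subseteq> A" shows "stock \<theta> (restrict \<omega> A) t = stock \<theta> \<omega> t"
  using assms
proof (induction t rule: dec_induct)
  case (step n)
  then have sub: "{0..<n} \<subseteq> A" and "n \<in> A" by auto
  from step.IH[OF sub] have eq: "stock \<theta> (restrict \<omega> A) n = stock \<theta> \<omega> n" .
  then show ?case
    unfolding stock_Suc[OF step(1)] eq using \<open>n \<in> A\<close> by simp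
qed auto

text \<open>On a fixed path both policies face the same demands and clamping is nonexpansive, so
  perturbations of the levels do not add up over time: the bound is \<open>e\<close>, with no
  dependence on \<open>t\<close>.\<close>

lemma stock_lipschitz:
  assumes "1 \<le> t" "0 \<le> e"
    and "\<And>i. 1 \<le> i \<Longrightarrow> i < t \<Longrightarrow> \<bar>lo \<theta> i - lo \<theta>' i\<bar> \<le> e \<and> \<bar>hi \<theta> i - hi \<theta>' i\<bar> \<le> e"
  shows "\<bar>stock \<theta> \<omega> t - stock \<theta>' \<omega> t\<bar> \<le> e"
  using assms
proof (induction t rule: dec_induct)
  case (step n)
  then have "\<bar>stock \<theta> \<omega> n - stock \<theta>' \<omega> n\<bar> \<le> e" by auto
  then show ?case
    using base_stock_lipschitz[of "\<theta> n" "\<theta>' n" e] step.prems(2)[of n] step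
    by (simp add: stock_Suc)
qed auto

text \<open>Fubini for the pair of post-decision stock and current demand, which are independent
  because the former depends only on the coordinates below \<open>t\<close>. The stock can thus be
  frozen while demand is averaged out.\<close>

lemma expectation_fresh:
  fixes w :: "real \<Rightarrow> real \<Rightarrow> real"
  assumes t: "t \<in> {1..T}"
    and w [measurable]: "(\<lambda>(y, x). w y x) \<in> borel_measurable (borel \<Otimes>\<^sub>M borel)"
    and int: "integrable (law C) (\<lambda>\<omega>. w (post_stock \<theta> \<omega> t) (\<omega> t))"
  shows "(\<integral>\<omega>. w (post_stock \<theta> \<omega> t) (\<omega> t) \<partial>law C) = (\<integral>\<omega>. (\<integral>x. w (post_stock \<theta> \<omega> t) x \<partial>demand) \<partial>law C)"
    "integrable (law C) (\<lambda>\<omega>. (\<integral>x. w (post_stock \<theta> \<omega> t) x \<partial>demand))"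
proof -
  let ?Y = "\<lambda>\<omega>. post_stock \<theta> \<omega> t"
  have [measurable]: "(\<lambda>\<omega>. stock \<theta> \<omega> t) \<in> borel_measurable (law C)"
    using t by (intro stock_measurable) auto
  have Ym [measurable]: "?Y \<in> borel_measurable (law C)" by measurable
  have tm [measurable]: "(\<lambda>\<omega>. \<omega> t) \<in> borel_measurable (law C)"
    using t by (intro coordinate_measurable) auto
  have "law.indep_var (\<Pi>\<^sub>M i\<in>{0..<t}. borel) (\<lambda>\<omega>. restrict (\<lambda>i. \<omega> i) {0..<t})
      (\<Pi>\<^sub>M i\<in>{t}. borel) (\<lambda>\<omega>. restrict (\<lambda>i. \<omega> i) {t})"
    using t by (intro law.indep_var_restrict[OF indep]) auto
  then have "law.indep_var borel (?Y \<circ> (\<lambda>\<omega>. restrict (\<lambda>i. \<omega> i) {0..<t}))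
      borel ((\<lambda>\<omega>. \<omega> t) \<circ> (\<lambda>\<omega>. restrict (\<lambda>i. \<omega> i) {t}))"
  proof (rule law.indep_var_compose)
    have [measurable]: "(\<lambda>\<omega>. stock \<theta> \<omega> t) \<in> borel_measurable (\<Pi>\<^sub>M i\<in>{0..<t}. borel)"
      using t by (intro stock_measurable_past) auto
    show "?Y \<in> borel_measurable (\<Pi>\<^sub>M i\<in>{0..<t}. borel)" by measurable
  qed auto
  moreover have "?Y \<circ> (\<lambda>\<omega>. restrict (\<lambda>i. \<omega> i) {0..<t}) = ?Y"
    using t by (auto simp: fun_eq_iff stock_restrict)
  ultimately have "law.indep_var borel ?Y borel (\<lambda>\<omega>. \<omega> t)"
    by (simp add: comp_def)
  then have eq: "distr (law C) borel ?Y \<Otimes>\<^sub>M demand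
      = distr (law C) (borel \<Otimes>\<^sub>M borel) (\<lambda>\<omega>. (?Y \<omega>, \<omega> t))"
    unfolding law.indep_var_distribution_eq distr_demand[OF t] by auto
  interpret Y: prob_space "distr (law C) borel ?Y" by (rule law.prob_space_distr) fact
  interpret P: pair_prob_space "distr (law C) borel ?Y" demand by standard
  have int': "integrable (distr (law C) borel ?Y \<Otimes>\<^sub>M demand) (\<lambda>(y, x). w y x)"
    unfolding eq by (subst integrable_distr_eq) (use int in auto)
  have inner [measurable]: "(\<lambda>y. \<integral>x. w y x \<partial>demand) \<in> borel_measurable borel"
    by (rule D.borel_measurable_lebesgue_integral) (simp add: split_beta' measurable_cong_sets[OF sets_pair_measure_cong[OF refl D.events_eq_borel]])
  have "(\<integral>\<omega>. w (?Y \<omega>) (\<omega> t) \<partial>law C) = (\<integral>z. (\<lambda>(y, x). w y x) z \<partial>(distr (law C) borel ?Y \<Otimes>\<^sub>M demand))"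
    unfolding eq by (subst integral_distr) auto
  also have "\<dots> = (\<integral>y. (\<integral>x. w y x \<partial>demand) \<partial>distr (law C) borel ?Y)"
    using P.integral_fst'[OF int'] by simp
  also have "\<dots> = (\<integral>\<omega>. (\<integral>x. w (?Y \<omega>) x \<partial>demand) \<partial>law C)"
    by (subst integral_distr) auto
  finally show "(\<integral>\<omega>. w (?Y \<omega>) (\<omega> t) \<partial>law C) = (\<integral>\<omega>. (\<integral>x. w (?Y \<omega>) x \<partial>demand) \<partial>law C)" .
  have "integrable (distr (law C) borel ?Y) (\<lambda>y. \<integral>x. w y x \<partial>demand)"
    using P.integrable_fst'[OF int'] by simp
  then show "integrable (law C) (\<lambda>\<omega>. (\<integral>x. w (?Y \<omega>) x \<partial>demand))"
    by (subst (asm) integrable_distr_eq) auto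
qed

lemma mismatch_rate_lipschitz:
  assumes "t \<in> {1..T}"
  shows "\<bar>mismatch_rate C t z - mismatch_rate C t z'\<bar> \<le> M * \<bar>z - z'\<bar>"
proof -
  have *: "\<bar>mismatch_rate C t z - mismatch_rate C t z'\<bar> \<le> M * \<bar>z - z'\<bar>" if "z \<le> z'" for z z'
  proof -
    have b: "0 \<le> holding C t" "holding C t \<le> M" "0 \<le> backlog C t" "backlog C t \<le> M"
      using rates[OF assms] by auto
    define u v where "u = max z' 0 - max z 0" and "v = max (- z) 0 - max (- z') 0"
    have uv: "0 \<le> u" "0 \<le> v" "u + v = z' - z" using that by (auto simp: u_def v_def)
    have "mismatch_rate C t z - mismatch_rate C t z' = backlog C t * v - holding C t * u"
      by (simp add: mismatch_rate_def u_def v_def algebra_simps)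
    moreover have "backlog C t * v \<le> M * v" "holding C t * u \<le> M * u" "0 \<le> backlog C t * v" "0 \<le> holding C t * u"
      using b uv by (auto intro: mult_right_mono)
    moreover have "M * \<bar>z - z'\<bar> = M * u + M * v" using uv that by (simp add: distrib_left[symmetric])
    ultimately show ?thesis by linarith
  qed
  show ?thesis using *[of z z'] *[of z' z] by (cases "z \<le> z'") (auto simp: abs_minus_commute)
qed

lemma mismatch_rate_measurable [measurable]: "mismatch_rate C t \<in> borel_measurable borel"
  unfolding mismatch_rate_def[abs_def] by measurable

lemma mismatch_slope_measurable [measurable]: "mismatch_slope C t \<in> borel_measurable borel"
  unfolding mismatch_slope_def[abs_def] by measurable

lemma mismatch_slope_abs_le: "t \<in> {1..T} \<Longrightarrow> \<bar>mismatch_slope C t z\<bar> \<le> M"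
  using rates[of t] by (auto simp: mismatch_slope_def)

lemma mismatch_rate_has_derivative:
  assumes "z \<noteq> 0"
  shows "(mismatch_rate C t has_real_derivative mismatch_slope C t z) (at z)"
proof (cases "z < 0")
  case True
  have "((\<lambda>z. backlog C t * (- z)) has_real_derivative mismatch_slope C t z) (at z)"
    using True by (auto intro!: derivative_eq_intros simp: mismatch_slope_def)
  then show ?thesis
    by (rule has_field_derivative_transform_within_open[where S = "{..<0}"])
      (use True in \<open>auto simp: mismatch_rate_def\<close>)
next
  case False
  then have z: "0 < z" using assms by simp
  have "((\<lambda>z. holding C t * z) has_real_derivative mismatch_slope C t z) (at z)"
    using z by (auto intro!: derivative_eq_intros simp: mismatch_slope_def)
  then show ?thesis
    by (rule has_field_derivative_transform_within_open[where S = "{0<..}"])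
      (use z in \<open>auto simp: mismatch_rate_def\<close>)
qed

lemma mismatch_rate_integrable: "t \<in> {1..T} \<Longrightarrow> integrable demand (\<lambda>x. mismatch_rate C t (y - x))"
  using int_mismatch[of t y] integral_demand(2)[of t "\<lambda>x. mismatch_rate C t (y - x)"]
  by (simp add: mismatch_cost_def mismatch_rate_def)

lemma L_cost_eq: "t \<in> {1..T} \<Longrightarrow> L_cost C t y = (\<integral>x. mismatch_rate C t (y - x) \<partial>demand)"
  using integral_demand(1)[of t "\<lambda>x. mismatch_rate C t (y - x)"]
  by (simp add: L_cost_def mismatch_cost_def mismatch_rate_def)

lemma L_cost_lipschitz: "t \<in> {1..T} \<Longrightarrow> \<bar>L_cost C t y - L_cost C t y'\<bar> \<le> M * \<bar>y - y'\<bar>"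
  unfolding L_cost_eq
  by (rule D.convolution_lipschitz) (auto intro: mismatch_rate_integrable mismatch_rate_lipschitz)

lemma measurable_of_lipschitz:
  fixes f :: "real \<Rightarrow> real"
  assumes "\<And>x y. \<bar>f x - f y\<bar> \<le> K * \<bar>x - y\<bar>" "0 \<le> K"
  shows "f \<in> borel_measurable borel"
proof -
  have "lipschitz_on K UNIV f"
    using assms by (intro lipschitz_onI) (auto simp: dist_real_def)
  then show ?thesis
    by (intro borel_measurable_continuous_onI lipschitz_on_continuous_on)
qed

lemma L_cost_measurable: "t \<in> {1..T} \<Longrightarrow> L_cost C t \<in> borel_measurable borel"
  by (rule measurable_of_lipschitz[OF L_cost_lipschitz M_nonneg])

lemma trans_cost_base_stock:
  assumes "fst ab \<le> snd ab"
  shows "trans_cost C (base_stock ab s) s = k * max (fst ab - s) 0 + q * max (s - snd ab) 0"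
  using assms by (auto simp: trans_cost_def base_stock_def min_def max_def)

text \<open>The way from \<open>s\<close> to \<open>s'\<close> splits into a part below the lower
  level, a part above the upper one and a part in between. The slopes on them are
  \<open>- k\<close>, \<open>q\<close> and that of \<open>f\<close>, so the constant is a maximum
  rather than a sum, and passing through a decision does not enlarge \<open>K\<close>.\<close>

lemma base_stock_cost_lipschitz:
  assumes ab: "fst ab \<le> snd ab" and f: "\<And>y y'. \<bar>f y - f y'\<bar> \<le> K * \<bar>y - y'\<bar>"
    and K: "\<bar>k\<bar> + \<bar>q\<bar> \<le> K"
  shows "\<bar>(trans_cost C (base_stock ab s) s + f (base_stock ab s))
     - (trans_cost C (base_stock ab s') s' + f (base_stock ab s'))\<bar> \<le> K * \<bar>s - s'\<bar>"
proof -
  let ?g = "\<lambda>s. trans_cost C (base_stock ab s) s + f (base_stock ab s)"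
  have *: "\<bar>?g s - ?g s'\<bar> \<le> K * \<bar>s - s'\<bar>" if "s \<le> s'" for s s'
  proof -
    define u v w where "u = max (fst ab - s) 0 - max (fst ab - s') 0"
      and "v = max (s' - snd ab) 0 - max (s - snd ab) 0"
      and "w = base_stock ab s' - base_stock ab s"
    have uvw: "0 \<le> u" "0 \<le> v" "0 \<le> w" "u + v + w = s' - s"
      using that ab by (auto simp: u_def v_def w_def base_stock_def)
    have "?g s - ?g s' = k * u - q * v + (f (base_stock ab s) - f (base_stock ab s'))"
      by (simp add: trans_cost_base_stock[OF ab] u_def v_def algebra_simps)
    moreover have "\<bar>f (base_stock ab s) - f (base_stock ab s')\<bar> \<le> K * w"
      using f[of "base_stock ab s" "base_stock ab s'"] uvw by (simp add: w_def)
    moreover have "\<bar>k * u\<bar> \<le> K * u" "\<bar>q * v\<bar> \<le> K * v"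
      using K uvw by (auto simp: abs_mult intro!: mult_right_mono)
    moreover have "K * \<bar>s - s'\<bar> = K * u + K * v + K * w"
      using uvw that by (simp add: distrib_left[symmetric])
    ultimately show ?thesis by linarith
  qed
  show ?thesis using *[of s s'] *[of s' s] by (cases "s \<le> s'") (auto simp: abs_minus_commute)
qed

lemma abs_le_on_bounds:
  assumes "\<And>y y'. \<bar>f y - f y'\<bar> \<le> K * \<bar>y - y'\<bar>" "0 \<le> K" "B\<^sub>l \<le> y" "y \<le> B\<^sub>u"
  shows "\<bar>f y :: real\<bar> \<le> \<bar>f B\<^sub>l\<bar> + K * (B\<^sub>u - B\<^sub>l)"
proof -
  have "\<bar>f y - f B\<^sub>l\<bar> \<le> K * \<bar>y - B\<^sub>l\<bar>" by (rule assms)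
  also have "\<dots> \<le> K * (B\<^sub>u - B\<^sub>l)" using assms by (intro mult_left_mono) auto
  finally show ?thesis by linarith
qed

lemma integrable_on_post_stock:
  assumes f: "\<And>y y'. \<bar>f y - f y'\<bar> \<le> K * \<bar>y - y'\<bar>" "0 \<le> K"
    and ab: "\<And>s. B\<^sub>l \<le> base_stock ab s \<and> base_stock ab s \<le> B\<^sub>u"
    and N: "finite_measure N" and [measurable]: "g \<in> borel_measurable N"
  shows "integrable N (\<lambda>x. f (base_stock ab (g x)) :: real)"
proof -
  have [measurable]: "f \<in> borel_measurable borel" by (rule measurable_of_lipschitz[OF f])
  have "(\<lambda>x. f (base_stock ab (g x))) \<in> borel_measurable N" by measurable
  then show ?thesis
    by (intro finite_measure.integrable_const_bound[OF N, where B = "\<bar>f B\<^sub>l\<bar> + K * (B\<^sub>u - B\<^sub>l)"] AE_I2)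
      (use abs_le_on_bounds[OF f] ab in auto)
qed

lemma trans_cost_integrable_law:
  assumes "\<theta> \<in> Theta C" "t \<in> {1..T}"
  shows "integrable (law C) (\<lambda>\<omega>. trans_cost C (post_stock \<theta> \<omega> t) (stock \<theta> \<omega> t))"
proof -
  have "integrable (law C) (\<lambda>\<omega>. L_cost C t (post_stock \<theta> \<omega> t))"
    by (rule integrable_on_post_stock[OF L_cost_lipschitz[OF assms(2)] M_nonneg])
      (use post_stock_bounds[OF assms] assms law.finite_measure_axioms in \<open>auto intro!: stock_measurable\<close>)
  from Bochner_Integration.integrable_diff[OF int_stage[OF assms(2,1)] this]
  show ?thesis by (simp add: stage_cost_def Let_def)
qed

lemma base_stock_trans_cost_lipschitz:
  assumes "\<theta> \<in> Theta C" "t \<in> {1..T}"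
  shows "\<bar>trans_cost C (base_stock (\<theta> t) s) s - trans_cost C (base_stock (\<theta> t) s') s'\<bar>
    \<le> (\<bar>k\<bar> + \<bar>q\<bar>) * \<bar>s - s'\<bar>"
  using base_stock_cost_lipschitz[of "\<theta> t" "\<lambda>_. 0" "\<bar>k\<bar> + \<bar>q\<bar>" s s'] Theta_D[OF assms] by simp

text \<open>For \<open>t = Suc i\<close> the stock is the post-decision stock of period
  \<open>i\<close> minus its demand. Replacing that random level by the fixed
  \<open>B\<^sub>l\<close> changes a Lipschitz cost by a bounded amount, so integrability along the
  trajectory becomes integrability under the demand law. Period 1 is excluded since the initial
  stock has a law of its own.\<close>

lemma trans_cost_integrable_demand:
  assumes \<theta>: "\<theta> \<in> Theta C" and t: "t \<in> {2..T}"
  shows "integrable demand (\<lambda>x. trans_cost C (base_stock (\<theta> t) (y - x)) (y - x))"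
proof -
  let ?g = "\<lambda>s. trans_cost C (base_stock (\<theta> t) s) s"
  define i where "i = t - 1"
  have i: "t = Suc i" "i \<in> {1..T}" "1 \<le> i" and t': "t \<in> {1..T}" using t by (auto simp: i_def)
  have g: "\<bar>?g s - ?g s'\<bar> \<le> (\<bar>k\<bar> + \<bar>q\<bar>) * \<bar>s - s'\<bar>" for s s'
    by (rule base_stock_trans_cost_lipschitz[OF \<theta> t'])
  have gm [measurable]: "?g \<in> borel_measurable borel" by (rule measurable_of_lipschitz[OF g]) simp
  have [measurable]: "(\<lambda>\<omega>. \<omega> i) \<in> borel_measurable (law C)"
    "(\<lambda>\<omega>. stock \<theta> \<omega> i) \<in> borel_measurable (law C)"
    using i by (auto intro!: stock_measurable coordinate_measurable)
  have diff: "integrable (law C) (\<lambda>\<omega>. ?g (B\<^sub>l - \<omega> i) - ?g (post_stock \<theta> \<omega> i - \<omega> i))"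
  proof (rule law.integrable_const_bound[where B = "(\<bar>k\<bar> + \<bar>q\<bar>) * (B\<^sub>u - B\<^sub>l)"], rule AE_I2)
    fix \<omega>
    have "\<bar>?g (B\<^sub>l - \<omega> i) - ?g (post_stock \<theta> \<omega> i - \<omega> i)\<bar> \<le> (\<bar>k\<bar> + \<bar>q\<bar>) * \<bar>(B\<^sub>l - \<omega> i) - (post_stock \<theta> \<omega> i - \<omega> i)\<bar>"
      by (rule g)
    also have "\<dots> \<le> (\<bar>k\<bar> + \<bar>q\<bar>) * (B\<^sub>u - B\<^sub>l)"
      using post_stock_bounds[OF \<theta> i(2), of "stock \<theta> \<omega> i"] by (intro mult_left_mono) auto
    finally show "norm (?g (B\<^sub>l - \<omega> i) - ?g (post_stock \<theta> \<omega> i - \<omega> i)) \<le> (\<bar>k\<bar> + \<bar>q\<bar>) * (B\<^sub>u - B\<^sub>l)" by simp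
  qed measurable
  have int: "integrable (law C) (\<lambda>\<omega>. ?g (post_stock \<theta> \<omega> i - \<omega> i))"
    using trans_cost_integrable_law[OF \<theta> t'] unfolding i(1) stock_Suc[OF i(3)] .
  have "integrable (law C) (\<lambda>\<omega>. ?g (B\<^sub>l - \<omega> i))"
    using Bochner_Integration.integrable_add[OF diff int] by simp
  then have "integrable demand (\<lambda>x. ?g (B\<^sub>l - x))"
    by (subst (asm) integral_demand(2)[OF i(2)]) auto
  then show ?thesis by (rule D.integrable_shift[OF gm g])
qed

subsection \<open>Cost-to-go of a base-stock policy\<close>

text \<open>Cost-to-go from stock \<open>s\<close> at the start of period \<open>t\<close>, before
  the decision, when \<open>\<theta>\<close> is followed from there on. It is a function on the
  reals, detached from the trajectory space, so that its kinks and slopes can be studied.\<close>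

function pol_val :: "params \<Rightarrow> nat \<Rightarrow> real \<Rightarrow> real" where
  "pol_val \<theta> t s = (if T < t then 0 else trans_cost C (base_stock (\<theta> t) s) s +
     (\<integral>x. mismatch_rate C t (base_stock (\<theta> t) s - x)
         + pol_val \<theta> (Suc t) (base_stock (\<theta> t) s - x) \<partial>demand))"
  by auto
termination by (relation "Wellfounded.measure (\<lambda>(\<theta>, t, s). Suc T - t)") auto

text \<open>The left derivative of \<open>pol_val\<close> for admissible levels. Below the lower
  level one more unit of stock saves one ordered unit, above the upper level it has to be removed at
  cost \<open>q\<close>; between the levels no decision is taken and the slope is that of the cost
  after the decision.\<close>

function pol_slope :: "params \<Rightarrow> nat \<Rightarrow> real \<Rightarrow> real" where
  "pol_slope \<theta> t s = (if T < t then 0 else if s \<le> lo \<theta> t then - k else if s \<le> hi \<theta> t then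
     (\<integral>x. mismatch_slope C t (s - x) + pol_slope \<theta> (Suc t) (s - x) \<partial>demand) else q)"
  by auto
termination by (relation "Wellfounded.measure (\<lambda>(\<theta>, t, s). Suc T - t)") auto

declare pol_val.simps [simp del] pol_slope.simps [simp del]

definition post_val :: "params \<Rightarrow> nat \<Rightarrow> real \<Rightarrow> real" where
  "post_val \<theta> t y = (\<integral>x. mismatch_rate C t (y - x) + pol_val \<theta> (Suc t) (y - x) \<partial>demand)"

definition post_slope :: "params \<Rightarrow> nat \<Rightarrow> real \<Rightarrow> real" where
  "post_slope \<theta> t y = (\<integral>x. mismatch_slope C t (y - x) + pol_slope \<theta> (Suc t) (y - x) \<partial>demand)"

lemma pol_val_last [simp]: "pol_val \<theta> (Suc T) s = 0"
  by (simp add: pol_val.simps)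

lemma pol_slope_last [simp]: "pol_slope \<theta> (Suc T) s = 0"
  by (simp add: pol_slope.simps)

lemma pol_val_rec:
  "t \<le> T \<Longrightarrow> pol_val \<theta> t s = trans_cost C (base_stock (\<theta> t) s) s + post_val \<theta> t (base_stock (\<theta> t) s)"
  by (subst pol_val.simps) (simp add: post_val_def)

lemma pol_slope_rec:
  "t \<le> T \<Longrightarrow> pol_slope \<theta> t s = (if s \<le> lo \<theta> t then - k else if s \<le> hi \<theta> t then post_slope \<theta> t s else q)"
  by (subst pol_slope.simps) (simp add: post_slope_def)

text \<open>Transaction costs count once and each remaining period adds the mismatch rate
  \<open>M\<close>; \<open>\<Phi>\<close> is the value at period 1.\<close>

definition slope_bd :: "nat \<Rightarrow> real" where
  "slope_bd t = \<bar>k\<bar> + \<bar>q\<bar> + (real (Suc T) - real t) * M"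

definition "\<Phi> = \<bar>k\<bar> + \<bar>q\<bar> + real T * M"

lemma slope_bd_Suc: "M + slope_bd (Suc t) = slope_bd t"
  by (simp add: slope_bd_def algebra_simps)

lemma slope_bd_ge: "t \<le> Suc T \<Longrightarrow> \<bar>k\<bar> + \<bar>q\<bar> \<le> slope_bd t"
  using M_nonneg by (auto simp: slope_bd_def intro!: mult_nonneg_nonneg)

lemma slope_bd_le: "1 \<le> t \<Longrightarrow> slope_bd t \<le> \<Phi>"
  using M_nonneg by (auto simp: slope_bd_def \<Phi>_def intro!: mult_right_mono)

lemma \<Phi>_ge: "\<bar>k\<bar> + \<bar>q\<bar> \<le> \<Phi>" "M \<le> \<Phi>" "0 \<le> \<Phi>"
proof -
  have "1 * M \<le> real T * M" using M_nonneg horizon_pos by (intro mult_right_mono) auto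
  then show "\<bar>k\<bar> + \<bar>q\<bar> \<le> \<Phi>" "M \<le> \<Phi>" "0 \<le> \<Phi>"
    using M_nonneg by (auto simp: \<Phi>_def)
qed

text \<open>The three claims need one another: averages over demand can be compared only once the
  integrands are integrable, and integrability of \<open>pol_val\<close> at \<open>t\<close> needs
  the Lipschitz bound on \<open>post_val\<close> at \<open>t\<close>, which comes from period
  \<open>Suc t\<close>.\<close>

lemma pol_val_regular:
  assumes \<theta>: "\<theta> \<in> Theta C" and "1 \<le> t" "t \<le> Suc T"
  shows "(\<forall>z z'. \<bar>pol_val \<theta> t z - pol_val \<theta> t z'\<bar> \<le> slope_bd t * \<bar>z - z'\<bar>) \<and>
    (2 \<le> t \<longrightarrow> (\<forall>y. integrable demand (\<lambda>x. pol_val \<theta> t (y - x)))) \<and>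
    (t \<le> T \<longrightarrow> (\<forall>y y'. \<bar>post_val \<theta> t y - post_val \<theta> t y'\<bar> \<le> slope_bd t * \<bar>y - y'\<bar>))"
  using assms(2,3)
proof (induction t rule: backward_induct)
  case last
  then show ?case using slope_bd_ge[of "Suc T"] by auto
next
  case (step t)
  have t: "t \<in> {1..T}" using step by auto
  have lip: "\<bar>pol_val \<theta> (Suc t) z - pol_val \<theta> (Suc t) z'\<bar> \<le> slope_bd (Suc t) * \<bar>z - z'\<bar>"
    and int: "integrable demand (\<lambda>x. pol_val \<theta> (Suc t) (y - x))" for z z' y
    using step by auto
  have post: "\<bar>post_val \<theta> t y - post_val \<theta> t y'\<bar> \<le> slope_bd t * \<bar>y - y'\<bar>" for y y'
    unfolding post_val_def
  proof (rule D.convolution_lipschitz)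
    show "integrable demand (\<lambda>x. mismatch_rate C t (y - x) + pol_val \<theta> (Suc t) (y - x))" for y
      using mismatch_rate_integrable[OF t] int by auto
    show "\<bar>(mismatch_rate C t z + pol_val \<theta> (Suc t) z) - (mismatch_rate C t z' + pol_val \<theta> (Suc t) z')\<bar>
        \<le> slope_bd t * \<bar>z - z'\<bar>" for z z'
      using mismatch_rate_lipschitz[OF t, of z z'] lip[of z z']
      unfolding slope_bd_Suc[of t, symmetric] distrib_right by linarith
  qed
  have val: "\<bar>pol_val \<theta> t z - pol_val \<theta> t z'\<bar> \<le> slope_bd t * \<bar>z - z'\<bar>" for z z'
    unfolding pol_val_rec[OF step(2)]
    by (rule base_stock_cost_lipschitz[OF Theta_D(2)[OF \<theta> t] post slope_bd_ge]) (use step in simp)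
  have nn: "0 \<le> slope_bd t" using slope_bd_ge[of t] step by linarith
  have "integrable demand (\<lambda>x. pol_val \<theta> t (y - x))" if "2 \<le> t" for y
    unfolding pol_val_rec[OF step(2)]
    by (intro Bochner_Integration.integrable_add trans_cost_integrable_demand[OF \<theta>]
        integrable_on_post_stock[OF post nn])
      (use that step post_stock_bounds[OF \<theta> t] D.finite_measure_axioms in auto)
  then show ?case using post val by auto
qed

lemma pol_val_lipschitz:
  assumes "\<theta> \<in> Theta C" "1 \<le> t" "t \<le> Suc T"
  shows "\<bar>pol_val \<theta> t z - pol_val \<theta> t z'\<bar> \<le> \<Phi> * \<bar>z - z'\<bar>"
proof -
  have "\<bar>pol_val \<theta> t z - pol_val \<theta> t z'\<bar> \<le> slope_bd t * \<bar>z - z'\<bar>"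
    using pol_val_regular[OF assms] by blast
  also have "\<dots> \<le> \<Phi> * \<bar>z - z'\<bar>" by (intro mult_right_mono slope_bd_le assms) simp
  finally show ?thesis .
qed

lemma post_val_lipschitz:
  assumes "\<theta> \<in> Theta C" "t \<in> {1..T}"
  shows "\<bar>post_val \<theta> t z - post_val \<theta> t z'\<bar> \<le> \<Phi> * \<bar>z - z'\<bar>"
proof -
  have "\<bar>post_val \<theta> t z - post_val \<theta> t z'\<bar> \<le> slope_bd t * \<bar>z - z'\<bar>"
    using pol_val_regular[OF assms(1), of t] assms(2) by auto
  also have "\<dots> \<le> \<Phi> * \<bar>z - z'\<bar>" using assms(2) by (intro mult_right_mono slope_bd_le) auto
  finally show ?thesis .
qed

lemma pol_val_integrable:
  "\<theta> \<in> Theta C \<Longrightarrow> t \<in> {1..T} \<Longrightarrow> integrable demand (\<lambda>x. pol_val \<theta> (Suc t) (y - x))"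
  using pol_val_regular[of \<theta> "Suc t"] by auto

lemma pol_val_measurable:
  "\<theta> \<in> Theta C \<Longrightarrow> 1 \<le> t \<Longrightarrow> t \<le> Suc T \<Longrightarrow> pol_val \<theta> t \<in> borel_measurable borel"
  by (rule measurable_of_lipschitz[OF pol_val_lipschitz \<Phi>_ge(3)])

lemma post_val_eq:
  assumes "\<theta> \<in> Theta C" "t \<in> {1..T}"
  shows "post_val \<theta> t y = L_cost C t y + (\<integral>x. pol_val \<theta> (Suc t) (y - x) \<partial>demand)"
  unfolding post_val_def L_cost_eq[OF assms(2)]
  by (rule Bochner_Integration.integral_add[OF mismatch_rate_integrable[OF assms(2)] pol_val_integrable[OF assms]])

lemma convolution_measurable:
  fixes w :: "real \<Rightarrow> real"
  assumes [measurable]: "w \<in> borel_measurable borel"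
  shows "(\<lambda>y. \<integral>x. w (y - x) \<partial>demand) \<in> borel_measurable borel"
  by (rule D.borel_measurable_lebesgue_integral) measurable

lemma pol_slope_regular:
  assumes "1 \<le> t" "t \<le> Suc T"
  shows "pol_slope \<theta> t \<in> borel_measurable borel \<and> (\<forall>z. \<bar>pol_slope \<theta> t z\<bar> \<le> slope_bd t) \<and>
    (t \<le> T \<longrightarrow> (\<forall>y. \<bar>post_slope \<theta> t y\<bar> \<le> slope_bd t))"
  using assms
proof (induction t rule: backward_induct)
  case last
  have "pol_slope \<theta> (Suc T) = (\<lambda>_. 0)" by auto
  then show ?case using slope_bd_ge[of "Suc T"] by auto
next
  case (step t)
  have t: "t \<in> {1..T}" using step by auto
  have [measurable]: "pol_slope \<theta> (Suc t) \<in> borel_measurable borel"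
    and bd: "\<bar>pol_slope \<theta> (Suc t) z\<bar> \<le> slope_bd (Suc t)" for z
    using step by auto
  have [measurable]: "post_slope \<theta> t \<in> borel_measurable borel"
    unfolding post_slope_def[abs_def]
    by (rule convolution_measurable[where w = "\<lambda>z. mismatch_slope C t z + pol_slope \<theta> (Suc t) z"]) measurable
  have "\<bar>post_slope \<theta> t y\<bar> \<le> slope_bd t" for y
  proof -
    have b: "\<bar>mismatch_slope C t z + pol_slope \<theta> (Suc t) z\<bar> \<le> slope_bd t" for z
      using mismatch_slope_abs_le[OF t, of z] bd[of z] slope_bd_Suc[of t] by linarith
    have "\<bar>post_slope \<theta> t y\<bar> \<le> (\<integral>x. slope_bd t \<partial>demand)"
      unfolding post_slope_def
      by (intro order_trans[OF integral_abs_bound] integral_mono integrable_abs b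
          D.integrable_shift_bounded[where w = "\<lambda>z. mismatch_slope C t z + pol_slope \<theta> (Suc t) z", OF _ b])
        measurable
    then show ?thesis by (simp add: D.prob_UNIV)
  qed
  moreover have "pol_slope \<theta> t = (\<lambda>s. if s \<le> lo \<theta> t then - k else if s \<le> hi \<theta> t then post_slope \<theta> t s else q)"
    using pol_slope_rec[OF step(2)] by auto
  ultimately show ?case
    using slope_bd_ge[of t] step by auto
qed

lemma pol_slope_measurable [measurable]:
  "1 \<le> t \<Longrightarrow> t \<le> Suc T \<Longrightarrow> pol_slope \<theta> t \<in> borel_measurable borel"
  using pol_slope_regular by blast

lemma pol_slope_abs_le:
  assumes "1 \<le> t" "t \<le> Suc T" shows "\<bar>pol_slope \<theta> t z\<bar> \<le> \<Phi>"
  using pol_slope_regular[OF assms] slope_bd_le[OF assms(1)] order_trans by blast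

lemma post_slope_abs_le:
  assumes "t \<in> {1..T}" shows "\<bar>post_slope \<theta> t y\<bar> \<le> \<Phi>"
proof -
  have "\<bar>post_slope \<theta> t y\<bar> \<le> slope_bd t"
    using pol_slope_regular[of t] assms by auto
  also have "\<dots> \<le> \<Phi>" using assms by (intro slope_bd_le) auto
  finally show ?thesis .
qed

lemma mismatch_slope_integrable: "t \<in> {1..T} \<Longrightarrow> integrable demand (\<lambda>x. mismatch_slope C t (y - x))"
  by (rule D.integrable_shift_bounded[OF _ mismatch_slope_abs_le]) auto

lemma pol_slope_integrable: "t \<in> {1..T} \<Longrightarrow> integrable demand (\<lambda>x. pol_slope \<theta> (Suc t) (y - x))"
  by (rule D.integrable_shift_bounded[OF _ pol_slope_abs_le]) auto

lemma post_slope_eq: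
  assumes "t \<in> {1..T}"
  shows "post_slope \<theta> t y = (\<integral>x. mismatch_slope C t (y - x) \<partial>demand) + (\<integral>x. pol_slope \<theta> (Suc t) (y - x) \<partial>demand)"
  unfolding post_slope_def
  by (rule Bochner_Integration.integral_add[OF mismatch_slope_integrable[OF assms] pol_slope_integrable[OF assms]])

text \<open>\<open>pol_val\<close> may have kinks at the two levels because arbitrary levels satisfy
  no first-order condition. One convolution with the demand law removes these kinks and the one of
  the mismatch cost at 0, so \<open>post_val\<close> is differentiable everywhere.\<close>

lemma pol_val_has_derivative_aux:
  assumes \<theta>: "\<theta> \<in> Theta C" and "1 \<le> t" "t \<le> Suc T"
  shows "(\<forall>z. z \<noteq> lo \<theta> t \<longrightarrow> z \<noteq> hi \<theta> t \<longrightarrow> (pol_val \<theta> t has_real_derivative pol_slope \<theta> t z) (at z)) \<and>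
    (t \<le> T \<longrightarrow> (\<forall>y. (post_val \<theta> t has_real_derivative post_slope \<theta> t y) (at y)))"
  using assms(2,3)
proof (induction t rule: backward_induct)
  case last
  have "pol_val \<theta> (Suc T) = (\<lambda>_. 0)" by auto
  then show ?case by simp
next
  case (step t)
  have t: "t \<in> {1..T}" using step by auto
  have [measurable]: "pol_slope \<theta> (Suc t) \<in> borel_measurable borel"
    using step by (intro pol_slope_measurable) auto
  have post: "(post_val \<theta> t has_real_derivative post_slope \<theta> t y) (at y)" for y
    unfolding post_val_def[abs_def] post_slope_def
  proof (rule D.convolution_has_derivative[where K = "M + \<Phi>" and S = "{0, lo \<theta> (Suc t), hi \<theta> (Suc t)}"
        and w = "\<lambda>z. mismatch_rate C t z + pol_val \<theta> (Suc t) z"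
        and w' = "\<lambda>z. mismatch_slope C t z + pol_slope \<theta> (Suc t) z"])
    show "integrable demand (\<lambda>x. mismatch_rate C t (y - x) + pol_val \<theta> (Suc t) (y - x))" for y
      using mismatch_rate_integrable[OF t] pol_val_integrable[OF \<theta> t] by auto
    show "\<bar>mismatch_rate C t z + pol_val \<theta> (Suc t) z - (mismatch_rate C t z' + pol_val \<theta> (Suc t) z')\<bar>
        \<le> (M + \<Phi>) * \<bar>z - z'\<bar>" for z z'
      using mismatch_rate_lipschitz[OF t, of z z'] pol_val_lipschitz[OF \<theta>, of "Suc t" z z'] t
      by (auto simp: distrib_right)
    show "(\<lambda>z. mismatch_slope C t z + pol_slope \<theta> (Suc t) z) \<in> borel_measurable borel"
      by measurable
    show "((\<lambda>z. mismatch_rate C t z + pol_val \<theta> (Suc t) z) has_real_derivative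
        mismatch_slope C t z + pol_slope \<theta> (Suc t) z) (at z)"
      if "z \<notin> {0, lo \<theta> (Suc t), hi \<theta> (Suc t)}" for z
      using that step.IH by (intro DERIV_add mismatch_rate_has_derivative) auto
  qed simp
  have lh: "lo \<theta> t \<le> hi \<theta> t" using Theta_D[OF \<theta> t] by simp
  have eq: "pol_val \<theta> t s = k * max (lo \<theta> t - s) 0 + q * max (s - hi \<theta> t) 0 + post_val \<theta> t (base_stock (\<theta> t) s)" for s
    unfolding pol_val_rec[OF step(2)] trans_cost_base_stock[OF lh] by simp
  have "(pol_val \<theta> t has_real_derivative pol_slope \<theta> t z) (at z)"
    if z: "z \<noteq> lo \<theta> t" "z \<noteq> hi \<theta> t" for z
  proof -
    consider "z < lo \<theta> t" | "lo \<theta> t < z" "z < hi \<theta> t" | "hi \<theta> t < z" using z by linarith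
    then show ?thesis
    proof cases
      case 1
      have "((\<lambda>s. k * (lo \<theta> t - s) + post_val \<theta> t (lo \<theta> t)) has_real_derivative pol_slope \<theta> t z) (at z)"
        using 1 by (auto intro!: derivative_eq_intros simp: pol_slope_rec[OF step(2)])
      then show ?thesis
        by (rule has_field_derivative_transform_within_open[where S = "{..<lo \<theta> t}"])
          (use 1 lh in \<open>auto simp: eq base_stock_def max_def min_def\<close>)
    next
      case 2
      have "(post_val \<theta> t has_real_derivative pol_slope \<theta> t z) (at z)"
        using 2 post by (auto simp: pol_slope_rec[OF step(2)])
      then show ?thesis
        by (rule has_field_derivative_transform_within_open[where S = "{lo \<theta> t<..<hi \<theta> t}"])
          (use 2 lh in \<open>auto simp: eq base_stock_def max_def min_def\<close>)
    next
      case 3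
      have "((\<lambda>s. q * (s - hi \<theta> t) + post_val \<theta> t (hi \<theta> t)) has_real_derivative pol_slope \<theta> t z) (at z)"
        using 3 lh by (auto intro!: derivative_eq_intros simp: pol_slope_rec[OF step(2)])
      then show ?thesis
        by (rule has_field_derivative_transform_within_open[where S = "{hi \<theta> t<..}"])
          (use 3 lh in \<open>auto simp: eq base_stock_def max_def min_def\<close>)
    qed
  qed
  then show ?case using post by blast
qed

lemma post_val_has_derivative:
  "\<theta> \<in> Theta C \<Longrightarrow> t \<in> {1..T} \<Longrightarrow> (post_val \<theta> t has_real_derivative post_slope \<theta> t y) (at y)"
  using pol_val_has_derivative_aux[of \<theta> t] by auto

text \<open>Per period the Lipschitz constant of \<open>post_slope\<close> gains
  \<open>2 * \<Phi> * L\<^sub>D\<close> from the jump of the mismatch slope and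
  \<open>4 * \<Phi> * L\<^sub>D\<close> from the jumps at the two levels of the next period.\<close>

definition "\<Lambda> = real T * (6 * \<Phi> * L\<^sub>D)"

lemma mismatch_slope_convolution_lipschitz:
  assumes "t \<in> {1..T}"
  shows "\<bar>(\<integral>x. mismatch_slope C t (y - x) \<partial>demand) - (\<integral>x. mismatch_slope C t (y' - x) \<partial>demand)\<bar>
    \<le> 2 * \<Phi> * L\<^sub>D * \<bar>y - y'\<bar>"
proof -
  have "\<bar>(\<integral>x. mismatch_slope C t (y - x) \<partial>demand) - (\<integral>x. mismatch_slope C t (y' - x) \<partial>demand)\<bar>
    \<le> (0 + (\<Sum>c\<in>{0::real}. 2 * \<Phi>) * L\<^sub>D) * \<bar>y - y'\<bar>"
  proof (rule D.convolution_piecewise_lipschitz)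
    show "\<bar>mismatch_slope C t z' - mismatch_slope C t z\<bar>
        \<le> 0 * (z' - z) + (\<Sum>c\<in>{0}. 2 * \<Phi> * indicat_real {z..z'} c)" if "z \<le> z'" for z z'
    proof (cases "z \<le> 0 \<and> 0 \<le> z'")
      case True
      then show ?thesis
        using mismatch_slope_abs_le[OF assms, of z] mismatch_slope_abs_le[OF assms, of z'] \<Phi>_ge(2)
        by (simp add: indicator_def)
    next
      case False
      then show ?thesis using that \<Phi>_ge(3) by (auto simp: mismatch_slope_def indicator_def)
    qed
  qed (use mismatch_slope_abs_le[OF assms] \<Phi>_ge(3) in auto)
  then show ?thesis by simp
qed

text \<open>Off the levels \<open>pol_slope\<close> is constant or equal to
  \<open>post_slope\<close> of the same period. Its Lipschitz part is therefore the one from the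
  induction hypothesis, and only the jumps add to the constant when the demand is averaged
  out.\<close>

lemma post_slope_lipschitz_aux:
  assumes "1 \<le> t" "t \<le> Suc T"
  shows "t \<le> T \<longrightarrow> (\<forall>y y'. \<bar>post_slope \<theta> t y - post_slope \<theta> t y'\<bar>
    \<le> (real (Suc T) - real t) * (6 * \<Phi> * L\<^sub>D) * \<bar>y - y'\<bar>)"
  using assms
proof (induction t rule: backward_induct)
  case last
  then show ?case by simp
next
  case (step t)
  have t: "t \<in> {1..T}" using step by auto
  let ?K = "(real T - real t) * (6 * \<Phi> * L\<^sub>D)"
  have K: "0 \<le> ?K" using \<Phi>_ge(3) D.L_nonneg t by (intro mult_nonneg_nonneg) auto
  have part: "\<bar>(\<integral>x. pol_slope \<theta> (Suc t) (y - x) \<partial>demand) - (\<integral>x. pol_slope \<theta> (Suc t) (y' - x) \<partial>demand)\<bar>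
    \<le> (?K + 4 * \<Phi> * L\<^sub>D) * \<bar>y - y'\<bar>" for y y'
  proof (cases "t = T")
    case True
    then show ?thesis using \<Phi>_ge(3) D.L_nonneg by simp
  next
    case False
    then have Suc: "Suc t \<le> T" using t by auto
    let ?S = "{lo \<theta> (Suc t), hi \<theta> (Suc t)}"
    have "\<bar>(\<integral>x. pol_slope \<theta> (Suc t) (y - x) \<partial>demand) - (\<integral>x. pol_slope \<theta> (Suc t) (y' - x) \<partial>demand)\<bar>
      \<le> (?K + (\<Sum>c\<in>?S. 2 * \<Phi>) * L\<^sub>D) * \<bar>y - y'\<bar>"
    proof (rule D.convolution_piecewise_lipschitz)
      show "\<bar>pol_slope \<theta> (Suc t) z' - pol_slope \<theta> (Suc t) z\<bar>
          \<le> ?K * (z' - z) + (\<Sum>c\<in>?S. 2 * \<Phi> * indicat_real {z..z'} c)" if zz: "z \<le> z'" for z z'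
      proof (cases "\<exists>c\<in>?S. z \<le> c \<and> c \<le> z'")
        case True
        then obtain c where c: "c \<in> ?S" "z \<le> c" "c \<le> z'" by blast
        have "\<bar>pol_slope \<theta> (Suc t) z' - pol_slope \<theta> (Suc t) z\<bar> \<le> 2 * \<Phi>"
          using pol_slope_abs_le[of "Suc t" \<theta> z] pol_slope_abs_le[of "Suc t" \<theta> z'] Suc by linarith
        also have "\<dots> = 2 * \<Phi> * indicat_real {z..z'} c" using c by simp
        also have "\<dots> \<le> (\<Sum>c\<in>?S. 2 * \<Phi> * indicat_real {z..z'} c)"
          using c(1) \<Phi>_ge(3) by (intro member_le_sum) auto
        also have "\<dots> \<le> ?K * (z' - z) + (\<Sum>c\<in>?S. 2 * \<Phi> * indicat_real {z..z'} c)"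
          using K zz by simp
        finally show ?thesis .
      next
        case False
        have "\<bar>post_slope \<theta> (Suc t) z' - post_slope \<theta> (Suc t) z\<bar> \<le> ?K * (z' - z)"
          using step.IH[rule_format, OF Suc, of z' z] zz by simp
        then have "\<bar>pol_slope \<theta> (Suc t) z' - pol_slope \<theta> (Suc t) z\<bar> \<le> ?K * (z' - z)"
          using False zz mult_nonneg_nonneg[OF K, of "z' - z"] by (auto simp: pol_slope_rec[OF Suc])
        moreover have "0 \<le> (\<Sum>c\<in>?S. 2 * \<Phi> * indicat_real {z..z'} c)"
          using \<Phi>_ge(3) by (intro sum_nonneg) auto
        ultimately show ?thesis by linarith
      qed
    qed (use pol_slope_abs_le[of "Suc t"] Suc \<Phi>_ge(3) in auto)
    moreover have "(\<Sum>c\<in>?S. 2 * \<Phi>) \<le> 4 * \<Phi>"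
      using \<Phi>_ge(3) by (cases "lo \<theta> (Suc t) = hi \<theta> (Suc t)") auto
    then have "(?K + (\<Sum>c\<in>?S. 2 * \<Phi>) * L\<^sub>D) * \<bar>y - y'\<bar> \<le> (?K + 4 * \<Phi> * L\<^sub>D) * \<bar>y - y'\<bar>"
      using D.L_nonneg by (intro mult_right_mono add_left_mono) auto
    ultimately show ?thesis by linarith
  qed
  have "\<bar>post_slope \<theta> t y - post_slope \<theta> t y'\<bar>
    \<le> (real (Suc T) - real t) * (6 * \<Phi> * L\<^sub>D) * \<bar>y - y'\<bar>" for y y'
  proof -
    have "(real (Suc T) - real t) * (6 * \<Phi> * L\<^sub>D) * \<bar>y - y'\<bar>
        = (?K + 4 * \<Phi> * L\<^sub>D) * \<bar>y - y'\<bar> + 2 * \<Phi> * L\<^sub>D * \<bar>y - y'\<bar>"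
      by (simp add: algebra_simps)
    then show ?thesis
      using part[of y y'] mismatch_slope_convolution_lipschitz[OF t, of y y']
      unfolding post_slope_eq[OF t] by linarith
  qed
  then show ?case by blast
qed

lemma post_slope_lipschitz:
  assumes "t \<in> {1..T}"
  shows "\<bar>post_slope \<theta> t y - post_slope \<theta> t y'\<bar> \<le> \<Lambda> * \<bar>y - y'\<bar>"
proof -
  have "\<bar>post_slope \<theta> t y - post_slope \<theta> t y'\<bar> \<le> (real (Suc T) - real t) * (6 * \<Phi> * L\<^sub>D) * \<bar>y - y'\<bar>"
    using post_slope_lipschitz_aux[of t \<theta>] assms by auto
  also have "\<dots> \<le> \<Lambda> * \<bar>y - y'\<bar>"
    unfolding \<Lambda>_def using assms \<Phi>_ge(3) D.L_nonneg by (intro mult_right_mono) auto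
  finally show ?thesis .
qed

lemma \<Lambda>_nonneg: "0 \<le> \<Lambda>"
  using \<Phi>_ge(3) D.L_nonneg by (simp add: \<Lambda>_def)

text \<open>Two policies with close levels use different branches of \<open>pol_slope\<close> only
  on two intervals of length at most \<open>e\<close>; there the slopes differ by up to
  \<open>2 * \<Phi>\<close>, elsewhere by what is inherited from the next period. After averaging,
  each interval costs \<open>2 * \<Phi> * L\<^sub>D * e\<close>.\<close>

lemma post_slope_param_lipschitz:
  assumes \<theta>: "\<theta> \<in> Theta C" "\<theta>' \<in> Theta C" and e: "0 \<le> e"
    and close: "\<And>t. t \<in> {1..T} \<Longrightarrow> \<bar>lo \<theta> t - lo \<theta>' t\<bar> \<le> e \<and> \<bar>hi \<theta> t - hi \<theta>' t\<bar> \<le> e"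
    and t: "t \<in> {1..T}"
  shows "\<bar>post_slope \<theta> t y - post_slope \<theta>' t y\<bar> \<le> \<Lambda> * e"
proof -
  have "1 \<le> t" "t \<le> Suc T" using t by auto
  then have "t \<le> T \<longrightarrow> (\<forall>y. \<bar>post_slope \<theta> t y - post_slope \<theta>' t y\<bar>
      \<le> (real (Suc T) - real t) * (6 * \<Phi> * L\<^sub>D) * e)"
  proof (induction t rule: backward_induct)
    case last
    then show ?case by simp
  next
    case (step t)
    have t: "t \<in> {1..T}" using step by auto
    show ?case
    proof (cases "t = T")
      case True
      then show ?thesis using \<Phi>_ge(3) D.L_nonneg e t by (auto simp: post_slope_eq)
    next
      case False
      then have Suc: "Suc t \<le> T" using t by auto
      let ?K = "(real T - real t) * (6 * \<Phi> * L\<^sub>D) * e"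
      define a b where "a = min (lo \<theta> (Suc t)) (lo \<theta>' (Suc t))" and "b = max (lo \<theta> (Suc t)) (lo \<theta>' (Suc t))"
      define c d where "c = min (hi \<theta> (Suc t)) (hi \<theta>' (Suc t))" and "d = max (hi \<theta> (Suc t)) (hi \<theta>' (Suc t))"
      note defs = a_def b_def c_def d_def
      have ab: "a \<le> b" "b - a \<le> e" "c \<le> d" "d - c \<le> e"
        using close[of "Suc t"] Suc by (auto simp: defs)
      have K: "0 \<le> ?K" using \<Phi>_ge(3) D.L_nonneg t e by (intro mult_nonneg_nonneg) auto
      have ptw: "\<bar>pol_slope \<theta> (Suc t) z - pol_slope \<theta>' (Suc t) z\<bar>
          \<le> ?K + 2 * \<Phi> * indicat_real {a..b} z + 2 * \<Phi> * indicat_real {c..d} z" for z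
      proof (cases "z \<in> {a..b} \<or> z \<in> {c..d}")
        case True
        have "\<bar>pol_slope \<theta> (Suc t) z - pol_slope \<theta>' (Suc t) z\<bar> \<le> 2 * \<Phi>"
          using pol_slope_abs_le[of "Suc t" \<theta> z] pol_slope_abs_le[of "Suc t" \<theta>' z] Suc by linarith
        moreover have "2 * \<Phi> \<le> 2 * \<Phi> * indicat_real {a..b} z + 2 * \<Phi> * indicat_real {c..d} z"
          using True \<Phi>_ge(3) by (auto simp: indicator_def)
        ultimately show ?thesis using K by linarith
      next
        case False
        have "\<bar>post_slope \<theta> (Suc t) z - post_slope \<theta>' (Suc t) z\<bar> \<le> ?K"
          using step.IH Suc by auto
        then have "\<bar>pol_slope \<theta> (Suc t) z - pol_slope \<theta>' (Suc t) z\<bar> \<le> ?K"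
          using False K Theta_D(2)[OF \<theta>(1), of "Suc t"] Theta_D(2)[OF \<theta>(2), of "Suc t"] Suc
          by (auto simp: pol_slope_rec[OF Suc] defs min_def max_def split: if_splits)
        then show ?thesis using False by simp
      qed
      have "\<bar>post_slope \<theta> t y - post_slope \<theta>' t y\<bar> \<le> (real (Suc T) - real t) * (6 * \<Phi> * L\<^sub>D) * e" for y
      proof -
        have "\<bar>post_slope \<theta> t y - post_slope \<theta>' t y\<bar>
            = \<bar>\<integral>x. pol_slope \<theta> (Suc t) (y - x) - pol_slope \<theta>' (Suc t) (y - x) \<partial>demand\<bar>"
          using pol_slope_integrable[OF t] by (simp add: post_slope_eq[OF t])
        also have "\<dots> \<le> (\<integral>x. ?K + 2 * \<Phi> * indicat_real {a..b} (y - x) + 2 * \<Phi> * indicat_real {c..d} (y - x) \<partial>demand)"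
          using pol_slope_integrable[OF t] D.integral_between(1) ab
          by (intro order_trans[OF integral_abs_bound] integral_mono ptw integrable_abs
              Bochner_Integration.integrable_add Bochner_Integration.integrable_diff integrable_mult_right) auto
        also have "\<dots> = ?K + 2 * \<Phi> * (\<integral>x. indicat_real {a..b} (y - x) \<partial>demand)
            + 2 * \<Phi> * (\<integral>x. indicat_real {c..d} (y - x) \<partial>demand)"
          using D.integral_between(1)[OF ab(1), of y] D.integral_between(1)[OF ab(3), of y]
          by (simp add: D.prob_UNIV)
        also have "\<dots> \<le> ?K + 2 * \<Phi> * (L\<^sub>D * e) + 2 * \<Phi> * (L\<^sub>D * e)"
          using D.integral_between(2)[OF ab(1), of y] D.integral_between(2)[OF ab(3), of y]
            mult_left_mono[OF ab(2) D.L_nonneg] mult_left_mono[OF ab(4) D.L_nonneg] \<Phi>_ge(3)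
          by (intro add_mono mult_left_mono order_refl) auto
        \<comment> \<open>The factor 4 is rounded up to 6 so that the dependence on the levels
          shares the constant \<open>\<Lambda>\<close> with the dependence on
          \<open>y\<close>.\<close>
        also have "\<dots> \<le> ?K + 6 * \<Phi> * L\<^sub>D * e"
          using mult_nonneg_nonneg[OF mult_nonneg_nonneg[OF \<Phi>_ge(3) D.L_nonneg] e] by (simp add: ac_simps)
        finally show ?thesis by (simp add: algebra_simps)
      qed
      then show ?thesis by blast
    qed
  qed
  then have "\<bar>post_slope \<theta> t y - post_slope \<theta>' t y\<bar> \<le> (real (Suc T) - real t) * (6 * \<Phi> * L\<^sub>D) * e"
    using t by auto
  also have "\<dots> \<le> \<Lambda> * e"
    unfolding \<Lambda>_def using t \<Phi>_ge(3) D.L_nonneg e by (intro mult_right_mono) auto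
  finally show ?thesis .
qed

text \<open>Two policies are mixed: trajectories of \<open>\<theta>\<close> and cost-to-go of
  \<open>\<theta>'\<close>. In period 1 the stock does not depend on the policy; later the
  post-decision stock is replaced by \<open>B\<^sub>l\<close> at bounded cost, which leaves an
  integral over demand alone.\<close>

lemma pol_val_stock_integrable:
  assumes \<theta>: "\<theta> \<in> Theta C" "\<theta>' \<in> Theta C" and t: "1 \<le> t" "t \<le> Suc T"
  shows "integrable (law C) (\<lambda>\<omega>. pol_val \<theta>' t (stock \<theta> \<omega> t))"
proof (cases "t = 1")
  case True
  have T1: "1 \<in> {1..T}" "1 \<le> T" using horizon_pos by auto
  have post: "integrable (law C) (\<lambda>\<omega>. post_val \<theta>' 1 (post_stock \<theta>' \<omega> 1))"
    by (rule integrable_on_post_stock[OF post_val_lipschitz[OF \<theta>(2) T1(1)] \<Phi>_ge(3)])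
      (use post_stock_bounds[OF \<theta>(2) T1(1)] T1 law.finite_measure_axioms in \<open>auto intro!: coordinate_measurable\<close>)
  show ?thesis
    unfolding True pol_val_rec[OF T1(2)]
    using Bochner_Integration.integrable_add[OF trans_cost_integrable_law[OF \<theta>(2) T1(1)] post] by simp
next
  case False
  define i where "i = t - 1"
  have i: "t = Suc i" "i \<in> {1..T}" "1 \<le> i" using t False by (auto simp: i_def)
  have [measurable]: "(\<lambda>\<omega>. \<omega> i) \<in> borel_measurable (law C)"
    "(\<lambda>\<omega>. stock \<theta> \<omega> i) \<in> borel_measurable (law C)" "pol_val \<theta>' t \<in> borel_measurable borel"
    using i by (auto intro!: stock_measurable coordinate_measurable pol_val_measurable[OF \<theta>(2)])
  have diff: "integrable (law C) (\<lambda>\<omega>. pol_val \<theta>' t (post_stock \<theta> \<omega> i - \<omega> i) - pol_val \<theta>' t (B\<^sub>l - \<omega> i))"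
  proof (rule law.integrable_const_bound[where B = "\<Phi> * (B\<^sub>u - B\<^sub>l)"], rule AE_I2)
    fix \<omega>
    have "\<bar>pol_val \<theta>' t (post_stock \<theta> \<omega> i - \<omega> i) - pol_val \<theta>' t (B\<^sub>l - \<omega> i)\<bar>
        \<le> \<Phi> * \<bar>(post_stock \<theta> \<omega> i - \<omega> i) - (B\<^sub>l - \<omega> i)\<bar>"
      by (rule pol_val_lipschitz[OF \<theta>(2) t])
    also have "\<dots> \<le> \<Phi> * (B\<^sub>u - B\<^sub>l)"
      using post_stock_bounds[OF \<theta>(1) i(2), of "stock \<theta> \<omega> i"] \<Phi>_ge(3) by (intro mult_left_mono) auto
    finally show "norm (pol_val \<theta>' t (post_stock \<theta> \<omega> i - \<omega> i) - pol_val \<theta>' t (B\<^sub>l - \<omega> i)) \<le> \<Phi> * (B\<^sub>u - B\<^sub>l)" by simp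
  qed measurable
  have "integrable (law C) (\<lambda>\<omega>. pol_val \<theta>' t (B\<^sub>l - \<omega> i))"
    using pol_val_integrable[OF \<theta>(2) i(2), of B\<^sub>l] unfolding i(1)[symmetric]
    by (subst integral_demand(2)[OF i(2)]) auto
  from Bochner_Integration.integrable_add[OF diff this] show ?thesis
    by (simp add: i(1) stock_Suc[OF i(3)])
qed

text \<open>The advantage function of reinforcement learning: the extra cost of using the levels
  \<open>ab\<close> in period \<open>t\<close> only and following \<open>\<theta>\<close>
  afterwards.\<close>

definition advantage :: "params \<Rightarrow> nat \<Rightarrow> real \<times> real \<Rightarrow> real \<Rightarrow> real" where
  "advantage \<theta> t ab s = trans_cost C (base_stock ab s) s + post_val \<theta> t (base_stock ab s) - pol_val \<theta> t s"

lemma advantage_integral: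
  assumes \<theta>: "\<theta> \<in> Theta C" "\<theta>' \<in> Theta C" and t: "t \<in> {1..T}"
  shows "integrable (law C) (\<lambda>\<omega>. advantage \<theta>' t (\<theta> t) (stock \<theta> \<omega> t))"
    "(\<integral>\<omega>. advantage \<theta>' t (\<theta> t) (stock \<theta> \<omega> t) \<partial>law C) = (\<integral>\<omega>. stage_cost C \<theta> \<omega> t \<partial>law C)
      + (\<integral>\<omega>. pol_val \<theta>' (Suc t) (stock \<theta> \<omega> (Suc t)) \<partial>law C) - (\<integral>\<omega>. pol_val \<theta>' t (stock \<theta> \<omega> t) \<partial>law C)"
proof -
  have t1: "1 \<le> t" "t \<le> T" using t by auto
  let ?w = "\<lambda>y x. pol_val \<theta>' (Suc t) (y - x)"
  have pm [measurable]: "pol_val \<theta>' (Suc t) \<in> borel_measurable borel"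
    using t by (intro pol_val_measurable[OF \<theta>(2)]) auto
  have int: "integrable (law C) (\<lambda>\<omega>. ?w (post_stock \<theta> \<omega> t) (\<omega> t))"
    using pol_val_stock_integrable[OF \<theta>, of "Suc t"] t by (simp add: stock_Suc)
  have wm: "(\<lambda>(y, x). ?w y x) \<in> borel_measurable (borel \<Otimes>\<^sub>M borel)" by measurable
  note fresh = expectation_fresh[where w = ?w, OF t wm int]
  have eq: "advantage \<theta>' t (\<theta> t) (stock \<theta> \<omega> t) = stage_cost C \<theta> \<omega> t
      + (\<integral>x. ?w (post_stock \<theta> \<omega> t) x \<partial>demand) - pol_val \<theta>' t (stock \<theta> \<omega> t)" for \<omega>
    by (simp add: advantage_def stage_cost_def Let_def post_val_eq[OF \<theta>(2) t])
  note ints = int_stage[OF t \<theta>(1)] fresh(2) pol_val_stock_integrable[OF \<theta>, of t]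
  show "integrable (law C) (\<lambda>\<omega>. advantage \<theta>' t (\<theta> t) (stock \<theta> \<omega> t))"
    unfolding eq using ints t by (intro Bochner_Integration.integrable_add Bochner_Integration.integrable_diff) auto
  have "(\<integral>\<omega>. advantage \<theta>' t (\<theta> t) (stock \<theta> \<omega> t) \<partial>law C) = (\<integral>\<omega>. stage_cost C \<theta> \<omega> t \<partial>law C)
      + (\<integral>\<omega>. (\<integral>x. ?w (post_stock \<theta> \<omega> t) x \<partial>demand) \<partial>law C) - (\<integral>\<omega>. pol_val \<theta>' t (stock \<theta> \<omega> t) \<partial>law C)"
    unfolding eq using ints t by simp
  then show "(\<integral>\<omega>. advantage \<theta>' t (\<theta> t) (stock \<theta> \<omega> t) \<partial>law C) = (\<integral>\<omega>. stage_cost C \<theta> \<omega> t \<partial>law C)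
      + (\<integral>\<omega>. pol_val \<theta>' (Suc t) (stock \<theta> \<omega> (Suc t)) \<partial>law C) - (\<integral>\<omega>. pol_val \<theta>' t (stock \<theta> \<omega> t) \<partial>law C)"
    unfolding fresh(1)[symmetric] stock_Suc[OF t1(1)] .
qed

text \<open>The expected cost-to-go of \<open>\<theta>'\<close> along trajectories of
  \<open>\<theta>\<close> telescopes: each expected stage cost is an expected advantage minus an
  increment of it, it is zero after the horizon, and at the start it does not depend on
  \<open>\<theta>\<close>.\<close>

lemma objective_eq:
  assumes \<theta>: "\<theta> \<in> Theta C" "\<theta>' \<in> Theta C"
  shows "objective C \<theta> = (\<integral>\<omega>. pol_val \<theta>' 1 (\<omega> 0) \<partial>law C)
    + (\<Sum>t=1..T. \<integral>\<omega>. advantage \<theta>' t (\<theta> t) (stock \<theta> \<omega> t) \<partial>law C)"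
proof -
  let ?A = "\<lambda>t. \<integral>\<omega>. pol_val \<theta>' t (stock \<theta> \<omega> t) \<partial>law C"
  have "objective C \<theta> = (\<Sum>t=1..T. \<integral>\<omega>. stage_cost C \<theta> \<omega> t \<partial>law C)"
    unfolding objective_def using int_stage \<theta> by (intro Bochner_Integration.integral_sum) auto
  also have "\<dots> = (\<Sum>t=1..T. (\<integral>\<omega>. advantage \<theta>' t (\<theta> t) (stock \<theta> \<omega> t) \<partial>law C) - (?A (Suc t) - ?A t))"
    using advantage_integral(2)[OF \<theta>] by (intro sum.cong) auto
  also have "\<dots> = (\<Sum>t=1..T. \<integral>\<omega>. advantage \<theta>' t (\<theta> t) (stock \<theta> \<omega> t) \<partial>law C) - (\<Sum>t=1..T. ?A (Suc t) - ?A t)"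
    by (rule sum_subtractf)
  also have "(\<Sum>t=1..T. ?A (Suc t) - ?A t) = ?A (Suc T) - ?A 1"
    using horizon_pos by (intro sum_Suc_diff) auto
  also have "?A (Suc T) = 0" by simp
  also have "?A 1 = (\<integral>\<omega>. pol_val \<theta>' 1 (\<omega> 0) \<partial>law C)" by simp
  finally show ?thesis by simp
qed

text \<open>The advantage is relative to the reference policy \<open>\<theta>'\<close> but averaged
  over the trajectories of \<open>\<theta>\<close>. With the current policy as reference this
  expands the objective; with the optimal policy as reference it measures the regret.\<close>

lemma performance_difference:
  assumes \<theta>: "\<theta> \<in> Theta C" "\<theta>' \<in> Theta C"
  shows "objective C \<theta> - objective C \<theta>'
    = (\<Sum>t=1..T. \<integral>\<omega>. advantage \<theta>' t (\<theta> t) (stock \<theta> \<omega> t) \<partial>law C)"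
proof -
  have "advantage \<theta>' t (\<theta>' t) s = 0" if "t \<in> {1..T}" for t s
    using that by (simp add: advantage_def pol_val_rec)
  then have "objective C \<theta>' = (\<integral>\<omega>. pol_val \<theta>' 1 (\<omega> 0) \<partial>law C)"
    unfolding objective_eq[OF \<theta>(2) \<theta>(2)] by (simp add: sum.neutral)
  then show ?thesis using objective_eq[OF \<theta>] by simp
qed

subsection \<open>Distribution of the stock\<close>

definition stock_cdf :: "params \<Rightarrow> nat \<Rightarrow> real \<Rightarrow> real" where
  "stock_cdf \<theta> t x = measure (law C) {\<omega> \<in> space (law C). stock \<theta> \<omega> t \<le> x}"

lemma stock_cdf_1: "stock_cdf \<theta> 1 x = cdf (distr (law C) borel (\<lambda>\<omega>. \<omega> 0)) x"
proof -
  have [measurable]: "(\<lambda>\<omega>. \<omega> 0) \<in> borel_measurable (law C)" by (intro coordinate_measurable) auto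
  have "(\<lambda>\<omega>. \<omega> 0) -` {..x} \<inter> space (law C) = {\<omega> \<in> space (law C). \<omega> 0 \<le> x}" by auto
  then show ?thesis
    unfolding stock_cdf_def cdf_def by (subst measure_distr) auto
qed

text \<open>Conditioning on the post-decision stock: the next stock is at most \<open>x\<close>
  exactly if the fresh demand is at least that stock minus \<open>x\<close>. In every period but the
  first, the distribution of the stock thus inherits its regularity from the demand.\<close>

lemma stock_cdf_Suc:
  assumes t: "t \<in> {1..T}"
  shows "stock_cdf \<theta> (Suc t) x = (\<integral>\<omega>. 1 - cdf demand (post_stock \<theta> \<omega> t - x) \<partial>law C)"
    "integrable (law C) (\<lambda>\<omega>. 1 - cdf demand (post_stock \<theta> \<omega> t - x))"
proof -
  have t1: "1 \<le> t" using t by simp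
  have [measurable]: "(\<lambda>\<omega>. \<omega> t) \<in> borel_measurable (law C)"
    "(\<lambda>\<omega>. stock \<theta> \<omega> t) \<in> borel_measurable (law C)" "(\<lambda>\<omega>. stock \<theta> \<omega> (Suc t)) \<in> borel_measurable (law C)"
    using t by (auto intro!: stock_measurable coordinate_measurable)
  let ?w = "\<lambda>y z. indicat_real {..x} (y - z)"
  have wm: "(\<lambda>(y, z). ?w y z) \<in> borel_measurable (borel \<Otimes>\<^sub>M borel)" by measurable
  have int: "integrable (law C) (\<lambda>\<omega>. ?w (post_stock \<theta> \<omega> t) (\<omega> t))"
    by (rule law.integrable_const_bound[where B = 1]) auto
  have inner: "(\<integral>z. ?w y z \<partial>demand) = 1 - cdf demand (y - x)" for y
  proof -
    have "(\<integral>z. ?w y z \<partial>demand) = (\<integral>z. indicat_real {y - x..} z \<partial>demand)"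
      by (intro Bochner_Integration.integral_cong) (auto simp: indicator_def)
    then show ?thesis by (simp add: D.prob_ge)
  qed
  have "stock_cdf \<theta> (Suc t) x = (\<integral>\<omega>. indicat_real {\<omega> \<in> space (law C). stock \<theta> \<omega> (Suc t) \<le> x} \<omega> \<partial>law C)"
    unfolding stock_cdf_def by simp
  also have "\<dots> = (\<integral>\<omega>. ?w (post_stock \<theta> \<omega> t) (\<omega> t) \<partial>law C)"
    by (intro Bochner_Integration.integral_cong) (auto simp: indicator_def stock_Suc[OF t1])
  finally show "stock_cdf \<theta> (Suc t) x = (\<integral>\<omega>. 1 - cdf demand (post_stock \<theta> \<omega> t - x) \<partial>law C)"
    using expectation_fresh(1)[where w = ?w, OF t wm int] by (simp add: inner)
  show "integrable (law C) (\<lambda>\<omega>. 1 - cdf demand (post_stock \<theta> \<omega> t - x))"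
    using expectation_fresh(2)[where w = ?w, OF t wm int] by (simp add: inner)
qed

definition "L\<^sub>s = L\<^sub>\<rho> + L\<^sub>D"

lemma L\<^sub>s_nonneg: "0 \<le> L\<^sub>s"
  using lipschitz_on_nonneg[OF lip_initial] D.L_nonneg by (simp add: L\<^sub>s_def)

text \<open>The initial stock is the same for both policies, which leaves
  \<open>L\<^sub>\<rho>\<close>; later the post-decision stocks differ by at most \<open>e\<close>
  on every path and the demand contributes \<open>L\<^sub>D\<close>. The sum
  \<open>L\<^sub>s\<close> covers both cases, and nothing accumulates over the periods.\<close>

lemma stock_cdf_lipschitz:
  assumes t: "t \<in> {1..T}" and e: "0 \<le> e"
    and close: "\<And>t. t \<in> {1..T} \<Longrightarrow> \<bar>lo \<theta> t - lo \<theta>' t\<bar> \<le> e \<and> \<bar>hi \<theta> t - hi \<theta>' t\<bar> \<le> e"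
  shows "\<bar>stock_cdf \<theta> t x - stock_cdf \<theta>' t x'\<bar> \<le> L\<^sub>s * (e + \<bar>x - x'\<bar>)"
proof (cases "t = 1")
  case True
  have "\<bar>stock_cdf \<theta> t x - stock_cdf \<theta>' t x'\<bar> \<le> L\<^sub>\<rho> * \<bar>x - x'\<bar>"
    using lipschitz_onD[OF lip_initial, of x x'] True by (simp add: stock_cdf_1[unfolded One_nat_def] dist_real_def)
  also have "\<dots> \<le> L\<^sub>s * (e + \<bar>x - x'\<bar>)"
    using lipschitz_on_nonneg[OF lip_initial] D.L_nonneg e by (intro mult_mono) (auto simp: L\<^sub>s_def)
  finally show ?thesis .
next
  case False
  define i where "i = t - 1"
  have i: "t = Suc i" "i \<in> {1..T}" "1 \<le> i" using t False by (auto simp: i_def)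
  have "\<bar>stock_cdf \<theta> t x - stock_cdf \<theta>' t x'\<bar> = \<bar>\<integral>\<omega>. (1 - cdf demand (post_stock \<theta> \<omega> i - x))
      - (1 - cdf demand (post_stock \<theta>' \<omega> i - x')) \<partial>law C\<bar>"
    unfolding i(1) stock_cdf_Suc(1)[OF i(2)]
    by (subst Bochner_Integration.integral_diff[OF stock_cdf_Suc(2)[OF i(2)] stock_cdf_Suc(2)[OF i(2)]]) simp
  also have "\<dots> \<le> (\<integral>\<omega>. L\<^sub>D * (e + \<bar>x - x'\<bar>) \<partial>law C)"
  proof (intro order_trans[OF integral_abs_bound] integral_mono integrable_abs
      Bochner_Integration.integrable_diff[OF stock_cdf_Suc(2)[OF i(2)] stock_cdf_Suc(2)[OF i(2)]])
    fix \<omega>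
    have "\<bar>post_stock \<theta> \<omega> i - post_stock \<theta>' \<omega> i\<bar> \<le> e"
      using close i t e by (intro base_stock_lipschitz stock_lipschitz) auto
    then have "L\<^sub>D * \<bar>(post_stock \<theta>' \<omega> i - x') - (post_stock \<theta> \<omega> i - x)\<bar> \<le> L\<^sub>D * (e + \<bar>x - x'\<bar>)"
      using D.L_nonneg by (intro mult_left_mono) auto
    then show "\<bar>(1 - cdf demand (post_stock \<theta> \<omega> i - x)) - (1 - cdf demand (post_stock \<theta>' \<omega> i - x'))\<bar>
        \<le> L\<^sub>D * (e + \<bar>x - x'\<bar>)"
      using D.cdf_lipschitz[of "post_stock \<theta>' \<omega> i - x'" "post_stock \<theta> \<omega> i - x"] by linarith
  qed auto
  also have "\<dots> = L\<^sub>D * (e + \<bar>x - x'\<bar>)" by (simp add: law.prob_space)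
  also have "\<dots> \<le> L\<^sub>s * (e + \<bar>x - x'\<bar>)"
    using lipschitz_on_nonneg[OF lip_initial] e by (intro mult_right_mono) (auto simp: L\<^sub>s_def)
  finally show ?thesis .
qed

lemma stock_cdf_indicator:
  assumes "t \<in> {1..Suc T}"
  shows "integrable (law C) (\<lambda>\<omega>. indicat_real {..x} (stock \<theta> \<omega> t))"
    "(\<integral>\<omega>. indicat_real {..x} (stock \<theta> \<omega> t) \<partial>law C) = stock_cdf \<theta> t x"
    "integrable (law C) (\<lambda>\<omega>. indicat_real {x<..} (stock \<theta> \<omega> t))"
    "(\<integral>\<omega>. indicat_real {x<..} (stock \<theta> \<omega> t) \<partial>law C) = 1 - stock_cdf \<theta> t x"
proof -
  have [measurable]: "(\<lambda>\<omega>. stock \<theta> \<omega> t) \<in> borel_measurable (law C)"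
    using assms by (rule stock_measurable)
  show i: "integrable (law C) (\<lambda>\<omega>. indicat_real {..x} (stock \<theta> \<omega> t))"
    by (rule law.integrable_const_bound[where B = 1]) auto
  have "(\<integral>\<omega>. indicat_real {..x} (stock \<theta> \<omega> t) \<partial>law C)
      = (\<integral>\<omega>. indicat_real {\<omega> \<in> space (law C). stock \<theta> \<omega> t \<le> x} \<omega> \<partial>law C)"
    by (intro Bochner_Integration.integral_cong) (auto simp: indicator_def)
  then show e: "(\<integral>\<omega>. indicat_real {..x} (stock \<theta> \<omega> t) \<partial>law C) = stock_cdf \<theta> t x"
    by (simp add: stock_cdf_def)
  have eq: "indicat_real {x<..} z = 1 - indicat_real {..x} z" for z by (auto simp: indicator_def)
  show "integrable (law C) (\<lambda>\<omega>. indicat_real {x<..} (stock \<theta> \<omega> t))"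
    unfolding eq using i by simp
  show "(\<integral>\<omega>. indicat_real {x<..} (stock \<theta> \<omega> t) \<partial>law C) = 1 - stock_cdf \<theta> t x"
    unfolding eq using i e by (simp add: law.prob_space)
qed

lemma stock_cdf_bounds: "0 \<le> stock_cdf \<theta> t x" "stock_cdf \<theta> t x \<le> 1"
  by (auto simp: stock_cdf_def)

subsection \<open>Gradient and smoothness of the objective\<close>

text \<open>The level \<open>lo \<theta> t\<close> matters only when the stock is below it, and then the marginal cost of
  raising it is \<open>k\<close> plus the slope of the cost-to-go; similarly for \<open>hi \<theta> t\<close>.\<close>

definition policy_gradient :: "params \<Rightarrow> params" where
  "policy_gradient \<theta> t = (stock_cdf \<theta> t (lo \<theta> t) * (k + post_slope \<theta> t (lo \<theta> t)),
     (1 - stock_cdf \<theta> t (hi \<theta> t)) * (post_slope \<theta> t (hi \<theta> t) - q))"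

lemma post_val_quadratic:
  assumes "\<theta> \<in> Theta C" "t \<in> {1..T}"
  shows "\<bar>post_val \<theta> t y' - post_val \<theta> t y - post_slope \<theta> t y * (y' - y)\<bar> \<le> \<Lambda> * (y' - y)\<^sup>2"
proof -
  have "\<exists>z. \<bar>z - y\<bar> \<le> \<bar>y' - y\<bar> \<and> post_val \<theta> t y' - post_val \<theta> t y = (y' - y) * post_slope \<theta> t z"
  proof (cases y y' rule: linorder_cases)
    case less
    from MVT2[OF less post_val_has_derivative[OF assms]] obtain z where "y < z" "z < y'"
      "post_val \<theta> t y' - post_val \<theta> t y = (y' - y) * post_slope \<theta> t z" by blast
    then show ?thesis by (intro exI[of _ z]) auto
  next
    case greater
    from MVT2[OF greater post_val_has_derivative[OF assms]] obtain z where "y' < z" "z < y"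
      "post_val \<theta> t y - post_val \<theta> t y' = (y - y') * post_slope \<theta> t z" by blast
    then show ?thesis by (intro exI[of _ z]) (auto simp: algebra_simps)
  qed auto
  then obtain z where z: "\<bar>z - y\<bar> \<le> \<bar>y' - y\<bar>"
    "post_val \<theta> t y' - post_val \<theta> t y = (y' - y) * post_slope \<theta> t z" by blast
  have "post_val \<theta> t y' - post_val \<theta> t y - post_slope \<theta> t y * (y' - y) = (y' - y) * (post_slope \<theta> t z - post_slope \<theta> t y)"
    unfolding z(2) by (simp add: algebra_simps)
  then have "\<bar>post_val \<theta> t y' - post_val \<theta> t y - post_slope \<theta> t y * (y' - y)\<bar>
      = \<bar>y' - y\<bar> * \<bar>post_slope \<theta> t z - post_slope \<theta> t y\<bar>"
    by (simp add: abs_mult)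
  also have "\<dots> \<le> \<bar>y' - y\<bar> * (\<Lambda> * \<bar>z - y\<bar>)"
    by (intro mult_left_mono post_slope_lipschitz[OF assms(2)]) simp
  also have "\<dots> \<le> \<bar>y' - y\<bar> * (\<Lambda> * \<bar>y' - y\<bar>)"
    using z(1) \<Lambda>_nonneg by (intro mult_left_mono) auto
  also have "\<dots> = \<Lambda> * (y' - y)\<^sup>2" by (simp add: power2_eq_square)
  finally show ?thesis .
qed

text \<open>A first-order expansion for a fixed stock \<open>s\<close>, accurate up to the curvature
  \<open>\<Lambda>\<close> when \<open>s\<close> lies on the same side of the old and the new
  levels. Otherwise it may fail by the order of \<open>e\<close>, but the indicator differences
  confine this to stocks between an old and a new level, an event whose probability is again of
  order \<open>e\<close>.\<close>

lemma advantage_quadratic: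
  assumes \<theta>: "\<theta> \<in> Theta C" and t: "t \<in> {1..T}" and ab: "fst ab \<le> snd ab"
    and e: "\<bar>fst ab - lo \<theta> t\<bar> \<le> e" "\<bar>snd ab - hi \<theta> t\<bar> \<le> e"
  shows "\<bar>advantage \<theta> t ab s
     - (indicat_real {..lo \<theta> t} s * ((k + post_slope \<theta> t (lo \<theta> t)) * (fst ab - lo \<theta> t))
      + indicat_real {hi \<theta> t<..} s * ((post_slope \<theta> t (hi \<theta> t) - q) * (snd ab - hi \<theta> t)))\<bar>
   \<le> \<Lambda> * e\<^sup>2 + 4 * \<Phi> * e * (\<bar>indicat_real {..fst ab} s - indicat_real {..lo \<theta> t} s\<bar>
      + \<bar>indicat_real {..snd ab} s - indicat_real {..hi \<theta> t} s\<bar>)"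
proof -
  have lh: "lo \<theta> t \<le> hi \<theta> t" and tT: "t \<le> T" using Theta_D[OF \<theta> t] t by auto
  have e0: "0 \<le> e" using e by linarith
  have adv: "advantage \<theta> t ab s = (trans_cost C (base_stock ab s) s + post_val \<theta> t (base_stock ab s))
      - (trans_cost C (base_stock (\<theta> t) s) s + post_val \<theta> t (base_stock (\<theta> t) s))"
    by (simp add: advantage_def pol_val_rec[OF tT])
  have sq: "\<Lambda> * x\<^sup>2 \<le> \<Lambda> * e\<^sup>2" if "\<bar>x\<bar> \<le> e" for x
    using that \<Lambda>_nonneg by (intro mult_left_mono) (auto simp: abs_le_square_iff[symmetric])
  have Le: "0 \<le> \<Lambda> * e\<^sup>2" using \<Lambda>_nonneg by simp
  have qd: "\<bar>post_val \<theta> t y' - post_val \<theta> t y - post_slope \<theta> t y * (y' - y)\<bar> \<le> \<Lambda> * e\<^sup>2" if "\<bar>y' - y\<bar> \<le> e" for y y'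
    using post_val_quadratic[OF \<theta> t, of y' y] sq[OF that] by linarith
  consider "s \<le> lo \<theta> t" "s \<le> fst ab" | "hi \<theta> t < s" "snd ab < s"
    | "lo \<theta> t < s" "s \<le> hi \<theta> t" "fst ab < s" "s \<le> snd ab"
    | "(s \<le> fst ab) \<noteq> (s \<le> lo \<theta> t) \<or> (s \<le> snd ab) \<noteq> (s \<le> hi \<theta> t)"
    using lh ab by linarith
  then show ?thesis
  proof cases
    case 1
    then have "advantage \<theta> t ab s - (k + post_slope \<theta> t (lo \<theta> t)) * (fst ab - lo \<theta> t)
        = post_val \<theta> t (fst ab) - post_val \<theta> t (lo \<theta> t) - post_slope \<theta> t (lo \<theta> t) * (fst ab - lo \<theta> t)"
      using lh ab unfolding adv trans_cost_base_stock[OF lh] trans_cost_base_stock[OF ab]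
      by (simp add: base_stock_def algebra_simps)
    then show ?thesis using 1 lh ab qd[OF e(1)] by simp
  next
    case 2
    then have "advantage \<theta> t ab s - (post_slope \<theta> t (hi \<theta> t) - q) * (snd ab - hi \<theta> t)
        = post_val \<theta> t (snd ab) - post_val \<theta> t (hi \<theta> t) - post_slope \<theta> t (hi \<theta> t) * (snd ab - hi \<theta> t)"
      using lh ab unfolding adv trans_cost_base_stock[OF lh] trans_cost_base_stock[OF ab]
      by (simp add: base_stock_def algebra_simps)
    then show ?thesis using 2 lh ab qd[OF e(2)] by simp
  next
    case 3
    then show ?thesis using lh ab Le
      unfolding adv trans_cost_base_stock[OF lh] trans_cost_base_stock[OF ab]
      by (simp add: base_stock_def)
  next
    case 4
    define u v where "u = max (fst ab - s) 0 - max (lo \<theta> t - s) 0" and "v = max (s - snd ab) 0 - max (s - hi \<theta> t) 0"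
    have uv: "\<bar>u\<bar> \<le> e" "\<bar>v\<bar> \<le> e" using e by (auto simp: u_def v_def)
    have bs: "\<bar>base_stock ab s - base_stock (\<theta> t) s\<bar> \<le> e" using e by (intro base_stock_lipschitz) auto
    have "advantage \<theta> t ab s = k * u + q * v + (post_val \<theta> t (base_stock ab s) - post_val \<theta> t (base_stock (\<theta> t) s))"
      unfolding adv trans_cost_base_stock[OF lh] trans_cost_base_stock[OF ab] by (simp add: u_def v_def algebra_simps)
    moreover have "\<bar>k * u\<bar> \<le> \<bar>k\<bar> * e" "\<bar>q * v\<bar> \<le> \<bar>q\<bar> * e" using uv by (auto simp: abs_mult intro!: mult_left_mono)
    moreover have "\<bar>post_val \<theta> t (base_stock ab s) - post_val \<theta> t (base_stock (\<theta> t) s)\<bar> \<le> \<Phi> * e"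
      using post_val_lipschitz[OF \<theta> t] bs \<Phi>_ge(3) by (meson mult_left_mono order_trans)
    moreover have "\<bar>k\<bar> * e + \<bar>q\<bar> * e \<le> \<Phi> * e"
      using \<Phi>_ge(1) e0 by (simp add: distrib_right[symmetric] mult_right_mono)
    ultimately have a: "\<bar>advantage \<theta> t ab s\<bar> \<le> 2 * \<Phi> * e" by linarith
    have "\<bar>(k + post_slope \<theta> t (lo \<theta> t)) * (fst ab - lo \<theta> t)\<bar> \<le> 2 * \<Phi> * e"
      unfolding abs_mult using e \<Phi>_ge post_slope_abs_le[OF t, of \<theta> "lo \<theta> t"] by (intro mult_mono) auto
    moreover have "\<bar>(post_slope \<theta> t (hi \<theta> t) - q) * (snd ab - hi \<theta> t)\<bar> \<le> 2 * \<Phi> * e"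
      unfolding abs_mult using e \<Phi>_ge post_slope_abs_le[OF t, of \<theta> "hi \<theta> t"] by (intro mult_mono) auto
    moreover have "0 \<le> 2 * \<Phi> * e" using \<Phi>_ge(3) e0 by simp
    ultimately have b: "\<bar>indicat_real {..lo \<theta> t} s * ((k + post_slope \<theta> t (lo \<theta> t)) * (fst ab - lo \<theta> t))
      + indicat_real {hi \<theta> t<..} s * ((post_slope \<theta> t (hi \<theta> t) - q) * (snd ab - hi \<theta> t))\<bar> \<le> 2 * \<Phi> * e"
      using lh by (auto simp: indicator_def)
    have "1 \<le> \<bar>indicat_real {..fst ab} s - indicat_real {..lo \<theta> t} s\<bar>
      + \<bar>indicat_real {..snd ab} s - indicat_real {..hi \<theta> t} s\<bar>"
      using 4 by (auto simp: indicator_def)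
    then have "4 * \<Phi> * e * 1 \<le> 4 * \<Phi> * e * (\<bar>indicat_real {..fst ab} s - indicat_real {..lo \<theta> t} s\<bar>
      + \<bar>indicat_real {..snd ab} s - indicat_real {..hi \<theta> t} s\<bar>)"
      using \<Phi>_ge(3) e0 by (intro mult_left_mono) auto
    then show ?thesis using a b Le by linarith
  qed
qed

end

section \<open>Geometry of the parameter set and uniqueness of gradients relative to it\<close>

lemma abs_fst_le_dist: "\<bar>fst a - fst b\<bar> \<le> dist a b" for a b :: "real \<times> real"
  using dist_fst_le[of a b] by (simp add: dist_real_def)

lemma abs_snd_le_dist: "\<bar>snd a - snd b\<bar> \<le> dist a b" for a b :: "real \<times> real"
  using dist_snd_le[of a b] by (simp add: dist_real_def)

lemma pdist_nonneg: "0 \<le> pdist n u v"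
  by (simp add: pdist_def L2_set_nonneg)

lemma dist_le_pdist: "t \<in> {1..n} \<Longrightarrow> dist (u t) (v t) \<le> pdist n u v"
  unfolding pdist_def by (rule member_le_L2_set) auto

lemma pdist_sq: "(pdist n u v)\<^sup>2 = (\<Sum>t=1..n. (dist (u t) (v t))\<^sup>2)"
  unfolding pdist_def L2_set_def by (simp add: sum_nonneg)

lemma pdist_upd:
  assumes "t \<in> {1..n}" shows "pdist n (u(t := a)) u = dist a (u t)"
proof -
  have "(pdist n (u(t := a)) u)\<^sup>2 = (\<Sum>i=1..n. if i = t then (dist a (u t))\<^sup>2 else 0)"
    unfolding pdist_sq by (intro sum.cong) auto
  also have "\<dots> = (dist a (u t))\<^sup>2" using assms by simp
  finally show ?thesis using pdist_nonneg by (simp add: power2_eq_iff_nonneg)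
qed

lemma Theta_stage_alt: "Theta_stage C = {p. lo_bound C \<le> fst p \<and> fst p \<le> snd p \<and> snd p \<le> hi_bound C}"
  by (auto simp: Theta_stage_def)

lemma closed_Theta_stage: "closed (Theta_stage C)"
  unfolding Theta_stage_alt by (intro closed_Collect_conj closed_Collect_le continuous_intros)

lemma convex_Theta_stage: "convex (Theta_stage C)"
proof (rule convexI)
  fix x y :: "real \<times> real" and u v :: real
  assume xy: "x \<in> Theta_stage C" "y \<in> Theta_stage C" and uv: "0 \<le> u" "0 \<le> v" "u + v = 1"
  have mono: "u * a + v * a' \<le> u * b + v * b'" if "a \<le> b" "a' \<le> b'" for a a' b b'
    using that uv by (intro add_mono mult_left_mono) auto
  have const: "u * c + v * c = c" for c using uv by (simp add: distrib_right[symmetric])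
  show "u *\<^sub>R x + v *\<^sub>R y \<in> Theta_stage C"
    using xy mono[of "lo_bound C" "fst x" "lo_bound C" "fst y"] mono[of "fst x" "snd x" "fst y" "snd y"]
      mono[of "snd x" "hi_bound C" "snd y" "hi_bound C"]
    by (simp add: Theta_stage_alt const)
qed

lemma Theta_upd:
  assumes "\<theta> \<in> Theta C" "t \<in> {1..horizon C}" "a \<in> Theta_stage C"
  shows "\<theta>(t := a) \<in> Theta C"
  using assms by (auto simp: Theta_def PiE_iff extensional_def)

text \<open>Gradients are tested only along admissible directions. From \<open>\<theta> t\<close>
  every point of the convex triangle \<open>Theta_stage C\<close> is approached along a segment, so
  the difference of two gradients is orthogonal to all differences of points of the triangle; as the
  triangle is nondegenerate, these span the plane.\<close>

lemma has_gradient_unique: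
  assumes \<theta>: "\<theta> \<in> Theta C" and t: "t \<in> {1..horizon C}" and nd: "lo_bound C < hi_bound C"
    and g: "has_gradient C l \<theta> g" "has_gradient C l \<theta> g'"
  shows "g t = g' t"
proof -
  have \<theta>t: "\<theta> t \<in> Theta_stage C" using \<theta> t by (auto simp: Theta_def)
  define w where "w = g t - g' t"
  have orth: "w \<bullet> (u - \<theta> t) = 0" if u: "u \<in> Theta_stage C" for u
  proof -
    have small: "\<bar>w \<bullet> (u - \<theta> t)\<bar> \<le> 2 * e * norm (u - \<theta> t)" if e: "0 < e" for e
    proof -
      obtain d where d: "0 < d" "\<And>\<theta>'. \<theta>' \<in> Theta C \<Longrightarrow> pdist (horizon C) \<theta>' \<theta> < d \<Longrightarrow>
        \<bar>l \<theta>' - l \<theta> - (\<Sum>t=1..horizon C. g t \<bullet> (\<theta>' t - \<theta> t))\<bar> \<le> e * pdist (horizon C) \<theta>' \<theta>"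
        using g(1) e unfolding has_gradient_def by blast
      obtain d' where d': "0 < d'" "\<And>\<theta>'. \<theta>' \<in> Theta C \<Longrightarrow> pdist (horizon C) \<theta>' \<theta> < d' \<Longrightarrow>
        \<bar>l \<theta>' - l \<theta> - (\<Sum>t=1..horizon C. g' t \<bullet> (\<theta>' t - \<theta> t))\<bar> \<le> e * pdist (horizon C) \<theta>' \<theta>"
        using g(2) e unfolding has_gradient_def by blast
      define D where "D = min d d'"
      define s where "s = min 1 (D / (2 * (norm (u - \<theta> t) + 1)))"
      have D: "0 < D" using d d' by (simp add: D_def)
      have n1: "0 < 2 * (norm (u - \<theta> t) + 1)" by (simp add: add_nonneg_pos)
      have s: "0 < s" "s \<le> 1" using D n1 by (auto simp: s_def)
      define \<theta>' where "\<theta>' = \<theta>(t := \<theta> t + s *\<^sub>R (u - \<theta> t))"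
      have eq: "\<theta> t + s *\<^sub>R (u - \<theta> t) = (1 - s) *\<^sub>R \<theta> t + s *\<^sub>R u"
        by (simp add: algebra_simps)
      have in\<theta>: "\<theta>' \<in> Theta C"
        unfolding \<theta>'_def eq using s convexD_alt[OF convex_Theta_stage \<theta>t u, of s]
        by (intro Theta_upd \<theta> t) auto
      have pd: "pdist (horizon C) \<theta>' \<theta> = s * norm (u - \<theta> t)"
        unfolding \<theta>'_def pdist_upd[OF t] using s by (simp add: dist_norm)
      have "s * norm (u - \<theta> t) \<le> D / (2 * (norm (u - \<theta> t) + 1)) * norm (u - \<theta> t)"
        by (intro mult_right_mono) (auto simp: s_def)
      also have "\<dots> < D"
      proof -
        have "r < 2 * (r + 1)" if "0 \<le> r" for r :: real using that by simp
        from this[OF norm_ge_zero] have "norm (u - \<theta> t) < 2 * (norm (u - \<theta> t) + 1)" .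
        then show ?thesis using D n1 by (simp add: divide_simps)
      qed
      finally have lt: "pdist (horizon C) \<theta>' \<theta> < D" unfolding pd .
      have sumeq: "(\<Sum>i=1..horizon C. h i \<bullet> (\<theta>' i - \<theta> i)) = s * (h t \<bullet> (u - \<theta> t))" for h :: params
      proof -
        have "(\<Sum>i=1..horizon C. h i \<bullet> (\<theta>' i - \<theta> i)) = (\<Sum>i=1..horizon C. if i = t then s * (h t \<bullet> (u - \<theta> t)) else 0)"
          by (intro sum.cong) (auto simp: \<theta>'_def)
        then show ?thesis using t by simp
      qed
      have "\<bar>l \<theta>' - l \<theta> - s * (g t \<bullet> (u - \<theta> t))\<bar> \<le> e * (s * norm (u - \<theta> t))"
        "\<bar>l \<theta>' - l \<theta> - s * (g' t \<bullet> (u - \<theta> t))\<bar> \<le> e * (s * norm (u - \<theta> t))"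
        using d(2)[OF in\<theta>] d'(2)[OF in\<theta>] lt unfolding sumeq pd D_def by auto
      then have "\<bar>s * (g t \<bullet> (u - \<theta> t)) - s * (g' t \<bullet> (u - \<theta> t))\<bar> \<le> 2 * (e * (s * norm (u - \<theta> t)))"
        by linarith
      then have "\<bar>s * (w \<bullet> (u - \<theta> t))\<bar> \<le> s * (2 * e * norm (u - \<theta> t))"
        by (simp add: w_def algebra_simps)
      then show ?thesis using s by (simp add: abs_mult)
    qed
    show ?thesis
    proof (rule ccontr)
      assume ne: "w \<bullet> (u - \<theta> t) \<noteq> 0"
      let ?n = "norm (u - \<theta> t)"
      have n: "0 < ?n" using ne by auto
      from small[of "\<bar>w \<bullet> (u - \<theta> t)\<bar> / (4 * ?n)"] ne n show False by (simp add: field_simps)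
    qed
  qed
  have "w \<bullet> (u - v) = 0" if "u \<in> Theta_stage C" "v \<in> Theta_stage C" for u v
    using orth[OF that(1)] orth[OF that(2)] by (simp add: inner_diff_right)
  \<comment> \<open>The two legs of the triangle point along the coordinate axes.\<close>
  from this[of "(lo_bound C, hi_bound C)" "(lo_bound C, lo_bound C)"]
    this[of "(hi_bound C, hi_bound C)" "(lo_bound C, hi_bound C)"]
  have "w = 0" using nd by (cases w) (auto simp: Theta_stage_def zero_prod_def)
  then show ?thesis by (simp add: w_def)
qed

section \<open>Second-order expansion of the objective and Lipschitz gradient\<close>

context cash_balance begin

text \<open>Per period, \<open>\<Lambda>\<close> is the curvature of \<open>post_val\<close>,
  \<open>8 * \<Phi> * L\<^sub>s\<close> comes from stocks between old and new levels, and
  \<open>4 * \<Phi> * L\<^sub>s\<close> from replacing the stock distribution under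
  \<open>\<theta>'\<close> by that under \<open>\<theta>\<close>.\<close>

definition "A\<^sub>g = real T * (\<Lambda> + 12 * \<Phi> * L\<^sub>s)"

text \<open>Twice \<open>2 * \<Lambda> + 4 * \<Phi> * L\<^sub>s\<close>, the bound for either
  component of the gradient of one period.\<close>

definition "L\<^sub>g = 4 * \<Lambda> + 8 * \<Phi> * L\<^sub>s"

lemma A\<^sub>g_nonneg: "0 \<le> A\<^sub>g"
  using \<Lambda>_nonneg \<Phi>_ge(3) L\<^sub>s_nonneg by (simp add: A\<^sub>g_def)

lemma L\<^sub>g_nonneg: "0 \<le> L\<^sub>g"
  using \<Lambda>_nonneg \<Phi>_ge(3) L\<^sub>s_nonneg by (simp add: L\<^sub>g_def)

lemma stock_indicator_diff:
  assumes t: "t \<in> {1..T}"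
  shows "integrable (law C) (\<lambda>\<omega>. \<bar>indicat_real {..x} (stock \<theta> \<omega> t) - indicat_real {..y} (stock \<theta> \<omega> t)\<bar>)"
    "(\<integral>\<omega>. \<bar>indicat_real {..x} (stock \<theta> \<omega> t) - indicat_real {..y} (stock \<theta> \<omega> t)\<bar> \<partial>law C) \<le> L\<^sub>s * \<bar>x - y\<bar>"
proof -
  have t': "t \<in> {1..Suc T}" using t by auto
  note ind = stock_cdf_indicator[OF t', where \<theta> = \<theta>]
  show "integrable (law C) (\<lambda>\<omega>. \<bar>indicat_real {..x} (stock \<theta> \<omega> t) - indicat_real {..y} (stock \<theta> \<omega> t)\<bar>)"
    using ind(1) by auto
  have *: "(\<integral>\<omega>. \<bar>indicat_real {..x} (stock \<theta> \<omega> t) - indicat_real {..y} (stock \<theta> \<omega> t)\<bar> \<partial>law C) \<le> L\<^sub>s * \<bar>x - y\<bar>"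
    if "x \<le> y" for x y
  proof -
    have "(\<integral>\<omega>. \<bar>indicat_real {..x} (stock \<theta> \<omega> t) - indicat_real {..y} (stock \<theta> \<omega> t)\<bar> \<partial>law C)
      = (\<integral>\<omega>. indicat_real {..y} (stock \<theta> \<omega> t) - indicat_real {..x} (stock \<theta> \<omega> t) \<partial>law C)"
      using that by (intro Bochner_Integration.integral_cong) (auto simp: indicator_def)
    also have "\<dots> = stock_cdf \<theta> t y - stock_cdf \<theta> t x" using ind by simp
    also have "\<dots> \<le> L\<^sub>s * (0 + \<bar>y - x\<bar>)"
      using stock_cdf_lipschitz[OF t, of 0 \<theta> \<theta> y x] by simp
    finally show ?thesis using that by simp
  qed
  show "(\<integral>\<omega>. \<bar>indicat_real {..x} (stock \<theta> \<omega> t) - indicat_real {..y} (stock \<theta> \<omega> t)\<bar> \<partial>law C) \<le> L\<^sub>s * \<bar>x - y\<bar>"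
    using *[of x y] *[of y x] by (cases "x \<le> y") (simp_all add: abs_minus_commute)
qed

lemma params_close:
  assumes "t \<in> {1..T}"
  shows "\<bar>lo \<theta>' t - lo \<theta> t\<bar> \<le> pdist T \<theta>' \<theta> \<and> \<bar>hi \<theta>' t - hi \<theta> t\<bar> \<le> pdist T \<theta>' \<theta>"
  using dist_le_pdist[OF assms, of \<theta>' \<theta>] abs_fst_le_dist[of "\<theta>' t" "\<theta> t"] abs_snd_le_dist[of "\<theta>' t" "\<theta> t"] by linarith

text \<open>Advantages relative to the old policy \<open>\<theta>\<close> are expanded along
  trajectories of the new one \<open>\<theta>'\<close>. The weights that appear are distribution
  functions of the stock under \<open>\<theta>'\<close>; exchanging them for those under
  \<open>\<theta>\<close> costs a further second-order term, as the coefficients \<open>c\<close>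
  and \<open>d\<close> are already of order \<open>e\<close>.\<close>

lemma objective_quadratic:
  assumes \<theta>: "\<theta> \<in> Theta C" "\<theta>' \<in> Theta C"
  shows "\<bar>objective C \<theta>' - objective C \<theta> - (\<Sum>t=1..T. policy_gradient \<theta> t \<bullet> (\<theta>' t - \<theta> t))\<bar>
    \<le> A\<^sub>g * (pdist T \<theta>' \<theta>)\<^sup>2"
proof -
  define e where "e = pdist T \<theta>' \<theta>"
  have e0: "0 \<le> e" by (simp add: e_def pdist_nonneg)
  have cl: "\<bar>lo \<theta>' t - lo \<theta> t\<bar> \<le> e \<and> \<bar>hi \<theta>' t - hi \<theta> t\<bar> \<le> e" if "t \<in> {1..T}" for t
    unfolding e_def by (rule params_close[OF that])
  have stage: "\<bar>(\<integral>\<omega>. advantage \<theta> t (\<theta>' t) (stock \<theta>' \<omega> t) \<partial>law C) - policy_gradient \<theta> t \<bullet> (\<theta>' t - \<theta> t)\<bar>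
      \<le> (\<Lambda> + 12 * \<Phi> * L\<^sub>s) * e\<^sup>2" if t: "t \<in> {1..T}" for t
  proof -
    have t': "t \<in> {1..Suc T}" using t by auto
    define c d where "c = (k + post_slope \<theta> t (lo \<theta> t)) * (lo \<theta>' t - lo \<theta> t)"
      and "d = (post_slope \<theta> t (hi \<theta> t) - q) * (hi \<theta>' t - hi \<theta> t)"
    have cd: "\<bar>c\<bar> \<le> 2 * \<Phi> * e" "\<bar>d\<bar> \<le> 2 * \<Phi> * e"
      unfolding c_def d_def abs_mult using cl[OF t] \<Phi>_ge post_slope_abs_le[OF t, of \<theta> "lo \<theta> t"]
        post_slope_abs_le[OF t, of \<theta> "hi \<theta> t"] by (auto intro!: mult_mono)
    let ?s = "\<lambda>\<omega>. stock \<theta>' \<omega> t"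
    let ?lin = "\<lambda>\<omega>. indicat_real {..lo \<theta> t} (?s \<omega>) * c + indicat_real {hi \<theta> t<..} (?s \<omega>) * d"
    let ?jl = "\<lambda>\<omega>. \<bar>indicat_real {..lo \<theta>' t} (?s \<omega>) - indicat_real {..lo \<theta> t} (?s \<omega>)\<bar>"
    let ?jh = "\<lambda>\<omega>. \<bar>indicat_real {..hi \<theta>' t} (?s \<omega>) - indicat_real {..hi \<theta> t} (?s \<omega>)\<bar>"
    note ind = stock_cdf_indicator[OF t', where \<theta> = \<theta>']
    note jmp = stock_indicator_diff[OF t, where \<theta> = \<theta>']
    have adv: "integrable (law C) (\<lambda>\<omega>. advantage \<theta> t (\<theta>' t) (?s \<omega>))"
      by (rule advantage_integral(1)[OF \<theta>(2,1) t])
    have lin: "integrable (law C) ?lin" using ind by auto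
    have lineq: "(\<integral>\<omega>. ?lin \<omega> \<partial>law C) = stock_cdf \<theta>' t (lo \<theta> t) * c + (1 - stock_cdf \<theta>' t (hi \<theta> t)) * d"
      using ind by simp
    have "\<bar>(\<integral>\<omega>. advantage \<theta> t (\<theta>' t) (?s \<omega>) \<partial>law C) - (\<integral>\<omega>. ?lin \<omega> \<partial>law C)\<bar>
        = \<bar>\<integral>\<omega>. advantage \<theta> t (\<theta>' t) (?s \<omega>) - ?lin \<omega> \<partial>law C\<bar>"
      using adv lin by (subst Bochner_Integration.integral_diff) auto
    also have "\<dots> \<le> (\<integral>\<omega>. \<Lambda> * e\<^sup>2 + 4 * \<Phi> * e * (?jl \<omega> + ?jh \<omega>) \<partial>law C)"
    proof (rule order_trans[OF integral_abs_bound integral_mono])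
      show "integrable (law C) (\<lambda>\<omega>. \<bar>advantage \<theta> t (\<theta>' t) (?s \<omega>) - ?lin \<omega>\<bar>)"
        by (intro integrable_abs Bochner_Integration.integrable_diff adv lin)
      show "integrable (law C) (\<lambda>\<omega>. \<Lambda> * e\<^sup>2 + 4 * \<Phi> * e * (?jl \<omega> + ?jh \<omega>))"
        by (intro Bochner_Integration.integrable_add integrable_mult_right jmp(1)) simp
      show "\<bar>advantage \<theta> t (\<theta>' t) (?s \<omega>) - ?lin \<omega>\<bar> \<le> \<Lambda> * e\<^sup>2 + 4 * \<Phi> * e * (?jl \<omega> + ?jh \<omega>)" for \<omega>
        unfolding c_def d_def using cl[OF t]
        by (intro advantage_quadratic[OF \<theta>(1) t Theta_D(2)[OF \<theta>(2) t]]) auto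
    qed
    also have "\<dots> = \<Lambda> * e\<^sup>2 + 4 * \<Phi> * e * ((\<integral>\<omega>. ?jl \<omega> \<partial>law C) + (\<integral>\<omega>. ?jh \<omega> \<partial>law C))"
      using jmp(1)[of "lo \<theta>' t" "lo \<theta> t"] jmp(1)[of "hi \<theta>' t" "hi \<theta> t"] by (simp add: law.prob_space)
    also have "\<dots> \<le> \<Lambda> * e\<^sup>2 + 4 * \<Phi> * e * (L\<^sub>s * e + L\<^sub>s * e)"
      using jmp(2)[of "lo \<theta>' t" "lo \<theta> t"] jmp(2)[of "hi \<theta>' t" "hi \<theta> t"] cl[OF t] L\<^sub>s_nonneg e0 \<Phi>_ge(3)
      by (intro add_left_mono mult_left_mono add_mono) (auto intro: order_trans mult_left_mono)
    also have "\<dots> = \<Lambda> * e\<^sup>2 + 8 * \<Phi> * L\<^sub>s * e\<^sup>2" by (simp add: power2_eq_square algebra_simps)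
    finally have 1: "\<bar>(\<integral>\<omega>. advantage \<theta> t (\<theta>' t) (?s \<omega>) \<partial>law C)
      - (stock_cdf \<theta>' t (lo \<theta> t) * c + (1 - stock_cdf \<theta>' t (hi \<theta> t)) * d)\<bar> \<le> \<Lambda> * e\<^sup>2 + 8 * \<Phi> * L\<^sub>s * e\<^sup>2"
      unfolding lineq .
    have F: "\<bar>stock_cdf \<theta>' t x - stock_cdf \<theta> t x\<bar> \<le> L\<^sub>s * e" for x
      using stock_cdf_lipschitz[OF t e0, of \<theta>' \<theta> x x] cl by simp
    have "\<bar>(stock_cdf \<theta>' t (lo \<theta> t) - stock_cdf \<theta> t (lo \<theta> t)) * c\<bar> \<le> (L\<^sub>s * e) * (2 * \<Phi> * e)"
      unfolding abs_mult using F cd L\<^sub>s_nonneg e0 by (intro mult_mono) auto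
    moreover have "\<bar>(stock_cdf \<theta>' t (hi \<theta> t) - stock_cdf \<theta> t (hi \<theta> t)) * d\<bar> \<le> (L\<^sub>s * e) * (2 * \<Phi> * e)"
      unfolding abs_mult using F cd L\<^sub>s_nonneg e0 by (intro mult_mono) auto
    moreover have "policy_gradient \<theta> t \<bullet> (\<theta>' t - \<theta> t) = stock_cdf \<theta> t (lo \<theta> t) * c + (1 - stock_cdf \<theta> t (hi \<theta> t)) * d"
      by (simp add: policy_gradient_def inner_prod_def c_def d_def)
    moreover have "(L\<^sub>s * e) * (2 * \<Phi> * e) = 2 * \<Phi> * L\<^sub>s * e\<^sup>2" by (simp add: power2_eq_square)
    ultimately show ?thesis
      using 1 by (simp add: distrib_right left_diff_distrib)
  qed
  have "objective C \<theta>' - objective C \<theta> - (\<Sum>t=1..T. policy_gradient \<theta> t \<bullet> (\<theta>' t - \<theta> t))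
      = (\<Sum>t=1..T. (\<integral>\<omega>. advantage \<theta> t (\<theta>' t) (stock \<theta>' \<omega> t) \<partial>law C) - policy_gradient \<theta> t \<bullet> (\<theta>' t - \<theta> t))"
    unfolding performance_difference[OF \<theta>(2,1)] by (simp add: sum_subtractf)
  also have "\<bar>\<dots>\<bar> \<le> (\<Sum>t=1..T. (\<Lambda> + 12 * \<Phi> * L\<^sub>s) * e\<^sup>2)"
    by (rule order_trans[OF sum_abs sum_mono[OF stage]])
  also have "\<dots> = A\<^sub>g * e\<^sup>2" by (simp add: A\<^sub>g_def)
  finally show ?thesis by (simp add: e_def)
qed

text \<open>Each component is a probability times a marginal cost, both bounded and Lipschitz in
  position and policy. The left side concerns one period but the right side the distance of all
  levels, so summing squares over the periods later produces
  \<open>real T * L\<^sub>g\<^sup>2\<close>.\<close>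

lemma policy_gradient_lipschitz:
  assumes \<theta>: "\<theta> \<in> Theta C" "\<theta>' \<in> Theta C" and t: "t \<in> {1..T}"
  shows "norm (policy_gradient \<theta> t - policy_gradient \<theta>' t) \<le> L\<^sub>g * pdist T \<theta> \<theta>'"
proof -
  define e where "e = pdist T \<theta> \<theta>'"
  have e0: "0 \<le> e" by (simp add: e_def pdist_nonneg)
  have cl: "\<bar>lo \<theta> t - lo \<theta>' t\<bar> \<le> e \<and> \<bar>hi \<theta> t - hi \<theta>' t\<bar> \<le> e" if "t \<in> {1..T}" for t
    unfolding e_def by (rule params_close[OF that])
  have prod: "\<bar>w * a - w' * a'\<bar> \<le> (2 * \<Lambda> + 4 * \<Phi> * L\<^sub>s) * e"
    if "\<bar>w - w'\<bar> \<le> 2 * L\<^sub>s * e" "\<bar>a\<bar> \<le> 2 * \<Phi>" "\<bar>w'\<bar> \<le> 1" "\<bar>a - a'\<bar> \<le> 2 * \<Lambda> * e" for w w' a a'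
  proof -
    have "w * a - w' * a' = (w - w') * a + w' * (a - a')" by (simp add: algebra_simps)
    moreover have "\<bar>(w - w') * a\<bar> \<le> (2 * L\<^sub>s * e) * (2 * \<Phi>)"
      unfolding abs_mult using that L\<^sub>s_nonneg e0 by (intro mult_mono) auto
    moreover have "\<bar>w' * (a - a')\<bar> \<le> 1 * (2 * \<Lambda> * e)"
      unfolding abs_mult using that by (intro mult_mono) auto
    ultimately show ?thesis by (simp add: algebra_simps)
  qed
  have slope: "\<bar>post_slope \<theta> t x - post_slope \<theta>' t x'\<bar> \<le> 2 * \<Lambda> * e" if "\<bar>x - x'\<bar> \<le> e" for x x'
    using post_slope_lipschitz[OF t, of \<theta> x x'] mult_left_mono[OF that \<Lambda>_nonneg]
      post_slope_param_lipschitz[OF \<theta> e0 cl t, of x'] by linarith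
  have cdf: "\<bar>stock_cdf \<theta> t x - stock_cdf \<theta>' t x'\<bar> \<le> 2 * L\<^sub>s * e" if "\<bar>x - x'\<bar> \<le> e" for x x'
  proof -
    have "\<bar>stock_cdf \<theta> t x - stock_cdf \<theta>' t x'\<bar> \<le> L\<^sub>s * (e + \<bar>x - x'\<bar>)"
      by (rule stock_cdf_lipschitz[OF t e0 cl])
    also have "\<dots> \<le> L\<^sub>s * (e + e)" using that L\<^sub>s_nonneg by (intro mult_left_mono) auto
    finally show ?thesis by simp
  qed
  note cb = stock_cdf_bounds
  have "\<bar>fst (policy_gradient \<theta> t - policy_gradient \<theta>' t)\<bar> \<le> (2 * \<Lambda> + 4 * \<Phi> * L\<^sub>s) * e"
    unfolding policy_gradient_def fst_diff fst_conv
    using cdf slope cl[OF t] cb \<Phi>_ge(1) post_slope_abs_le[OF t, of \<theta> "lo \<theta> t"]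
    by (intro prod) auto
  moreover have "\<bar>snd (policy_gradient \<theta> t - policy_gradient \<theta>' t)\<bar> \<le> (2 * \<Lambda> + 4 * \<Phi> * L\<^sub>s) * e"
    unfolding policy_gradient_def snd_diff snd_conv
    using cdf[of "hi \<theta> t" "hi \<theta>' t"] slope cl[OF t] cb[of \<theta>' t "hi \<theta>' t"] \<Phi>_ge(1) post_slope_abs_le[OF t, of \<theta> "hi \<theta> t"]
    by (intro prod) auto
  moreover have "norm x \<le> \<bar>fst x\<bar> + \<bar>snd x\<bar>" for x :: "real \<times> real"
    using norm_Pair_le[of "fst x" "snd x"] by simp
  ultimately have "norm (policy_gradient \<theta> t - policy_gradient \<theta>' t) \<le> 2 * ((2 * \<Lambda> + 4 * \<Phi> * L\<^sub>s) * e)"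
    by (smt (verit))
  then show ?thesis by (simp add: L\<^sub>g_def e_def algebra_simps)
qed

lemma has_gradient_policy_gradient:
  assumes \<theta>: "\<theta> \<in> Theta C"
  shows "has_gradient C (objective C) \<theta> (policy_gradient \<theta>)"
  unfolding has_gradient_def
proof (intro allI impI)
  fix e :: real assume e: "0 < e"
  show "\<exists>d>0. \<forall>\<theta>'\<in>Theta C. pdist T \<theta>' \<theta> < d \<longrightarrow>
    \<bar>objective C \<theta>' - objective C \<theta> - (\<Sum>t=1..T. policy_gradient \<theta> t \<bullet> (\<theta>' t - \<theta> t))\<bar> \<le> e * pdist T \<theta>' \<theta>"
  proof (intro exI[of _ "e / (A\<^sub>g + 1)"] conjI ballI impI)
    show "0 < e / (A\<^sub>g + 1)" using e A\<^sub>g_nonneg by simp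
    fix \<theta>' assume \<theta>': "\<theta>' \<in> Theta C" and lt: "pdist T \<theta>' \<theta> < e / (A\<^sub>g + 1)"
    have "(A\<^sub>g + 1) * pdist T \<theta>' \<theta> \<le> e" using lt A\<^sub>g_nonneg by (simp add: field_simps)
    then have "A\<^sub>g * pdist T \<theta>' \<theta> \<le> e"
      using pdist_nonneg[of T \<theta>' \<theta>] by (simp add: distrib_right)
    then have "A\<^sub>g * pdist T \<theta>' \<theta> * pdist T \<theta>' \<theta> \<le> e * pdist T \<theta>' \<theta>"
      by (intro mult_right_mono pdist_nonneg)
    then show "\<bar>objective C \<theta>' - objective C \<theta> - (\<Sum>t=1..T. policy_gradient \<theta> t \<bullet> (\<theta>' t - \<theta> t))\<bar> \<le> e * pdist T \<theta>' \<theta>"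
      using objective_quadratic[OF \<theta> \<theta>'] by (simp add: power2_eq_square mult.assoc)
  qed
qed

text \<open>\<open>grad\<close> is an arbitrary choice among the gradients relative to
  \<open>Theta C\<close>; uniqueness identifies it as soon as the triangle of admissible levels has
  interior.\<close>

lemma grad_eq_policy_gradient:
  assumes "\<theta> \<in> Theta C" "t \<in> {1..T}" "B\<^sub>l < B\<^sub>u"
  shows "grad C \<theta> t = policy_gradient \<theta> t"
proof -
  have "has_gradient C (objective C) \<theta> (grad C \<theta>)"
    unfolding grad_def using has_gradient_policy_gradient[OF assms(1)] by (rule someI[where P = "has_gradient C (objective C) \<theta>"])
  then show ?thesis
    using has_gradient_unique[OF assms] has_gradient_policy_gradient[OF assms(1)] by blast
qed

end

lemma is_arg_min_iff_le: "is_arg_min f (\<lambda>_. True) x \<longleftrightarrow> (\<forall>y. f x \<le> (f y :: real))"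
  by (auto simp: is_arg_min_def not_less)

section \<open>Gradient domination\<close>

locale optimal_cash_balance = cash_balance +
  fixes V :: "nat \<Rightarrow> real \<Rightarrow> real" and \<theta>\<^sub>s :: params and \<alpha> m \<mu>\<^sub>D :: real
  assumes value_opt: "optimal_value C V"
    and params_opt: "optimal_params C V \<theta>\<^sub>s"
    and \<alpha>_pos: "0 < \<alpha>"
    and initial_lo: "\<alpha> \<le> cdf (distr (law C) borel (\<lambda>\<omega>. \<omega> 0)) (lo_bound C)"
    and initial_hi: "cdf (distr (law C) borel (\<lambda>\<omega>. \<omega> 0)) (hi_bound C) \<le> 1 - \<alpha>"
    and demand_hi: "\<alpha> \<le> \<P>(\<omega> in law C. \<omega> 1 \<ge> hi_bound C - lo_bound C)"
    and demand_lo: "\<alpha> \<le> \<P>(\<omega> in law C. \<omega> 1 \<le> lo_bound C - hi_bound C)"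
    and m_pos: "0 < m" and m_le: "\<And>t. t \<in> {1..horizon C} \<Longrightarrow> m \<le> holding C t + backlog C t"
    and \<mu>_pos: "0 < \<mu>\<^sub>D"
    and demand_density: "\<exists>f. distributed (law C) lborel (\<lambda>\<omega>. \<omega> 1) f \<and>
      (\<forall>x\<in>{lo_bound C..hi_bound C}. ennreal \<mu>\<^sub>D \<le> f x)"
begin

lemma \<theta>\<^sub>s_Theta: "\<theta>\<^sub>s \<in> Theta C"
  using params_opt by (simp add: optimal_params_def)

text \<open>A modulus of strong convexity of the mismatch cost on the admissible interval: the
  second derivative is the sum of the two rates times the demand density.\<close>

definition "\<kappa> = m * \<mu>\<^sub>D"

lemma \<kappa>_pos: "0 < \<kappa>"
  using m_pos \<mu>_pos by (simp add: \<kappa>_def)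

lemma cdf_demand_bounds:
  "cdf demand (B\<^sub>u - B\<^sub>l) \<le> 1 - \<alpha>" "\<alpha> \<le> cdf demand (B\<^sub>l - B\<^sub>u)"
proof -
  have m: "(\<lambda>\<omega>. \<omega> 1) \<in> borel_measurable (law C)"
    using horizon_pos by (intro coordinate_measurable) auto
  have "measure demand {B\<^sub>u - B\<^sub>l..} = \<P>(\<omega> in law C. \<omega> 1 \<ge> B\<^sub>u - B\<^sub>l)"
    unfolding demand_def by (subst measure_distr[OF m]) (auto intro!: arg_cong[where f = law.prob])
  then show "cdf demand (B\<^sub>u - B\<^sub>l) \<le> 1 - \<alpha>"
    using demand_hi D.prob_ge[of "B\<^sub>u - B\<^sub>l"] by simp
  have "measure demand {..B\<^sub>l - B\<^sub>u} = \<P>(\<omega> in law C. \<omega> 1 \<le> B\<^sub>l - B\<^sub>u)"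
    unfolding demand_def by (subst measure_distr[OF m]) (auto intro!: arg_cong[where f = law.prob])
  then show "\<alpha> \<le> cdf demand (B\<^sub>l - B\<^sub>u)"
    using demand_lo by (simp add: cdf_def)
qed

lemma \<alpha>_le_1: "\<alpha> \<le> 1"
  using cdf_demand_bounds(2) D.cdf_bounded_prob[of "B\<^sub>l - B\<^sub>u"] by linarith

text \<open>The preceding post-decision stock is at most \<open>B\<^sub>u\<close>, so a demand of at
  least \<open>B\<^sub>u - B\<^sub>l\<close> brings the stock to \<open>B\<^sub>l\<close> or below,
  whatever the policy. The weights in the gradient therefore stay away from zero.\<close>

lemma stock_cdf_ge:
  assumes \<theta>: "\<theta> \<in> Theta C" and t: "t \<in> {1..T}" and x: "B\<^sub>l \<le> x"
  shows "\<alpha> \<le> stock_cdf \<theta> t x"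
proof (cases "t = 1")
  case True
  interpret I: real_distribution "distr (law C) borel (\<lambda>\<omega>. \<omega> 0)"
    by (intro law.real_distribution_distr coordinate_measurable) auto
  show ?thesis
    unfolding True stock_cdf_1 using initial_lo I.cdf_nondecreasing[OF x] by linarith
next
  case False
  define i where "i = t - 1"
  have i: "t = Suc i" "i \<in> {1..T}" using t False by (auto simp: i_def)
  have "\<alpha> = (\<integral>\<omega>. \<alpha> \<partial>law C)" by (simp add: law.prob_space)
  also have "\<dots> \<le> (\<integral>\<omega>. 1 - cdf demand (post_stock \<theta> \<omega> i - x) \<partial>law C)"
  proof (rule integral_mono[OF _ stock_cdf_Suc(2)[OF i(2)]])
    fix \<omega>
    have "cdf demand (post_stock \<theta> \<omega> i - x) \<le> cdf demand (B\<^sub>u - B\<^sub>l)"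
      using post_stock_bounds[OF \<theta> i(2), of "stock \<theta> \<omega> i"] x by (intro D.cdf_nondecreasing) auto
    then show "\<alpha> \<le> 1 - cdf demand (post_stock \<theta> \<omega> i - x)" using cdf_demand_bounds(1) by linarith
  qed simp
  finally show ?thesis unfolding i(1) stock_cdf_Suc(1)[OF i(2)] .
qed

lemma stock_cdf_le:
  assumes \<theta>: "\<theta> \<in> Theta C" and t: "t \<in> {1..T}" and x: "x \<le> B\<^sub>u"
  shows "\<alpha> \<le> 1 - stock_cdf \<theta> t x"
proof (cases "t = 1")
  case True
  interpret I: real_distribution "distr (law C) borel (\<lambda>\<omega>. \<omega> 0)"
    by (intro law.real_distribution_distr coordinate_measurable) auto
  show ?thesis
    unfolding True stock_cdf_1 using initial_hi I.cdf_nondecreasing[OF x] by linarith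
next
  case False
  define i where "i = t - 1"
  have i: "t = Suc i" "i \<in> {1..T}" using t False by (auto simp: i_def)
  have "(\<integral>\<omega>. 1 - cdf demand (post_stock \<theta> \<omega> i - x) \<partial>law C) \<le> (\<integral>\<omega>. 1 - \<alpha> \<partial>law C)"
  proof (rule integral_mono[OF stock_cdf_Suc(2)[OF i(2)]])
    fix \<omega>
    have "cdf demand (B\<^sub>l - B\<^sub>u) \<le> cdf demand (post_stock \<theta> \<omega> i - x)"
      using post_stock_bounds[OF \<theta> i(2), of "stock \<theta> \<omega> i"] x by (intro D.cdf_nondecreasing) auto
    then show "1 - cdf demand (post_stock \<theta> \<omega> i - x) \<le> 1 - \<alpha>" using cdf_demand_bounds(2) by linarith
  qed simp
  also have "\<dots> = 1 - \<alpha>" by (simp add: law.prob_space)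
  finally show ?thesis unfolding i(1) stock_cdf_Suc(1)[OF i(2)] by linarith
qed

lemma cdf_demand_increase:
  assumes "B\<^sub>l \<le> x" "x \<le> y" "y \<le> B\<^sub>u"
  shows "\<mu>\<^sub>D * (y - x) \<le> cdf demand y - cdf demand x"
proof (cases "x = y")
  case False
  then have xy: "x < y" using assms by simp
  obtain f where f: "distributed (law C) lborel (\<lambda>\<omega>. \<omega> 1) f" "\<And>x. x \<in> {B\<^sub>l..B\<^sub>u} \<Longrightarrow> ennreal \<mu>\<^sub>D \<le> f x"
    using demand_density by blast
  have fm [measurable]: "f \<in> borel_measurable borel"
    using distributed_borel_measurable[OF f(1)] by simp
  have "ennreal (\<mu>\<^sub>D * (y - x)) = (\<integral>\<^sup>+ z. ennreal \<mu>\<^sub>D * indicator {x<..y} z \<partial>lborel)"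
    using xy \<mu>_pos by (simp add: nn_integral_cmult_indicator ennreal_mult)
  also have "\<dots> \<le> (\<integral>\<^sup>+ z. f z * indicator {x<..y} z \<partial>lborel)"
    using assms f(2) by (intro nn_integral_mono) (auto simp: indicator_def)
  also have "\<dots> = emeasure (density lborel f) {x<..y}"
    by (rule emeasure_density[symmetric]) auto
  also have "density lborel f = distr (law C) lborel (\<lambda>\<omega>. \<omega> 1)"
    by (rule distributed_distr_eq_density[OF f(1), symmetric])
  also have "\<dots> = demand" unfolding demand_def by (rule distr_cong) auto
  also have "emeasure demand {x<..y} = ennreal (cdf demand y - cdf demand x)"
    unfolding D.cdf_diff_eq[OF xy] by (rule D.emeasure_eq_measure)
  finally show ?thesis
    using D.cdf_nondecreasing[OF assms(2)] by (subst (asm) ennreal_le_iff) auto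
qed simp

lemma mismatch_slope_convolution:
  assumes "t \<in> {1..T}"
  shows "(\<integral>x. mismatch_slope C t (y - x) \<partial>demand) = - backlog C t + (holding C t + backlog C t) * cdf demand y"
proof -
  have "(\<integral>x. mismatch_slope C t (y - x) \<partial>demand)
      = (\<integral>x. - backlog C t + (holding C t + backlog C t) * indicat_real {..<y} x \<partial>demand)"
    by (intro Bochner_Integration.integral_cong) (auto simp: mismatch_slope_def indicator_def)
  also have "\<dots> = - backlog C t + (holding C t + backlog C t) * measure demand {..<y}"
    by (subst Bochner_Integration.integral_add)
      (auto intro!: integrable_mult_right integrable_real_indicator simp: D.prob_UNIV D.emeasure_eq_measure)
  finally show ?thesis by (simp add: D.prob_lt_eq_cdf)
qed

abbreviation "\<phi> \<equiv> post_slope \<theta>\<^sub>s"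
abbreviation "f \<equiv> post_val \<theta>\<^sub>s"

text \<open>The future enters through a monotone slope and can only help; strong monotonicity comes
  from the mismatch cost of the current period alone. Hence \<open>\<kappa>\<close> is the same for
  all periods.\<close>

lemma post_slope_mono_step:
  assumes t: "t \<in> {1..T}" and mono: "mono (pol_slope \<theta>\<^sub>s (Suc t))"
  shows "mono (\<phi> t)" "\<And>x y. B\<^sub>l \<le> x \<Longrightarrow> x \<le> y \<Longrightarrow> y \<le> B\<^sub>u \<Longrightarrow> \<kappa> * (y - x) \<le> \<phi> t y - \<phi> t x"
proof -
  have int: "(\<integral>z. pol_slope \<theta>\<^sub>s (Suc t) (x - z) \<partial>demand) \<le> (\<integral>z. pol_slope \<theta>\<^sub>s (Suc t) (y - z) \<partial>demand)"
    if "x \<le> y" for x y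
    using that by (intro integral_mono pol_slope_integrable[OF t] monoD[OF mono]) auto
  have diff: "(holding C t + backlog C t) * (cdf demand y - cdf demand x) \<le> \<phi> t y - \<phi> t x" if "x \<le> y" for x y
    using int[OF that] unfolding post_slope_eq[OF t] mismatch_slope_convolution[OF t] by (simp add: algebra_simps)
  have hb: "m \<le> holding C t + backlog C t" by (rule m_le[OF t])
  show "mono (\<phi> t)"
  proof (rule monoI)
    fix x y :: real assume "x \<le> y"
    have "0 \<le> (holding C t + backlog C t) * (cdf demand y - cdf demand x)"
      using hb m_pos D.cdf_nondecreasing[OF \<open>x \<le> y\<close>] by (intro mult_nonneg_nonneg) auto
    then show "\<phi> t x \<le> \<phi> t y" using diff[OF \<open>x \<le> y\<close>] by linarith
  qed
  fix x y assume xy: "B\<^sub>l \<le> x" "x \<le> y" "y \<le> B\<^sub>u"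
  have "\<kappa> * (y - x) = m * (\<mu>\<^sub>D * (y - x))" by (simp add: \<kappa>_def)
  also have "\<dots> \<le> (holding C t + backlog C t) * (cdf demand y - cdf demand x)"
    using hb m_pos cdf_demand_increase[OF xy] \<mu>_pos xy by (intro mult_mono) auto
  also have "\<dots> \<le> \<phi> t y - \<phi> t x" by (rule diff[OF xy(2)])
  finally show "\<kappa> * (y - x) \<le> \<phi> t y - \<phi> t x" .
qed

lemma post_val_MVT:
  assumes "t \<in> {1..T}" "x < y"
  obtains z where "x < z" "z < y" "f t y - f t x = (y - x) * \<phi> t z"
  using MVT2[OF assms(2) post_val_has_derivative[OF \<theta>\<^sub>s_Theta assms(1)]] by blast

text \<open>As \<open>k + q\<close> is nonnegative, the transaction cost is the maximum of two
  linear functions; either lower bound separates the decision \<open>y\<close> from the stock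
  \<open>s\<close>.\<close>

lemma trans_cost_ge: "k * (y - s) \<le> trans_cost C y s" "q * (s - y) \<le> trans_cost C y s"
proof -
  have "0 \<le> (k + q) * (s - y)" if "y \<le> s" using that cost_sum by simp
  moreover have "0 \<le> (k + q) * (y - s)" if "s \<le> y" using that cost_sum by simp
  ultimately show "k * (y - s) \<le> trans_cost C y s" "q * (s - y) \<le> trans_cost C y s"
    by (auto simp: trans_cost_def algebra_simps not_le)
qed

lemma post_cost_eq:
  assumes t: "t \<in> {1..T}" and VS: "V (Suc t) = pol_val \<theta>\<^sub>s (Suc t)"
  shows "post_cost C V t y = f t y"
proof -
  have [measurable]: "pol_val \<theta>\<^sub>s (Suc t) \<in> borel_measurable borel"
    using t by (intro pol_val_measurable \<theta>\<^sub>s_Theta) auto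
  show ?thesis
    unfolding post_cost_def VS post_val_eq[OF \<theta>\<^sub>s_Theta t]
    by (subst integral_demand(1)[OF t]) auto
qed

text \<open>Convexity of the optimal cost-to-go makes the base-stock policy optimal, so that the optimal
  value is itself the cost-to-go of a base-stock policy.\<close>

lemma optimal_structure:
  assumes "1 \<le> t" "t \<le> Suc T"
  shows "V t = pol_val \<theta>\<^sub>s t \<and> mono (pol_slope \<theta>\<^sub>s t) \<and>
    (t \<le> T \<longrightarrow> \<phi> t (lo \<theta>\<^sub>s t) = - k \<and> \<phi> t (hi \<theta>\<^sub>s t) = q \<and> mono (\<phi> t) \<and>
      (\<forall>x y. B\<^sub>l \<le> x \<longrightarrow> x \<le> y \<longrightarrow> y \<le> B\<^sub>u \<longrightarrow> \<kappa> * (y - x) \<le> \<phi> t y - \<phi> t x) \<and>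
      (\<forall>y. k * lo \<theta>\<^sub>s t + f t (lo \<theta>\<^sub>s t) \<le> k * y + f t y) \<and>
      (\<forall>y. - q * hi \<theta>\<^sub>s t + f t (hi \<theta>\<^sub>s t) \<le> - q * y + f t y))"
  using assms
proof (induction t rule: backward_induct)
  case last
  have "V (Suc T) = (\<lambda>_. 0)" using value_opt by (auto simp: optimal_value_def)
  then show ?case by (auto simp: fun_eq_iff mono_def)
next
  case (step t)
  have t: "t \<in> {1..T}" using step by auto
  let ?a = "lo \<theta>\<^sub>s t" and ?b = "hi \<theta>\<^sub>s t"
  have ab: "?a \<le> ?b" by (rule Theta_D(2)[OF \<theta>\<^sub>s_Theta t])
  have VS: "V (Suc t) = pol_val \<theta>\<^sub>s (Suc t)" and ms: "mono (pol_slope \<theta>\<^sub>s (Suc t))" using step.IH by auto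
  note post = post_cost_eq[OF t VS]
  note mono = post_slope_mono_step[OF t ms]
  have am: "k * ?a + f t ?a \<le> k * y + f t y" and bm: "- q * ?b + f t ?b \<le> - q * y + f t y" for y
  proof -
    have "is_arg_min (\<lambda>y. k * y + post_cost C V t y) (\<lambda>_. True) ?a"
      "is_arg_min (\<lambda>y. - q * y + post_cost C V t y) (\<lambda>_. True) ?b"
      using params_opt t unfolding optimal_params_def by auto
    then show "k * ?a + f t ?a \<le> k * y + f t y" "- q * ?b + f t ?b \<le> - q * y + f t y"
      unfolding is_arg_min_iff_le post by auto
  qed
  have der: "((\<lambda>y. c * y + f t y) has_real_derivative c + \<phi> t y) (at y)" for c y
    by (auto intro!: derivative_eq_intros post_val_has_derivative[OF \<theta>\<^sub>s_Theta t])
  \<comment> \<open>The optimal levels minimise over all reals, so the first-order condition gives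
    the exact slope there even if a level lies on the boundary of the admissible interval.\<close>
  have "k + \<phi> t ?a = 0" by (rule DERIV_local_min[OF der, of 1]) (use am in auto)
  then have pa: "\<phi> t ?a = - k" by simp
  have "- q + \<phi> t ?b = 0" by (rule DERIV_local_min[OF der, of 1]) (use bm in auto)
  then have pb: "\<phi> t ?b = q" by simp
  have mult: "x \<le> y \<Longrightarrow> 0 \<le> d \<Longrightarrow> d * x \<le> d * y" for d x y :: real by (rule mult_left_mono)
  have le: "trans_cost C (base_stock (\<theta>\<^sub>s t) s) s + f t (base_stock (\<theta>\<^sub>s t) s) \<le> trans_cost C y s + f t y" for s y
  proof -
    consider "s \<le> ?a" | "?b \<le> s" | "?a < s" "s < ?b" by linarith
    then show ?thesis
    proof cases
      case 1
      then show ?thesis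
        using am[of y] trans_cost_ge(1)[of y s] ab
        by (simp add: trans_cost_base_stock[OF ab]) (simp add: base_stock_def algebra_simps)
    next
      case 2
      then show ?thesis
        using bm[of y] trans_cost_ge(2)[of s y] ab
        by (simp add: trans_cost_base_stock[OF ab]) (simp add: base_stock_def algebra_simps)
    next
      \<comment> \<open>Between the levels the slope of \<open>f\<close> lies between
        \<open>- k\<close> and \<open>q\<close>, so neither raising nor lowering the stock
        pays.\<close>
      case 3
      then have eq: "trans_cost C (base_stock (\<theta>\<^sub>s t) s) s + f t (base_stock (\<theta>\<^sub>s t) s) = f t s"
        by (simp add: trans_cost_base_stock[OF ab]) (simp add: base_stock_def)
      show ?thesis
      proof (cases y s rule: linorder_cases)
        case less
        obtain z where z: "y < z" "z < s" "f t s - f t y = (s - y) * \<phi> t z"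
          using post_val_MVT[OF t less] .
        have "\<phi> t z \<le> q" using monoD[OF mono(1), of z ?b] z 3 pb by simp
        then have "f t s - f t y \<le> (s - y) * q" unfolding z(3) using less by (intro mult) auto
        then show ?thesis unfolding eq using trans_cost_ge(2)[of s y] by (simp add: mult.commute)
      next
        case equal
        then show ?thesis unfolding eq by (simp add: trans_cost_def)
      next
        case greater
        obtain z where z: "s < z" "z < y" "f t y - f t s = (y - s) * \<phi> t z"
          using post_val_MVT[OF t greater] .
        have "- k \<le> \<phi> t z" using monoD[OF mono(1), of ?a z] z 3 pa by simp
        then have "(y - s) * (- k) \<le> f t y - f t s" unfolding z(3) using greater by (intro mult) auto
        then show ?thesis unfolding eq using trans_cost_ge(1)[of y s] by (simp add: mult.commute)
      qed
    qed
  qed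
  have "V t s = pol_val \<theta>\<^sub>s t s" for s
  proof -
    obtain y where y: "\<And>y'. trans_cost C y s + f t y \<le> trans_cost C y' s + f t y'" "V t s = trans_cost C y s + f t y"
    proof -
      obtain y where "is_arg_min (\<lambda>y. trans_cost C y s + post_cost C V t y) (\<lambda>_. True) y"
        "V t s = trans_cost C y s + post_cost C V t y"
        using value_opt t unfolding optimal_value_def by blast
      then show thesis using that unfolding is_arg_min_iff_le post by auto
    qed
    show ?thesis
      using y(1)[of "base_stock (\<theta>\<^sub>s t) s"] le[of s y] t
      by (simp add: pol_val_rec y(2))
  qed
  \<comment> \<open>At the optimal levels \<open>\<phi> t\<close> takes the values
    \<open>- k\<close> and \<open>q\<close>, so the branches of the slope meet without a jump;
    monotonicity survives the decision and the induction can go on.\<close>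
  moreover have "mono (pol_slope \<theta>\<^sub>s t)"
  proof (rule monoI)
    fix x y :: real assume "x \<le> y"
    then show "pol_slope \<theta>\<^sub>s t x \<le> pol_slope \<theta>\<^sub>s t y"
      using monoD[OF mono(1), of x y] monoD[OF mono(1), of ?a y] monoD[OF mono(1), of x ?b] pa pb ab cost_sum
      by (auto simp: pol_slope_rec[OF step(2)])
  qed
  ultimately show ?case using pa pb mono am bm by blast
qed

lemma optimal_facts:
  assumes "t \<in> {1..T}"
  shows "\<phi> t (lo \<theta>\<^sub>s t) = - k" "\<phi> t (hi \<theta>\<^sub>s t) = q" "x \<le> y \<Longrightarrow> \<phi> t x \<le> \<phi> t y"
    "B\<^sub>l \<le> x \<Longrightarrow> x \<le> y \<Longrightarrow> y \<le> B\<^sub>u \<Longrightarrow> \<kappa> * (y - x) \<le> \<phi> t y - \<phi> t x"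
    "k * lo \<theta>\<^sub>s t + f t (lo \<theta>\<^sub>s t) \<le> k * y + f t y"
    "- q * hi \<theta>\<^sub>s t + f t (hi \<theta>\<^sub>s t) \<le> - q * y + f t y"
  using optimal_structure[of t] assms by (auto dest: monoD)

lemma pol_val_le:
  assumes t: "t \<in> {1..T}" shows "pol_val \<theta>\<^sub>s t s \<le> trans_cost C y s + f t y"
proof -
  have VS: "V (Suc t) = pol_val \<theta>\<^sub>s (Suc t)" and Vt: "V t = pol_val \<theta>\<^sub>s t"
    using optimal_structure[of t] optimal_structure[of "Suc t"] t by auto
  obtain y' where "is_arg_min (\<lambda>y. trans_cost C y s + post_cost C V t y) (\<lambda>_. True) y'"
    "V t s = trans_cost C y' s + post_cost C V t y'"
    using value_opt t unfolding optimal_value_def by blast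
  then show ?thesis
    unfolding is_arg_min_iff_le post_cost_eq[OF t VS] Vt by auto
qed

lemma level_distance:
  assumes t: "t \<in> {1..T}" and x: "B\<^sub>l \<le> x" "x \<le> B\<^sub>u" and y: "B\<^sub>l \<le> y" "y \<le> B\<^sub>u"
  shows "\<bar>x - y\<bar> \<le> \<bar>\<phi> t x - \<phi> t y\<bar> / \<kappa>"
proof -
  have "\<kappa> * \<bar>x - y\<bar> \<le> \<bar>\<phi> t x - \<phi> t y\<bar>"
    using optimal_facts(4)[OF t, of x y] optimal_facts(4)[OF t, of y x] x y by (cases "x \<le> y") auto
  then show ?thesis using \<kappa>_pos by (simp add: field_simps)
qed

text \<open>The Polyak-Lojasiewicz argument in one dimension: by convexity the gap is at most the
  distance times the slope at \<open>x\<close>, and by strong convexity the distance to the point of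
  zero slope is at most that slope over \<open>\<kappa>\<close>. Used with \<open>c = k\<close> for
  lower levels and \<open>c = - q\<close> for upper ones.\<close>

lemma level_gap:
  assumes t: "t \<in> {1..T}" and x: "B\<^sub>l \<le> x" "x \<le> B\<^sub>u" and y: "B\<^sub>l \<le> y" "y \<le> B\<^sub>u" and c: "\<phi> t y = - c"
  shows "(c * x + f t x) - (c * y + f t y) \<le> (\<phi> t x + c)\<^sup>2 / \<kappa>"
proof -
  have "\<exists>z. \<bar>\<phi> t z + c\<bar> \<le> \<bar>\<phi> t x + c\<bar> \<and> f t x - f t y = (x - y) * \<phi> t z"
  proof (cases x y rule: linorder_cases)
    case less
    obtain z where z: "x < z" "z < y" "f t y - f t x = (y - x) * \<phi> t z" using post_val_MVT[OF t less] .
    then show ?thesis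
      using optimal_facts(3)[OF t, of x z] optimal_facts(3)[OF t, of z y] c
      by (intro exI[of _ z]) (auto simp: algebra_simps)
  next
    case greater
    obtain z where z: "y < z" "z < x" "f t x - f t y = (x - y) * \<phi> t z" using post_val_MVT[OF t greater] .
    then show ?thesis
      using optimal_facts(3)[OF t, of z x] optimal_facts(3)[OF t, of y z] c
      by (intro exI[of _ z]) auto
  qed (auto intro: exI[of _ x])
  then obtain z where z: "\<bar>\<phi> t z + c\<bar> \<le> \<bar>\<phi> t x + c\<bar>" "f t x - f t y = (x - y) * \<phi> t z" by blast
  have "(c * x + f t x) - (c * y + f t y) = (x - y) * (\<phi> t z + c)" using z(2) by (simp add: algebra_simps)
  also have "\<dots> \<le> \<bar>x - y\<bar> * \<bar>\<phi> t z + c\<bar>" by (simp add: abs_mult[symmetric])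
  also have "\<dots> \<le> \<bar>\<phi> t x + c\<bar> / \<kappa> * \<bar>\<phi> t x + c\<bar>"
    using level_distance[OF t x y] z(1) c \<kappa>_pos by (intro mult_mono) auto
  also have "\<dots> = (\<phi> t x + c)\<^sup>2 / \<kappa>" by (simp add: power2_eq_square)
  finally show ?thesis .
qed

abbreviation "dev_lo \<theta> t \<equiv> \<bar>\<phi> t (lo \<theta> t) + k\<bar>"
abbreviation "dev_hi \<theta> t \<equiv> \<bar>\<phi> t (hi \<theta> t) - q\<bar>"

text \<open>If the policy moves to one of its levels, the loss is at most the gap of that level. If
  it does nothing where the optimal policy acts, then \<open>s\<close> lies between the levels of
  the two policies, and by monotonicity its slope deviates no more than that at the policy's own
  level.\<close>

lemma advantage_le:
  assumes \<theta>: "\<theta> \<in> Theta C" and t: "t \<in> {1..T}"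
  shows "advantage \<theta>\<^sub>s t (\<theta> t) s \<le> ((dev_lo \<theta> t)\<^sup>2 + (dev_hi \<theta> t)\<^sup>2) / \<kappa>"
proof -
  let ?a = "lo \<theta>\<^sub>s t" and ?b = "hi \<theta>\<^sub>s t" and ?c = "lo \<theta> t" and ?d = "hi \<theta> t"
  note o = Theta_D(1-3)[OF \<theta>\<^sub>s_Theta t] and p = Theta_D(1-3)[OF \<theta> t]
  note F = optimal_facts[OF t]
  have tT: "t \<le> T" using t by simp
  have g1: "(k * ?c + f t ?c) - (k * ?a + f t ?a) \<le> (dev_lo \<theta> t)\<^sup>2 / \<kappa>"
    using level_gap[OF t _ _ _ _ , of ?c ?a k] o p F(1) by simp
  have g2: "(- q * ?d + f t ?d) - (- q * ?b + f t ?b) \<le> (dev_hi \<theta> t)\<^sup>2 / \<kappa>"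
    using level_gap[OF t _ _ _ _ , of ?d ?b "- q"] o p F(2) by simp
  have nn: "0 \<le> (dev_lo \<theta> t)\<^sup>2 / \<kappa>" "0 \<le> (dev_hi \<theta> t)\<^sup>2 / \<kappa>" using \<kappa>_pos by auto
  have sum: "((dev_lo \<theta> t)\<^sup>2 + (dev_hi \<theta> t)\<^sup>2) / \<kappa> = (dev_lo \<theta> t)\<^sup>2 / \<kappa> + (dev_hi \<theta> t)\<^sup>2 / \<kappa>"
    by (simp add: add_divide_distrib)
  have V: "pol_val \<theta>\<^sub>s t s = trans_cost C (base_stock (\<theta>\<^sub>s t) s) s + f t (base_stock (\<theta>\<^sub>s t) s)"
    by (rule pol_val_rec[OF tT])
  \<comment> \<open>These two lower bounds for the optimal value hold at every stock, so when the
    policy moves to a level it does not matter what the optimal policy does at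
    \<open>s\<close>.\<close>
  have V1: "k * ?a + f t ?a - k * s \<le> pol_val \<theta>\<^sub>s t s"
    using F(5)[of "base_stock (\<theta>\<^sub>s t) s"] trans_cost_ge(1)[of "base_stock (\<theta>\<^sub>s t) s" s]
    unfolding V by (simp add: algebra_simps)
  have V2: "- q * ?b + f t ?b + q * s \<le> pol_val \<theta>\<^sub>s t s"
    using F(6)[of "base_stock (\<theta>\<^sub>s t) s"] trans_cost_ge(2)[of s "base_stock (\<theta>\<^sub>s t) s"]
    unfolding V by (simp add: algebra_simps)
  consider "s \<le> ?c" | "?d \<le> s" | "?c < s" "s < ?d" by linarith
  then show ?thesis
  proof cases
    case 1
    then have "advantage \<theta>\<^sub>s t (\<theta> t) s = k * ?c + f t ?c - k * s - pol_val \<theta>\<^sub>s t s"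
      using p unfolding advantage_def trans_cost_base_stock[OF p(2)] by (simp add: base_stock_def algebra_simps)
    then show ?thesis using V1 g1 nn unfolding sum by linarith
  next
    case 2
    then have "advantage \<theta>\<^sub>s t (\<theta> t) s = - q * ?d + f t ?d + q * s - pol_val \<theta>\<^sub>s t s"
      using p unfolding advantage_def trans_cost_base_stock[OF p(2)] by (simp add: base_stock_def algebra_simps)
    then show ?thesis using V2 g2 nn unfolding sum by linarith
  next
    case 3
    then have adv: "advantage \<theta>\<^sub>s t (\<theta> t) s = f t s - pol_val \<theta>\<^sub>s t s"
      using p unfolding advantage_def trans_cost_base_stock[OF p(2)] by (simp add: base_stock_def)
    consider "s < ?a" | "?b < s" | "?a \<le> s" "s \<le> ?b" by linarith
    then show ?thesis
    proof cases
      case 1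
      have "(k * s + f t s) - (k * ?a + f t ?a) \<le> (\<phi> t s + k)\<^sup>2 / \<kappa>"
        using 1 3 o p F(1) by (intro level_gap[OF t]) auto
      moreover have "(\<phi> t s + k)\<^sup>2 \<le> (dev_lo \<theta> t)\<^sup>2"
        using F(3)[of ?c s] F(3)[of s ?a] 1 3 F(1) by (intro power2_le_iff_abs_le[THEN iffD2]) auto
      then have "(\<phi> t s + k)\<^sup>2 / \<kappa> \<le> (dev_lo \<theta> t)\<^sup>2 / \<kappa>" using \<kappa>_pos by (intro divide_right_mono) auto
      ultimately show ?thesis using V1 nn unfolding sum adv by linarith
    next
      case 2
      have "(- q * s + f t s) - (- q * ?b + f t ?b) \<le> (\<phi> t s + - q)\<^sup>2 / \<kappa>"
        using 2 3 o p F(2) by (intro level_gap[OF t]) auto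
      moreover have "(\<phi> t s + - q)\<^sup>2 \<le> (dev_hi \<theta> t)\<^sup>2"
        using F(3)[of ?b s] F(3)[of s ?d] 2 3 F(2) by (intro power2_le_iff_abs_le[THEN iffD2]) auto
      then have "(\<phi> t s + - q)\<^sup>2 / \<kappa> \<le> (dev_hi \<theta> t)\<^sup>2 / \<kappa>" using \<kappa>_pos by (intro divide_right_mono) auto
      ultimately show ?thesis using V2 nn unfolding sum adv by linarith
    next
      case bt: 3
      then have "pol_val \<theta>\<^sub>s t s = f t s"
        unfolding V trans_cost_base_stock[OF o(2)] by (simp add: base_stock_def)
      then show ?thesis using nn unfolding sum adv by linarith
    qed
  qed
qed

text \<open>Averaging a disagreement of height \<open>dev\<close> on an interval of length
  \<open>dev / \<kappa>\<close> gives \<open>L\<^sub>D / \<kappa>\<close> times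
  \<open>dev\<^sup>2\<close>, once for the lower and once for the upper levels. The inherited error
  \<open>d\<close> passes with factor 1.\<close>

lemma slope_error_step:
  assumes \<theta>: "\<theta> \<in> Theta C" and t: "t \<in> {1..T}" "Suc t \<in> {1..T}"
    and err: "\<And>y. \<bar>post_slope \<theta> (Suc t) y - \<phi> (Suc t) y\<bar> \<le> d"
  shows "\<bar>post_slope \<theta> t y - \<phi> t y\<bar> \<le> d + L\<^sub>D / \<kappa> * ((dev_lo \<theta> (Suc t))\<^sup>2 + (dev_hi \<theta> (Suc t))\<^sup>2)"
proof -
  let ?i = "Suc t"
  let ?a = "lo \<theta>\<^sub>s ?i" and ?b = "hi \<theta>\<^sub>s ?i" and ?c = "lo \<theta> ?i" and ?d = "hi \<theta> ?i"
  let ?A = "{min ?a ?c..max ?a ?c}" and ?B = "{min ?b ?d..max ?b ?d}"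
  note o = Theta_D(1-3)[OF \<theta>\<^sub>s_Theta t(2)] and p = Theta_D(1-3)[OF \<theta> t(2)]
  note F = optimal_facts[OF t(2)]
  have iT: "?i \<le> T" using t by simp
  have d0: "0 \<le> d" using err[of 0] by linarith
  have ptw: "\<bar>pol_slope \<theta> ?i z - pol_slope \<theta>\<^sub>s ?i z\<bar>
      \<le> d + dev_lo \<theta> ?i * indicat_real ?A z + dev_hi \<theta> ?i * indicat_real ?B z" for z
  proof -
    \<comment> \<open>A hybrid: the levels of \<open>\<theta>\<close> with the optimal slope between
      them. It differs from the slope of the policy by at most \<open>d\<close>, and from the
      optimal slope only between a level of \<open>\<theta>\<close> and the corresponding optimal
      one.\<close>
    define b where "b = (if z \<le> ?c then - k else if z \<le> ?d then \<phi> ?i z else q)"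
    have "\<bar>pol_slope \<theta> ?i z - b\<bar> \<le> d"
      using err[of z] d0 by (auto simp: b_def pol_slope_rec[OF iT])
    moreover have "\<bar>b - pol_slope \<theta>\<^sub>s ?i z\<bar> \<le> dev_lo \<theta> ?i * indicat_real ?A z + dev_hi \<theta> ?i * indicat_real ?B z"
    proof -
      have mono: "x \<le> y \<Longrightarrow> \<phi> ?i x \<le> \<phi> ?i y" for x y by (rule F(3))
      note zc = mono[of z ?c] mono[of ?c z] mono[of z ?d] mono[of ?d z] mono[of z ?a] mono[of ?a z] mono[of z ?b] mono[of ?b z]
      have nn: "0 \<le> dev_lo \<theta> ?i * indicat_real ?A z" "0 \<le> dev_hi \<theta> ?i * indicat_real ?B z" by auto
      consider (lo) "z \<in> ?A" "\<bar>b - pol_slope \<theta>\<^sub>s ?i z\<bar> \<le> dev_lo \<theta> ?i"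
        | (hi) "z \<in> ?B" "\<bar>b - pol_slope \<theta>\<^sub>s ?i z\<bar> \<le> dev_hi \<theta> ?i"
        | (eq) "b = pol_slope \<theta>\<^sub>s ?i z"
      proof -
        \<comment> \<open>In the mixed regions monotonicity of \<open>\<phi>\<close> puts both
          slopes between the optimal slope at the deviating level and the value \<open>- k\<close>
          or \<open>q\<close>, so they differ by at most the deviation.\<close>
        consider "z \<le> ?c" "z \<le> ?a" | "z \<le> ?c" "?a < z" | "?c < z" "z \<le> ?d" "z \<le> ?a"
          | "?c < z" "z \<le> ?d" "?a < z" "z \<le> ?b" | "?c < z" "z \<le> ?d" "?b < z"
          | "?d < z" "?b < z" | "?d < z" "z \<le> ?b"
          using o p by linarith
        then show ?thesis
        proof cases
          case 1 then show ?thesis using eq by (simp add: b_def pol_slope_rec[OF iT])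
        next
          case 2
          then have "\<bar>b - pol_slope \<theta>\<^sub>s ?i z\<bar> \<le> dev_lo \<theta> ?i"
            using zc F(1,2) cost_sum by (auto simp: b_def pol_slope_rec[OF iT])
          then show ?thesis using 2 by (intro lo) auto
        next
          case 3
          then have "\<bar>b - pol_slope \<theta>\<^sub>s ?i z\<bar> \<le> dev_lo \<theta> ?i"
            using zc F(1,2) cost_sum by (auto simp: b_def pol_slope_rec[OF iT])
          then show ?thesis using 3 by (intro lo) auto
        next
          case 4 then show ?thesis using eq by (simp add: b_def pol_slope_rec[OF iT])
        next
          case 5
          then have "\<bar>b - pol_slope \<theta>\<^sub>s ?i z\<bar> \<le> dev_hi \<theta> ?i"
            using zc F(1,2) cost_sum o by (auto simp: b_def pol_slope_rec[OF iT])
          then show ?thesis using 5 by (intro hi) auto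
        next
          case 6 then show ?thesis using eq o p by (simp add: b_def pol_slope_rec[OF iT])
        next
          case 7
          then have "\<bar>b - pol_slope \<theta>\<^sub>s ?i z\<bar> \<le> dev_hi \<theta> ?i"
            using zc F(1,2) cost_sum o p by (auto simp: b_def pol_slope_rec[OF iT])
          then show ?thesis using 7 by (intro hi) auto
        qed
      qed
      then show ?thesis
      proof cases
        case lo
        then have "dev_lo \<theta> ?i * indicat_real ?A z = dev_lo \<theta> ?i" by simp
        then show ?thesis using lo(2) nn(2) by linarith
      next
        case hi
        then have "dev_hi \<theta> ?i * indicat_real ?B z = dev_hi \<theta> ?i" by simp
        then show ?thesis using hi(2) nn(1) by linarith
      next
        case eq then show ?thesis using nn by simp
      qed
    qed
    ultimately show ?thesis by linarith
  qed
  have jump: "dev * (\<integral>x. indicat_real {min u v..max u v} (y - x) \<partial>demand) \<le> L\<^sub>D / \<kappa> * dev\<^sup>2"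
    if "0 \<le> dev" "\<bar>u - v\<bar> \<le> dev / \<kappa>" for dev u v
  proof -
    have "(\<integral>x. indicat_real {min u v..max u v} (y - x) \<partial>demand) \<le> L\<^sub>D * (max u v - min u v)"
      by (rule D.integral_between) auto
    also have "\<dots> = L\<^sub>D * \<bar>u - v\<bar>" by (simp add: max_def min_def)
    also have "\<dots> \<le> L\<^sub>D * (dev / \<kappa>)" using that D.L_nonneg by (intro mult_left_mono)
    finally have "dev * (\<integral>x. indicat_real {min u v..max u v} (y - x) \<partial>demand) \<le> dev * (L\<^sub>D * (dev / \<kappa>))"
      using that by (intro mult_left_mono)
    then show ?thesis by (simp add: power2_eq_square mult.commute mult.left_commute)
  qed
  have "\<bar>post_slope \<theta> t y - \<phi> t y\<bar> = \<bar>\<integral>x. pol_slope \<theta> ?i (y - x) - pol_slope \<theta>\<^sub>s ?i (y - x) \<partial>demand\<bar>"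
    using pol_slope_integrable[OF t(1)] by (simp add: post_slope_eq[OF t(1)])
  also have "\<dots> \<le> (\<integral>x. d + dev_lo \<theta> ?i * indicat_real ?A (y - x) + dev_hi \<theta> ?i * indicat_real ?B (y - x) \<partial>demand)"
    using pol_slope_integrable[OF t(1)]
    by (intro order_trans[OF integral_abs_bound] integral_mono ptw integrable_abs
        Bochner_Integration.integrable_add Bochner_Integration.integrable_diff integrable_mult_right
        D.integral_between(1)) auto
  also have "\<dots> = d + dev_lo \<theta> ?i * (\<integral>x. indicat_real ?A (y - x) \<partial>demand)
      + dev_hi \<theta> ?i * (\<integral>x. indicat_real ?B (y - x) \<partial>demand)"
    using D.integral_between(1)[of "min ?a ?c" "max ?a ?c" y] D.integral_between(1)[of "min ?b ?d" "max ?b ?d" y]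
    by (simp add: D.prob_UNIV)
  also have "\<dots> \<le> d + L\<^sub>D / \<kappa> * (dev_lo \<theta> ?i)\<^sup>2 + L\<^sub>D / \<kappa> * (dev_hi \<theta> ?i)\<^sup>2"
  proof (intro add_mono jump order_refl)
    show "\<bar>?a - ?c\<bar> \<le> dev_lo \<theta> ?i / \<kappa>"
      using level_distance[OF t(2), of ?c ?a] o p F(1) by (simp add: abs_minus_commute)
    show "\<bar>?b - ?d\<bar> \<le> dev_hi \<theta> ?i / \<kappa>"
      using level_distance[OF t(2), of ?d ?b] o p F(2) by (simp add: abs_minus_commute)
  qed auto
  finally show ?thesis by (simp add: algebra_simps)
qed

text \<open>Moving one level at a time isolates a single product of a weight and a marginal cost;
  the weight is at least \<open>\<alpha>\<close> and is divided out. Four one-sided bounds result.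
  Where a move is blocked by an end of the admissible interval, the optimal level cannot lie beyond
  that end, and monotonicity of \<open>\<phi>\<close> gives the required sign without any
  test.\<close>

lemma dev_le_residual:
  assumes \<theta>: "\<theta> \<in> Theta C" and t: "t \<in> {1..T}" and r: "0 \<le> r"
    and err: "\<And>y. \<bar>post_slope \<theta> t y - \<phi> t y\<bar> \<le> d"
    and res: "\<And>u. u \<in> Theta_stage C \<Longrightarrow> - r * norm (u - \<theta> t) \<le> policy_gradient \<theta> t \<bullet> (u - \<theta> t)"
  shows "dev_lo \<theta> t \<le> r / \<alpha> + d" "dev_hi \<theta> t \<le> r / \<alpha> + d"
proof -
  define a b where "a = lo \<theta> t" and "b = hi \<theta> t"
  define A B where "A = k + post_slope \<theta> t a" and "B = post_slope \<theta> t b - q"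
  define w v where "w = stock_cdf \<theta> t a" and "v = 1 - stock_cdf \<theta> t b"
  have ab: "B\<^sub>l \<le> a" "a \<le> b" "b \<le> B\<^sub>u" using Theta_D[OF \<theta> t] by (auto simp: a_def b_def)
  have wv: "\<alpha> \<le> w" "\<alpha> \<le> v" unfolding w_def v_def
    using ab by (auto intro!: stock_cdf_ge[OF \<theta> t] stock_cdf_le[OF \<theta> t])
  note o = Theta_D(1-3)[OF \<theta>\<^sub>s_Theta t]
  note F = optimal_facts[OF t]
  have d0: "0 \<le> d" using err[of 0] by linarith
  have ra: "0 \<le> r / \<alpha>" using r \<alpha>_pos by simp
  have g: "policy_gradient \<theta> t \<bullet> (u - \<theta> t) = w * A * (fst u - a) + v * B * (snd u - b)" for u
    by (simp add: policy_gradient_def inner_prod_def A_def B_def w_def v_def a_def b_def)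
  have nrm: "norm (u - \<theta> t) \<le> \<bar>fst u - a\<bar> + \<bar>snd u - b\<bar>" for u
    using norm_Pair_le[of "fst u - a" "snd u - b"] by (cases u; cases "\<theta> t") (simp add: a_def b_def)
  have test: "- r * (\<bar>x - a\<bar> + \<bar>y - b\<bar>) \<le> w * A * (x - a) + v * B * (y - b)"
    if "B\<^sub>l \<le> x" "x \<le> y" "y \<le> B\<^sub>u" for x y
  proof -
    have "(x, y) \<in> Theta_stage C" using that by (simp add: Theta_stage_def)
    from res[OF this] g[of "(x, y)"] mult_left_mono[OF nrm[of "(x, y)"] r] show ?thesis by simp
  qed
  have cancel: "X \<le> r / \<alpha>" if "w' * X \<le> r" "\<alpha> \<le> w'" for w' X
  proof (cases "0 \<le> X")
    case True
    then have "\<alpha> * X \<le> r" using that mult_right_mono[OF that(2) True] by linarith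
    then show ?thesis using \<alpha>_pos by (simp add: field_simps)
  qed (use ra in linarith)
  have div: "X \<le> r" if "X * c \<le> r * c" "0 < c" for X c using that by simp
  have A\<phi>: "\<bar>A - (\<phi> t a + k)\<bar> \<le> d" using err[of a] by (simp add: A_def)
  have B\<phi>: "\<bar>B - (\<phi> t b - q)\<bar> \<le> d" using err[of b] by (simp add: B_def)
  \<comment> \<open>At coinciding levels the two marginal costs differ by exactly
    \<open>k + q\<close>, so one controls the other when the levels block each other.\<close>
  have eqAB: "B \<le> A" if "a = b" using that cost_sum by (simp add: A_def B_def)
  have wv2: "2 * \<alpha> \<le> w + v" using wv by linarith
  have 1: "\<phi> t a + k \<le> r / \<alpha> + d"
  proof (cases "a = B\<^sub>l")
    case True
    then show ?thesis using F(3)[of a "lo \<theta>\<^sub>s t"] F(1) o ra d0 by simp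
  next
    case False
    then have "w * A * (a - B\<^sub>l) \<le> r * (a - B\<^sub>l)"
      using test[of "B\<^sub>l" b] ab by (simp add: algebra_simps)
    then have "w * A \<le> r" using False ab by (intro div[of "w * A" "a - B\<^sub>l"]) auto
    from cancel[OF this wv(1)] A\<phi> show ?thesis by linarith
  qed
  have 2: "- (\<phi> t a + k) \<le> r / \<alpha> + d"
  proof (cases "a < b")
    case True
    then have "w * (- A) * (b - a) \<le> r * (b - a)"
      using test[of b b] ab by (simp add: algebra_simps)
    then have "w * (- A) \<le> r" using True by (intro div[of "w * (- A)" "b - a"]) auto
    from cancel[OF this wv(1)] A\<phi> show ?thesis by linarith
  next
    case False
    \<comment> \<open>The levels coincide and cannot be moved towards each other, so both are moved together.\<close>
    then have eq: "a = b" using ab by simp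
    show ?thesis
    proof (cases "a = B\<^sub>u")
      case True
      then show ?thesis using F(3)[of "lo \<theta>\<^sub>s t" a] F(1) o ra d0 by simp
    next
      case False
      \<comment> \<open>Moving both levels by the same amount has length at most twice that amount,
        whence the factor 1/2; the mean of the two weights is again at least
        \<open>\<alpha>\<close>.\<close>
      then have "(w * (- A) + v * (- B)) / 2 * (B\<^sub>u - a) \<le> r * (B\<^sub>u - a)"
        using test[of "B\<^sub>u" "B\<^sub>u"] ab eq by (simp add: field_simps)
      then have "(w * (- A) + v * (- B)) / 2 \<le> r"
        using False ab by (intro div[of "(w * (- A) + v * (- B)) / 2" "B\<^sub>u - a"]) auto
      moreover have "v * (- A) \<le> v * (- B)" using eqAB[OF eq] wv \<alpha>_pos by (intro mult_left_mono) auto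
      ultimately have "(w + v) / 2 * (- A) \<le> r" by (simp add: field_simps)
      have "\<alpha> \<le> (w + v) / 2" using wv2 by simp
      from cancel[OF \<open>(w + v) / 2 * (- A) \<le> r\<close> this] A\<phi> show ?thesis by linarith
    qed
  qed
  have 3: "- (\<phi> t b - q) \<le> r / \<alpha> + d"
  proof (cases "b = B\<^sub>u")
    case True
    then show ?thesis using F(3)[of "hi \<theta>\<^sub>s t" b] F(2) o ra d0 by simp
  next
    case False
    then have "v * (- B) * (B\<^sub>u - b) \<le> r * (B\<^sub>u - b)"
      using test[of a "B\<^sub>u"] ab by (simp add: algebra_simps)
    then have "v * (- B) \<le> r" using False ab by (intro div[of "v * (- B)" "B\<^sub>u - b"]) auto
    from cancel[OF this wv(2)] B\<phi> show ?thesis by linarith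
  qed
  have 4: "\<phi> t b - q \<le> r / \<alpha> + d"
  proof (cases "a < b")
    case True
    then have "v * B * (b - a) \<le> r * (b - a)"
      using test[of a a] ab by (simp add: algebra_simps)
    then have "v * B \<le> r" using True by (intro div[of "v * B" "b - a"]) auto
    from cancel[OF this wv(2)] B\<phi> show ?thesis by linarith
  next
    case False
    then have eq: "a = b" using ab by simp
    show ?thesis
    proof (cases "b = B\<^sub>l")
      case True
      then show ?thesis using F(3)[of b "hi \<theta>\<^sub>s t"] F(2) o ra d0 by simp
    next
      case False
      then have "(w * A + v * B) / 2 * (b - B\<^sub>l) \<le> r * (b - B\<^sub>l)"
        using test[of "B\<^sub>l" "B\<^sub>l"] ab eq by (simp add: field_simps)
      then have "(w * A + v * B) / 2 \<le> r"
        using False ab by (intro div[of "(w * A + v * B) / 2" "b - B\<^sub>l"]) auto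
      moreover have "w * B \<le> w * A" using eqAB[OF eq] wv \<alpha>_pos by (intro mult_left_mono) auto
      ultimately have "(w + v) / 2 * B \<le> r" by (simp add: field_simps)
      have "\<alpha> \<le> (w + v) / 2" using wv2 by simp
      from cancel[OF \<open>(w + v) / 2 * B \<le> r\<close> this] B\<phi> show ?thesis by linarith
    qed
  qed
  show "dev_lo \<theta> t \<le> r / \<alpha> + d" "dev_hi \<theta> t \<le> r / \<alpha> + d"
    using 1 2 3 4 by (auto simp: a_def b_def)
qed

text \<open>The factor \<open>L\<^sub>D / \<kappa>\<close> of \<open>slope_error_step\<close> times
  \<open>4 / \<alpha>\<^sup>2\<close>, which is what \<open>dev_sq_le\<close> gives for two
  levels.\<close>

definition "c\<^sub>e = 4 * L\<^sub>D / (\<kappa> * \<alpha>\<^sup>2)"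

text \<open>The first summand serves the case of small residuals; the second is
  \<open>4 * c\<^sub>e\<^sup>2 * real T\<close> times the trivial regret bound
  \<open>\<Delta>\<close> and serves the case of large ones.\<close>

definition "C\<^sub>K = 8 / (\<kappa> * \<alpha>\<^sup>2) + 32 * \<Phi>\<^sup>2 * c\<^sub>e\<^sup>2 * (real T)\<^sup>2 / \<kappa>"

definition "\<Delta> = 8 * \<Phi>\<^sup>2 * real T / \<kappa>"

lemma c\<^sub>e_nonneg: "0 \<le> c\<^sub>e"
  using D.L_nonneg \<kappa>_pos by (simp add: c\<^sub>e_def)

lemma C\<^sub>K_pos: "0 < C\<^sub>K"
  using \<kappa>_pos \<alpha>_pos by (auto simp: C\<^sub>K_def intro!: add_pos_nonneg)

lemma regret_le_dev:
  assumes \<theta>: "\<theta> \<in> Theta C"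
  shows "objective C \<theta> - objective C \<theta>\<^sub>s \<le> (\<Sum>t=1..T. ((dev_lo \<theta> t)\<^sup>2 + (dev_hi \<theta> t)\<^sup>2) / \<kappa>)"
  unfolding performance_difference[OF \<theta> \<theta>\<^sub>s_Theta]
proof (rule sum_mono)
  fix t assume t: "t \<in> {1..T}"
  have "(\<integral>\<omega>. advantage \<theta>\<^sub>s t (\<theta> t) (stock \<theta> \<omega> t) \<partial>law C) \<le> (\<integral>\<omega>. ((dev_lo \<theta> t)\<^sup>2 + (dev_hi \<theta> t)\<^sup>2) / \<kappa> \<partial>law C)"
    by (intro integral_mono advantage_integral(1)[OF \<theta> \<theta>\<^sub>s_Theta t] advantage_le[OF \<theta> t]) simp
  then show "(\<integral>\<omega>. advantage \<theta>\<^sub>s t (\<theta> t) (stock \<theta> \<omega> t) \<partial>law C) \<le> ((dev_lo \<theta> t)\<^sup>2 + (dev_hi \<theta> t)\<^sup>2) / \<kappa>"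
    by (simp add: law.prob_space)
qed

lemma regret_nonneg:
  assumes \<theta>: "\<theta> \<in> Theta C" shows "0 \<le> objective C \<theta> - objective C \<theta>\<^sub>s"
  unfolding performance_difference[OF \<theta> \<theta>\<^sub>s_Theta]
  using pol_val_le by (intro sum_nonneg integral_nonneg) (auto simp: advantage_def)

lemma regret_le:
  assumes \<theta>: "\<theta> \<in> Theta C" shows "objective C \<theta> - objective C \<theta>\<^sub>s \<le> \<Delta>"
proof -
  have "((dev_lo \<theta> t)\<^sup>2 + (dev_hi \<theta> t)\<^sup>2) / \<kappa> \<le> 8 * \<Phi>\<^sup>2 / \<kappa>" if t: "t \<in> {1..T}" for t
  proof -
    have "dev_lo \<theta> t \<le> 2 * \<Phi>" "dev_hi \<theta> t \<le> 2 * \<Phi>"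
      using post_slope_abs_le[OF t, of \<theta>\<^sub>s "lo \<theta> t"] post_slope_abs_le[OF t, of \<theta>\<^sub>s "hi \<theta> t"] \<Phi>_ge(1) by linarith+
    then have "(dev_lo \<theta> t)\<^sup>2 + (dev_hi \<theta> t)\<^sup>2 \<le> (2 * \<Phi>)\<^sup>2 + (2 * \<Phi>)\<^sup>2"
      by (intro add_mono power_mono abs_ge_zero)
    then show ?thesis using \<kappa>_pos by (intro divide_right_mono) (auto simp: power_mult_distrib)
  qed
  then have "(\<Sum>t=1..T. ((dev_lo \<theta> t)\<^sup>2 + (dev_hi \<theta> t)\<^sup>2) / \<kappa>) \<le> (\<Sum>t=1..T. 8 * \<Phi>\<^sup>2 / \<kappa>)" by (rule sum_mono)
  then show ?thesis using regret_le_dev[OF \<theta>] by (simp add: \<Delta>_def mult.commute)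
qed

lemma dev_sq_le:
  assumes "dev \<le> r / \<alpha> + d" "0 \<le> dev" "0 \<le> r" "0 \<le> d"
  shows "dev\<^sup>2 \<le> 2 * (r\<^sup>2 + d\<^sup>2) / \<alpha>\<^sup>2"
proof -
  have "dev \<le> (r + d) / \<alpha>"
    using assms \<alpha>_le_1 \<alpha>_pos mult_left_mono[OF \<alpha>_le_1 assms(4)] by (simp add: field_simps)
  then have "dev\<^sup>2 \<le> ((r + d) / \<alpha>)\<^sup>2" using assms by (intro power_mono) auto
  also have "\<dots> = (r + d)\<^sup>2 / \<alpha>\<^sup>2" by (simp add: power_divide)
  also have "\<dots> \<le> 2 * (r\<^sup>2 + d\<^sup>2) / \<alpha>\<^sup>2"
    using sum_squares_bound[of r d] by (intro divide_right_mono) (auto simp: power2_sum)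
  finally show ?thesis .
qed

text \<open>The Kurdyka-Lojasiewicz inequality: small residuals keep the error of the policy's marginal
  cost-to-go quadratically small through the backward recursion; large ones beat the trivial bound
  on the regret.\<close>

lemma gradient_domination:
  assumes \<theta>: "\<theta> \<in> Theta C" and r: "\<And>t. t \<in> {1..T} \<Longrightarrow> 0 \<le> r t"
    and res: "\<And>t u. t \<in> {1..T} \<Longrightarrow> u \<in> Theta_stage C \<Longrightarrow>
      - r t * norm (u - \<theta> t) \<le> policy_gradient \<theta> t \<bullet> (u - \<theta> t)"
  shows "objective C \<theta> - objective C \<theta>\<^sub>s \<le> C\<^sub>K * (\<Sum>t=1..T. (r t)\<^sup>2)"
proof -
  define R where "R = (\<Sum>t=1..T. (r t)\<^sup>2)"
  have R0: "0 \<le> R" by (simp add: R_def sum_nonneg)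
  have Tpos: "0 < real T" using horizon_pos by simp
  have ka: "0 < \<kappa> * \<alpha>\<^sup>2" using \<kappa>_pos \<alpha>_pos by simp
  show ?thesis
  \<comment> \<open>The threshold below which \<open>(2 * c\<^sub>e * R)\<^sup>2\<close> is at most
    \<open>R / real T\<close>.\<close>
  proof (cases "4 * c\<^sub>e\<^sup>2 * real T * R \<le> 1")
    case True
    \<comment> \<open>An explicit majorant of the recursion in which every quadratic error term is
      replaced by a share \<open>R / real T\<close>. All shares together amount to at most
      \<open>c\<^sub>e * R\<close>, so \<open>d\<close> stays below
      \<open>2 * c\<^sub>e * R\<close>, and by the case assumption its square fits into one share:
      the estimate closes on itself.\<close>
    define d where "d t = c\<^sub>e * (\<Sum>i\<in>{Suc t..T}. (r i)\<^sup>2) + (real T - real t) * (c\<^sub>e * R / real T)" for t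
    have d_nonneg: "0 \<le> d t" if "t \<le> T" for t
      using that c\<^sub>e_nonneg R0 by (auto simp: d_def intro!: add_nonneg_nonneg mult_nonneg_nonneg sum_nonneg)
    have d_le: "d t \<le> 2 * c\<^sub>e * R" if t: "t \<le> T" for t
    proof -
      have "(\<Sum>i\<in>{Suc t..T}. (r i)\<^sup>2) \<le> R" unfolding R_def by (intro sum_mono2) auto
      then have "c\<^sub>e * (\<Sum>i\<in>{Suc t..T}. (r i)\<^sup>2) \<le> c\<^sub>e * R" using c\<^sub>e_nonneg by (intro mult_left_mono)
      moreover have "(real T - real t) * (c\<^sub>e * R / real T) \<le> real T * (c\<^sub>e * R / real T)"
        using c\<^sub>e_nonneg R0 by (intro mult_right_mono) auto
      ultimately show ?thesis using Tpos by (simp add: d_def)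
    qed
    have d_sq: "(d t)\<^sup>2 \<le> R / real T" if t: "t \<le> T" for t
    proof -
      have "(d t)\<^sup>2 \<le> (2 * c\<^sub>e * R)\<^sup>2" using d_le[OF t] d_nonneg[OF t] by (intro power_mono)
      also have "\<dots> = 4 * c\<^sub>e\<^sup>2 * real T * R * (R / real T)" using Tpos by (simp add: power2_eq_square)
      also have "\<dots> \<le> 1 * (R / real T)" using True R0 by (intro mult_right_mono) auto
      finally show ?thesis by simp
    qed
    have err: "t \<le> T \<longrightarrow> (\<forall>y. \<bar>post_slope \<theta> t y - \<phi> t y\<bar> \<le> d t)" if "1 \<le> t" "t \<le> Suc T" for t
      using that
    proof (induction t rule: backward_induct)
      case last
      then show ?case by simp
    next
      case (step t)
      have t: "t \<in> {1..T}" using step by auto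
      show ?case
      proof (cases "t = T")
        case True
        then show ?thesis using d_nonneg[of T] t by (simp add: post_slope_eq)
      next
        case False
        then have S: "Suc t \<in> {1..T}" "Suc t \<le> T" using t by auto
        have e: "\<bar>post_slope \<theta> (Suc t) y - \<phi> (Suc t) y\<bar> \<le> d (Suc t)" for y
          using step.IH S by blast
        note dev = dev_le_residual[OF \<theta> S(1) r[OF S(1)] e res[OF S(1)]]
        have sq: "(dev_lo \<theta> (Suc t))\<^sup>2 + (dev_hi \<theta> (Suc t))\<^sup>2 \<le> 4 * ((r (Suc t))\<^sup>2 + (d (Suc t))\<^sup>2) / \<alpha>\<^sup>2"
          using dev_sq_le[OF dev(1) _ r[OF S(1)] d_nonneg[OF S(2)]] dev_sq_le[OF dev(2) _ r[OF S(1)] d_nonneg[OF S(2)]]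
          by (simp add: add_divide_distrib)
        have "L\<^sub>D / \<kappa> * ((dev_lo \<theta> (Suc t))\<^sup>2 + (dev_hi \<theta> (Suc t))\<^sup>2)
            \<le> L\<^sub>D / \<kappa> * (4 * ((r (Suc t))\<^sup>2 + (d (Suc t))\<^sup>2) / \<alpha>\<^sup>2)"
          using D.L_nonneg \<kappa>_pos by (intro mult_left_mono sq) auto
        also have "\<dots> = c\<^sub>e * ((r (Suc t))\<^sup>2 + (d (Suc t))\<^sup>2)" by (simp add: c\<^sub>e_def)
        also have "\<dots> \<le> c\<^sub>e * ((r (Suc t))\<^sup>2 + R / real T)"
          using d_sq[OF S(2)] c\<^sub>e_nonneg by (intro mult_left_mono add_left_mono)
        finally have inc: "L\<^sub>D / \<kappa> * ((dev_lo \<theta> (Suc t))\<^sup>2 + (dev_hi \<theta> (Suc t))\<^sup>2)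
            \<le> c\<^sub>e * ((r (Suc t))\<^sup>2 + R / real T)" .
        have "{Suc t..T} = insert (Suc t) {Suc (Suc t)..T}" using S by auto
        then have dt: "d t = d (Suc t) + c\<^sub>e * ((r (Suc t))\<^sup>2 + R / real T)"
          unfolding d_def using S(2)
          by (simp add: distrib_left distrib_right left_diff_distrib add_divide_distrib diff_divide_distrib)
        have "\<bar>post_slope \<theta> t y - \<phi> t y\<bar> \<le> d t" for y
          using slope_error_step[OF \<theta> t S(1) e, of y] inc unfolding dt by linarith
        then show ?thesis by blast
      qed
    qed
    have "objective C \<theta> - objective C \<theta>\<^sub>s \<le> (\<Sum>t=1..T. ((dev_lo \<theta> t)\<^sup>2 + (dev_hi \<theta> t)\<^sup>2) / \<kappa>)"
      by (rule regret_le_dev[OF \<theta>])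
    also have "\<dots> \<le> (\<Sum>t=1..T. 4 / (\<kappa> * \<alpha>\<^sup>2) * ((r t)\<^sup>2 + R / real T))"
    proof (rule sum_mono)
      fix t assume t: "t \<in> {1..T}"
      then have tT: "t \<le> T" by simp
      have e: "\<bar>post_slope \<theta> t y - \<phi> t y\<bar> \<le> d t" for y using err[of t] t by auto
      note dev = dev_le_residual[OF \<theta> t r[OF t] e res[OF t]]
      have "(dev_lo \<theta> t)\<^sup>2 + (dev_hi \<theta> t)\<^sup>2 \<le> 4 * ((r t)\<^sup>2 + (d t)\<^sup>2) / \<alpha>\<^sup>2"
        using dev_sq_le[OF dev(1) _ r[OF t] d_nonneg[OF tT]] dev_sq_le[OF dev(2) _ r[OF t] d_nonneg[OF tT]]
        by (simp add: add_divide_distrib)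
      also have "\<dots> \<le> 4 * ((r t)\<^sup>2 + R / real T) / \<alpha>\<^sup>2"
        using d_sq[OF tT] by (intro divide_right_mono mult_left_mono add_left_mono) auto
      finally have "((dev_lo \<theta> t)\<^sup>2 + (dev_hi \<theta> t)\<^sup>2) / \<kappa> \<le> 4 * ((r t)\<^sup>2 + R / real T) / \<alpha>\<^sup>2 / \<kappa>"
        using \<kappa>_pos by (intro divide_right_mono) auto
      then show "((dev_lo \<theta> t)\<^sup>2 + (dev_hi \<theta> t)\<^sup>2) / \<kappa> \<le> 4 / (\<kappa> * \<alpha>\<^sup>2) * ((r t)\<^sup>2 + R / real T)"
        by (simp add: mult.commute)
    qed
    also have "\<dots> = 4 / (\<kappa> * \<alpha>\<^sup>2) * (R + R)"
      unfolding sum_distrib_left[symmetric] sum.distrib using Tpos by (simp add: R_def)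
    also have "\<dots> = 8 / (\<kappa> * \<alpha>\<^sup>2) * R" by simp
    also have "\<dots> \<le> C\<^sub>K * R"
      using R0 \<kappa>_pos by (intro mult_right_mono) (auto simp: C\<^sub>K_def)
    finally show ?thesis by (simp add: R_def)
  next
    case False
    have D0: "0 \<le> \<Delta>" using \<kappa>_pos by (simp add: \<Delta>_def)
    have "objective C \<theta> - objective C \<theta>\<^sub>s \<le> \<Delta> * 1" using regret_le[OF \<theta>] by simp
    also have "\<dots> \<le> \<Delta> * (4 * c\<^sub>e\<^sup>2 * real T * R)" using False D0 by (intro mult_left_mono) auto
    also have "\<dots> = 32 * \<Phi>\<^sup>2 * c\<^sub>e\<^sup>2 * (real T)\<^sup>2 / \<kappa> * R" by (simp add: \<Delta>_def power2_eq_square)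
    also have "\<dots> \<le> C\<^sub>K * R"
      using R0 ka by (intro mult_right_mono) (auto simp: C\<^sub>K_def)
    finally show ?thesis by (simp add: R_def)
  qed
qed

subsection \<open>One projected gradient step\<close>

text \<open>The stepsize is written \<open>1 / S\<close>. Descent leaves minus \<open>S / 3\<close>
  times the squared step length; the domination inequality at the new point, multiplied by
  \<open>1 / (18 * S * C\<^sub>K)\<close>, yields plus the same amount. Adding the two removes the
  step length, and only noise remains.\<close>

lemma projected_step:
  fixes gh :: params and S :: real
  assumes \<theta>: "\<theta> \<in> Theta C" and \<theta>': "\<theta>' \<in> Theta C"
    and step: "\<And>t. t \<in> {1..T} \<Longrightarrow> \<theta>' t = closest_point (Theta_stage C) (\<theta> t - (1 / S) *\<^sub>R gh t)"
    and S: "0 < S" "3 * A\<^sub>g \<le> S" "real T * L\<^sub>g\<^sup>2 \<le> S\<^sup>2"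
  shows "(1 + 1 / (18 * S * C\<^sub>K)) * (objective C \<theta>' - objective C \<theta>\<^sub>s)
    \<le> objective C \<theta> - objective C \<theta>\<^sub>s + (\<Sum>t=1..T. (norm (gh t - policy_gradient \<theta> t))\<^sup>2) / S"
proof -
  define P where "P = pdist T \<theta>' \<theta>"
  define \<delta> where "\<delta> t = \<theta>' t - \<theta> t" for t
  define e where "e t = gh t - policy_gradient \<theta> t" for t
  define E where "E = (\<Sum>t=1..T. (norm (e t))\<^sup>2)"
  have P2: "P\<^sup>2 = (\<Sum>t=1..T. (norm (\<delta> t))\<^sup>2)"
    by (simp add: P_def pdist_sq \<delta>_def dist_norm)
  have E0: "0 \<le> E" by (simp add: E_def sum_nonneg)
  \<comment> \<open>The variational inequality of the projection: with \<open>u = \<theta> t\<close>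
    it gives the descent, with general \<open>u\<close> the residual at the new point.\<close>
  have var: "gh t \<bullet> (\<theta>' t - u) \<le> S * (\<delta> t \<bullet> (u - \<theta>' t))" if t: "t \<in> {1..T}" and u: "u \<in> Theta_stage C" for t u
  proof -
    have "(\<theta> t - (1 / S) *\<^sub>R gh t - \<theta>' t) \<bullet> (u - \<theta>' t) \<le> 0"
      unfolding step[OF t] by (rule closest_point_dot[OF convex_Theta_stage closed_Theta_stage u])
    then have "(1 / S) * (gh t \<bullet> (\<theta>' t - u)) \<le> \<delta> t \<bullet> (u - \<theta>' t)"
      by (simp add: \<delta>_def inner_diff_left inner_diff_right algebra_simps)
    then show ?thesis using S(1) by (simp add: field_simps)
  qed
  have desc: "objective C \<theta>' - objective C \<theta> \<le> - (S / 3) * P\<^sup>2 + 3 / (4 * S) * E"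
  proof -
    have "policy_gradient \<theta> t \<bullet> \<delta> t \<le> - (2 * S / 3) * (norm (\<delta> t))\<^sup>2 + 3 / (4 * S) * (norm (e t))\<^sup>2"
      if t: "t \<in> {1..T}" for t
    proof -
      have "gh t \<bullet> \<delta> t \<le> - S * (norm (\<delta> t))\<^sup>2"
        using var[OF t Theta_D(4)[OF \<theta> t]]
        by (simp add: \<delta>_def power2_norm_eq_inner inner_diff_right inner_diff_left algebra_simps)
      moreover have "- (e t \<bullet> \<delta> t) \<le> norm (e t) * norm (\<delta> t)"
        using norm_cauchy_schwarz[of "- e t" "\<delta> t"] by simp
      \<comment> \<open>Young's inequality with weights that give away one third of the quadratic
        descent; another third pays for the curvature \<open>A\<^sub>g\<close>.\<close>
      moreover have "norm (e t) * norm (\<delta> t) \<le> S / 3 * (norm (\<delta> t))\<^sup>2 + 3 / (4 * S) * (norm (e t))\<^sup>2"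
      proof -
        have "0 \<le> (2 * S * norm (\<delta> t) - 3 * norm (e t))\<^sup>2 / (12 * S)" using S(1) by simp
        also have "\<dots> = S / 3 * (norm (\<delta> t))\<^sup>2 + 3 / (4 * S) * (norm (e t))\<^sup>2 - norm (e t) * norm (\<delta> t)"
          using S(1) by (simp add: power2_eq_square field_simps)
        finally show ?thesis by simp
      qed
      moreover have "policy_gradient \<theta> t \<bullet> \<delta> t = gh t \<bullet> \<delta> t - e t \<bullet> \<delta> t"
        by (simp add: e_def inner_diff_left)
      ultimately show ?thesis by linarith
    qed
    then have "(\<Sum>t=1..T. policy_gradient \<theta> t \<bullet> \<delta> t)
        \<le> (\<Sum>t=1..T. - (2 * S / 3) * (norm (\<delta> t))\<^sup>2 + 3 / (4 * S) * (norm (e t))\<^sup>2)"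
      by (rule sum_mono)
    also have "\<dots> = - (2 * S / 3) * P\<^sup>2 + 3 / (4 * S) * E"
      unfolding sum.distrib sum_distrib_left[symmetric] P2 E_def ..
    finally have lin: "(\<Sum>t=1..T. policy_gradient \<theta> t \<bullet> \<delta> t) \<le> - (2 * S / 3) * P\<^sup>2 + 3 / (4 * S) * E" .
    have "A\<^sub>g * P\<^sup>2 \<le> S / 3 * P\<^sup>2" using S(2) by (intro mult_right_mono) auto
    moreover have "objective C \<theta>' - objective C \<theta> \<le> (\<Sum>t=1..T. policy_gradient \<theta> t \<bullet> \<delta> t) + A\<^sub>g * P\<^sup>2"
      using objective_quadratic[OF \<theta> \<theta>'] unfolding P_def \<delta>_def by linarith
    ultimately show ?thesis using lin by simp
  qed
  \<comment> \<open>Residual at \<open>\<theta>'\<close>: change of the gradient along the step,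
    noise of the estimate, and the step itself through the variational inequality.\<close>
  define r where "r t = L\<^sub>g * P + norm (e t) + S * norm (\<delta> t)" for t
  have P0: "0 \<le> P" by (simp add: P_def pdist_nonneg)
  have r0: "0 \<le> r t" for t using L\<^sub>g_nonneg P0 S(1) by (simp add: r_def)
  have "objective C \<theta>' - objective C \<theta>\<^sub>s \<le> C\<^sub>K * (\<Sum>t=1..T. (r t)\<^sup>2)"
  proof (rule gradient_domination[OF \<theta>' r0])
    fix t u assume t: "t \<in> {1..T}" and u: "u \<in> Theta_stage C"
    let ?w = "u - \<theta>' t"
    have "(policy_gradient \<theta> t - policy_gradient \<theta>' t) \<bullet> ?w \<le> L\<^sub>g * P * norm ?w"
      using norm_cauchy_schwarz[of "policy_gradient \<theta> t - policy_gradient \<theta>' t" ?w]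
        mult_right_mono[OF policy_gradient_lipschitz[OF \<theta>' \<theta> t] norm_ge_zero[of ?w]]
      by (simp add: P_def norm_minus_commute)
    moreover have "e t \<bullet> ?w \<le> norm (e t) * norm ?w" by (rule norm_cauchy_schwarz)
    moreover have "- (gh t \<bullet> ?w) \<le> S * norm (\<delta> t) * norm ?w"
    proof -
      have "- (gh t \<bullet> ?w) \<le> S * (\<delta> t \<bullet> ?w)" using var[OF t u] by (simp add: inner_diff_right)
      also have "\<dots> \<le> S * (norm (\<delta> t) * norm ?w)" using S(1) by (intro mult_left_mono norm_cauchy_schwarz) auto
      finally show ?thesis by simp
    qed
    moreover have "policy_gradient \<theta>' t \<bullet> ?w
        = gh t \<bullet> ?w - e t \<bullet> ?w - (policy_gradient \<theta> t - policy_gradient \<theta>' t) \<bullet> ?w"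
      by (simp add: e_def inner_diff_left)
    moreover have "- r t * norm ?w = - (L\<^sub>g * P * norm ?w) - norm (e t) * norm ?w - S * norm (\<delta> t) * norm ?w"
      by (simp add: r_def algebra_simps)
    ultimately show "- r t * norm ?w \<le> policy_gradient \<theta>' t \<bullet> ?w" by linarith
  qed
  also have "\<dots> \<le> C\<^sub>K * (6 * S\<^sup>2 * P\<^sup>2 + 3 * E)"
  proof (rule mult_left_mono)
    have three: "(x + y + z)\<^sup>2 \<le> 3 * (x\<^sup>2 + y\<^sup>2 + z\<^sup>2)" for x y z :: real
    proof -
      have "0 \<le> (x - y)\<^sup>2 + (y - z)\<^sup>2 + (x - z)\<^sup>2" by simp
      then show ?thesis by (simp add: power2_eq_square algebra_simps)
    qed
    have "(\<Sum>t=1..T. (r t)\<^sup>2) \<le> (\<Sum>t=1..T. 3 * ((L\<^sub>g * P)\<^sup>2 + (norm (e t))\<^sup>2 + (S * norm (\<delta> t))\<^sup>2))"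
      unfolding r_def by (intro sum_mono three)
    also have "\<dots> = 3 * (real T * L\<^sub>g\<^sup>2 * P\<^sup>2 + E + S\<^sup>2 * P\<^sup>2)"
      unfolding sum_distrib_left[symmetric] sum.distrib power_mult_distrib E_def P2 by simp
    also have "\<dots> \<le> 3 * (S\<^sup>2 * P\<^sup>2 + E + S\<^sup>2 * P\<^sup>2)"
      using S(3) by (intro mult_left_mono add_mono mult_right_mono order_refl) auto
    finally show "(\<Sum>t=1..T. (r t)\<^sup>2) \<le> 6 * S\<^sup>2 * P\<^sup>2 + 3 * E" by (simp add: mult.commute mult.left_commute)
  qed (use C\<^sub>K_pos in simp)
  finally have kl: "objective C \<theta>' - objective C \<theta>\<^sub>s \<le> C\<^sub>K * (6 * S\<^sup>2 * P\<^sup>2 + 3 * E)" .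
  have "1 / (18 * S * C\<^sub>K) * (objective C \<theta>' - objective C \<theta>\<^sub>s)
      \<le> 1 / (18 * S * C\<^sub>K) * (C\<^sub>K * (6 * S\<^sup>2 * P\<^sup>2 + 3 * E))"
    using S(1) C\<^sub>K_pos by (intro mult_left_mono kl) auto
  also have "\<dots> = S / 3 * P\<^sup>2 + E / (6 * S)"
    using S(1) C\<^sub>K_pos by (simp add: field_simps power2_eq_square)
  finally have kl': "1 / (18 * S * C\<^sub>K) * (objective C \<theta>' - objective C \<theta>\<^sub>s) \<le> S / 3 * P\<^sup>2 + E / (6 * S)" .
  have "3 / (4 * S) * E + E / (6 * S) = 11 / 12 * (E / S)" using S(1) by (simp add: field_simps)
  also have "\<dots> \<le> E / S" using E0 S(1) by (simp add: field_simps)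
  finally have "3 / (4 * S) * E + E / (6 * S) \<le> E / S" .
  then have "(1 + 1 / (18 * S * C\<^sub>K)) * (objective C \<theta>' - objective C \<theta>\<^sub>s)
      \<le> objective C \<theta> - objective C \<theta>\<^sub>s + E / S"
  proof -
    have combine: "(1 + c) * y \<le> z + w" if "y - z \<le> - p + c1" "c * y \<le> p + c2" "c1 + c2 \<le> w"
      for c y z w p c1 c2 :: real
      using that by (simp add: distrib_right)
    have "(objective C \<theta>' - objective C \<theta>\<^sub>s) - (objective C \<theta> - objective C \<theta>\<^sub>s)
        \<le> - (S / 3 * P\<^sup>2) + 3 / (4 * S) * E"
      using desc by simp
    from combine[OF this kl' \<open>3 / (4 * S) * E + E / (6 * S) \<le> E / S\<close>] show ?thesis .
  qed
  then show ?thesis by (simp add: E_def e_def)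
qed

end

section \<open>Stochastic policy gradient\<close>

lemma norm_prod_sq: "(norm x)\<^sup>2 = (fst x)\<^sup>2 + (snd x)\<^sup>2" for x :: "real \<times> real"
  by (cases x) (simp add: norm_Pair)

text \<open>Onto a product set one projects componentwise. As \<open>arg_min\<close> chooses some
  minimiser, uniqueness is proved as well: no single period can be improved, so another minimiser
  has the same distance in every period, and there the nearest point of a closed convex set is
  unique.\<close>

lemma proj_Theta_eq:
  assumes "lo_bound C \<le> hi_bound C"
  shows "proj_Theta C x = (\<lambda>t\<in>{1..horizon C}. closest_point (Theta_stage C) (x t))"
proof -
  let ?S = "Theta_stage C" and ?T = "horizon C"
  let ?c = "\<lambda>t\<in>{1..?T}. closest_point ?S (x t)"
  have ne: "?S \<noteq> {}" using assms by (auto simp: Theta_stage_def)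
  have c: "?c \<in> Theta C"
    using closest_point_in_set[OF closed_Theta_stage ne] by (auto simp: Theta_def)
  have le: "dist (x t) (?c t) \<le> dist (x t) (u t)" if "u \<in> Theta C" "t \<in> {1..?T}" for u t
  proof -
    have "u t \<in> ?S" using that by (auto simp: Theta_def)
    from closest_point_le[OF closed_Theta_stage this, of "x t"] that(2) show ?thesis by simp
  qed
  have min: "pdist ?T x ?c \<le> pdist ?T x u" if "u \<in> Theta C" for u
    unfolding pdist_def by (rule L2_set_mono) (use le[OF that] in auto)
  have uniq: "u = ?c" if u: "u \<in> Theta C" "pdist ?T x u \<le> pdist ?T x ?c" for u
  proof (rule ext)
    fix t
    show "u t = ?c t"
    proof (cases "t \<in> {1..?T}")
      case True
      have "(pdist ?T x u)\<^sup>2 \<le> (pdist ?T x ?c)\<^sup>2" using u(2) pdist_nonneg by (rule power_mono)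
      then have "(\<Sum>t=1..?T. (dist (x t) (u t))\<^sup>2 - (dist (x t) (?c t))\<^sup>2) \<le> 0"
        unfolding pdist_sq sum_subtractf by simp
      moreover have nn: "0 \<le> (dist (x t) (u t))\<^sup>2 - (dist (x t) (?c t))\<^sup>2" if "t \<in> {1..?T}" for t
        using power_mono[OF le[OF u(1) that] zero_le_dist, of 2] by simp
      ultimately have "(\<Sum>t=1..?T. (dist (x t) (u t))\<^sup>2 - (dist (x t) (?c t))\<^sup>2) = 0"
        by (intro antisym sum_nonneg) auto
      then have "(dist (x t) (u t))\<^sup>2 - (dist (x t) (?c t))\<^sup>2 = 0"
        using sum_nonneg_eq_0_iff[of "{1..?T}" "\<lambda>t. (dist (x t) (u t))\<^sup>2 - (dist (x t) (?c t))\<^sup>2"] nn True by auto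
      then have "dist (x t) (u t) = dist (x t) (?c t)"
        by (simp add: power2_eq_iff_nonneg)
      moreover have "dist (x t) (?c t) \<le> dist (x t) z" if "z \<in> ?S" for z
        using closest_point_le[OF closed_Theta_stage that, of "x t"] True by simp
      ultimately have "u t = closest_point ?S (x t)"
        using u(1) True by (intro closest_point_unique convex_Theta_stage closed_Theta_stage) (auto simp: Theta_def)
      then show ?thesis using True by simp
    next
      case False
      then show ?thesis using u(1) by (auto simp: Theta_def PiE_iff extensional_def)
    qed
  qed
  show ?thesis
    unfolding proj_Theta_def arg_min_def
  proof (rule some_equality)
    show "is_arg_min (pdist ?T x) (\<lambda>\<theta>. \<theta> \<in> Theta C) ?c"
      using c min by (auto simp: is_arg_min_def not_less)
    show "u = ?c" if "is_arg_min (pdist ?T x) (\<lambda>\<theta>. \<theta> \<in> Theta C) u" for u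
      using that c uniq[of u] by (auto simp: is_arg_min_def not_less)
  qed
qed

text \<open>Iterate \<open>j\<close> does not look at the trajectories of iteration \<open>j\<close>
  or later, so it may be frozen while these are averaged out.\<close>

lemma spg_iterate_cong:
  assumes "\<And>i r. i < j \<Longrightarrow> r \<in> {1..N} \<Longrightarrow> \<xi> (i, r) = \<xi>' (i, r)"
  shows "spg_iterate C g \<gamma> N \<theta>\<^sub>0 \<xi> j = spg_iterate C g \<gamma> N \<theta>\<^sub>0 \<xi>' j"
  using assms
proof (induction j)
  case (Suc j)
  have "spg_iterate C g \<gamma> N \<theta>\<^sub>0 \<xi> j = spg_iterate C g \<gamma> N \<theta>\<^sub>0 \<xi>' j" by (rule Suc.IH) (use Suc.prems in auto)
  moreover have "(\<Sum>r=1..N. g \<theta> (\<xi> (j, r)) t) = (\<Sum>r=1..N. g \<theta> (\<xi>' (j, r)) t)" for \<theta> t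
    using Suc.prems by (intro sum.cong) auto
  ultimately show ?case by (simp only: spg_iterate.simps Let_def)
qed simp

section \<open>Measurability of the iterates and of the objective along them\<close>

context cash_balance begin

lemma Theta_stage_nonempty: "Theta_stage C \<noteq> {}"
  using bounds by (auto simp: Theta_stage_def)

lemma closest_point_measurable: "closest_point (Theta_stage C) \<in> borel_measurable borel"
  by (intro borel_measurable_continuous_onI continuous_on_closest_point convex_Theta_stage
      closed_Theta_stage Theta_stage_nonempty)

lemma proj_Theta_in_Theta: "proj_Theta C x \<in> Theta C"
  unfolding proj_Theta_eq[OF bounds]
  using closest_point_in_set[OF closed_Theta_stage Theta_stage_nonempty] by (auto simp: Theta_def)

lemma spg_iterate_in_Theta: "\<theta>\<^sub>0 \<in> Theta C \<Longrightarrow> spg_iterate C g \<gamma> N \<theta>\<^sub>0 \<xi> j \<in> Theta C"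
  by (cases j) (auto simp: Let_def intro: proj_Theta_in_Theta)

lemma stock_measurable_joint:
  assumes "1 \<le> t" "t \<le> Suc T"
  shows "(\<lambda>p. stock (fst p) (snd p) t) \<in> borel_measurable ((\<Pi>\<^sub>M t\<in>{1..T}. (borel :: (real \<times> real) measure)) \<Otimes>\<^sub>M law C)"
  using assms
proof (induction t rule: dec_induct)
  case base
  have "(\<lambda>p. snd p 0) \<in> borel_measurable ((\<Pi>\<^sub>M t\<in>{1..T}. (borel :: (real \<times> real) measure)) \<Otimes>\<^sub>M law C)"
    by (rule measurable_compose[OF measurable_snd coordinate_measurable]) simp
  then show ?case by simp
next
  case (step n)
  have [measurable]: "(\<lambda>p. stock (fst p) (snd p) n) \<in> borel_measurable ((\<Pi>\<^sub>M t\<in>{1..T}. (borel :: (real \<times> real) measure)) \<Otimes>\<^sub>M law C)"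
    using step by auto
  have [measurable]: "(\<lambda>p. snd p n) \<in> borel_measurable ((\<Pi>\<^sub>M t\<in>{1..T}. (borel :: (real \<times> real) measure)) \<Otimes>\<^sub>M law C)"
    by (rule measurable_compose[OF measurable_snd coordinate_measurable]) (use step in auto)
  have [measurable]: "(\<lambda>p. fst p n) \<in> borel_measurable ((\<Pi>\<^sub>M t\<in>{1..T}. (borel :: (real \<times> real) measure)) \<Otimes>\<^sub>M law C)"
    by (rule measurable_compose[OF measurable_fst measurable_component_singleton]) (use step in auto)
  show ?case unfolding stock_Suc[OF step(1)] by measurable
qed

lemma objective_measurable:
  "objective C \<in> borel_measurable (\<Pi>\<^sub>M t\<in>{1..T}. borel)"
  unfolding objective_def[abs_def]
proof (rule law.borel_measurable_lebesgue_integral)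
  have "(\<lambda>p. stage_cost C (fst p) (snd p) t) \<in> borel_measurable ((\<Pi>\<^sub>M t\<in>{1..T}. borel) \<Otimes>\<^sub>M law C)"
    if t: "t \<in> {1..T}" for t
  proof -
    have [measurable]: "(\<lambda>p. stock (fst p) (snd p) t) \<in> borel_measurable ((\<Pi>\<^sub>M t\<in>{1..T}. (borel :: (real \<times> real) measure)) \<Otimes>\<^sub>M law C)"
      using t by (intro stock_measurable_joint) auto
    have [measurable]: "(\<lambda>p. fst p t) \<in> borel_measurable ((\<Pi>\<^sub>M t\<in>{1..T}. (borel :: (real \<times> real) measure)) \<Otimes>\<^sub>M law C)"
      by (rule measurable_compose[OF measurable_fst measurable_component_singleton]) (use t in auto)
    have [measurable]: "L_cost C t \<in> borel_measurable borel" by (rule L_cost_measurable[OF t])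
    show ?thesis unfolding stage_cost_def Let_def by measurable
  qed
  then show "(\<lambda>(\<theta>, \<omega>). \<Sum>t=1..T. stage_cost C \<theta> \<omega> t) \<in> borel_measurable ((\<Pi>\<^sub>M t\<in>{1..T}. borel) \<Otimes>\<^sub>M law C)"
    unfolding split_beta' by (intro borel_measurable_sum) auto
qed

lemma spg_step_measurable:
  assumes g: "stochastic_gradient C g \<sigma>"
    and \<Theta>: "Y \<in> measurable Q (restrict_space (\<Pi>\<^sub>M t\<in>{1..T}. borel) (Theta C))"
    and X: "\<And>r. r \<in> {1..N} \<Longrightarrow> X r \<in> measurable Q (law C)"
  shows "(\<lambda>x. proj_Theta C (\<lambda>t\<in>{1..T}. Y x t - \<gamma> *\<^sub>R ((1 / real N) *\<^sub>R (\<Sum>r=1..N. g (Y x) (X r x) t))))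
    \<in> measurable Q (restrict_space (\<Pi>\<^sub>M t\<in>{1..T}. borel) (Theta C))"
proof (rule measurable_restrict_space2)
  have Y: "Y \<in> measurable Q (\<Pi>\<^sub>M t\<in>{1..T}. borel)"
    using \<Theta> by (simp add: measurable_restrict_space2_iff)
  show "(\<lambda>x. proj_Theta C (\<lambda>t\<in>{1..T}. Y x t - \<gamma> *\<^sub>R ((1 / real N) *\<^sub>R (\<Sum>r=1..N. g (Y x) (X r x) t))))
    \<in> measurable Q (\<Pi>\<^sub>M t\<in>{1..T}. borel)"
    unfolding proj_Theta_eq[OF bounds]
  proof (rule measurable_restrict)
    fix t assume t: "t \<in> {1..T}"
    have [measurable]: "(\<lambda>x. Y x t) \<in> borel_measurable Q"
      by (rule measurable_compose[OF Y measurable_component_singleton[OF t]])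
    have "(\<lambda>x. g (Y x) (X r x) t) \<in> borel_measurable Q" if r: "r \<in> {1..N}" for r
    proof -
      have "(\<lambda>(\<theta>, \<omega>). g \<theta> \<omega> t) \<in> borel_measurable (restrict_space (\<Pi>\<^sub>M t\<in>{1..T}. borel) (Theta C) \<Otimes>\<^sub>M law C)"
        using g t by (simp add: stochastic_gradient_def)
      from measurable_compose[OF measurable_Pair[OF \<Theta> X[OF r]] this] show ?thesis by simp
    qed
    then have [measurable]: "(\<lambda>x. \<Sum>r=1..N. g (Y x) (X r x) t) \<in> borel_measurable Q"
      by (intro borel_measurable_sum)
    have "(\<lambda>x. Y x t - \<gamma> *\<^sub>R ((1 / real N) *\<^sub>R (\<Sum>r=1..N. g (Y x) (X r x) t))) \<in> borel_measurable Q"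
      by measurable
    from measurable_compose[OF this closest_point_measurable]
    show "(\<lambda>x. closest_point (Theta_stage C) ((\<lambda>t\<in>{1..T}. Y x t - \<gamma> *\<^sub>R ((1 / real N) *\<^sub>R (\<Sum>r=1..N. g (Y x) (X r x) t))) t))
      \<in> borel_measurable Q"
      using t by simp
  qed
qed (use proj_Theta_in_Theta in auto)

lemma spg_iterate_measurable:
  assumes g: "stochastic_gradient C g \<sigma>" and \<theta>\<^sub>0: "\<theta>\<^sub>0 \<in> Theta C"
    and I: "{..<j} \<times> {1..N} \<subseteq> I"
  shows "(\<lambda>\<xi>. spg_iterate C g \<gamma> N \<theta>\<^sub>0 \<xi> j)
    \<in> measurable (\<Pi>\<^sub>M i\<in>I. law C) (restrict_space (\<Pi>\<^sub>M t\<in>{1..T}. borel) (Theta C))"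
  using I
proof (induction j)
  case 0
  have "\<theta>\<^sub>0 \<in> space (restrict_space (\<Pi>\<^sub>M t\<in>{1..T}. borel) (Theta C))"
    using \<theta>\<^sub>0 by (auto simp: space_restrict_space space_PiM Theta_def)
  then show ?case by simp
next
  case (Suc j)
  have "(\<lambda>\<xi>. spg_iterate C g \<gamma> N \<theta>\<^sub>0 \<xi> j)
    \<in> measurable (\<Pi>\<^sub>M i\<in>I. law C) (restrict_space (\<Pi>\<^sub>M t\<in>{1..T}. borel) (Theta C))"
    by (rule Suc.IH) (use Suc.prems in force)
  moreover have "(\<lambda>\<xi>. \<xi> (j, r)) \<in> measurable (\<Pi>\<^sub>M i\<in>I. law C) (law C)" if "r \<in> {1..N}" for r
    using that Suc.prems by (intro measurable_component_singleton) auto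
  ultimately show ?case
    unfolding spg_iterate.simps Let_def by (rule spg_step_measurable[OF g])
qed

end

section \<open>Contraction of the expected regret\<close>

context optimal_cash_balance begin

abbreviation "regret \<theta> \<equiv> objective C \<theta> - objective C \<theta>\<^sub>s"

definition rate :: "real \<Rightarrow> real" where
  "rate S = 1 / (18 * S * C\<^sub>K)"

text \<open>The squared Euclidean error splits into \<open>2 * T\<close> scalar errors; each is a
  mean of independent centred copies, so its second moment is \<open>1 / N\<close> times that of one
  copy.\<close>

lemma batch_variance:
  fixes j :: nat
  assumes nd: "B\<^sub>l < B\<^sub>u" and g: "stochastic_gradient C g \<sigma>" and \<theta>: "\<theta> \<in> Theta C" and N: "1 \<le> N"
  defines "J \<equiv> {j} \<times> {1..N}"
  shows "integrable (\<Pi>\<^sub>M i\<in>J. law C) (\<lambda>y. \<Sum>t=1..T. (norm ((1 / real N) *\<^sub>R (\<Sum>r=1..N. g \<theta> (y (j, r)) t) - policy_gradient \<theta> t))\<^sup>2)"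
    "(\<integral>y. (\<Sum>t=1..T. (norm ((1 / real N) *\<^sub>R (\<Sum>r=1..N. g \<theta> (y (j, r)) t) - policy_gradient \<theta> t))\<^sup>2) \<partial>(\<Pi>\<^sub>M i\<in>J. law C))
      \<le> \<sigma>\<^sup>2 / real N"
proof -
  define Z where "Z pr t \<omega> = pr (g \<theta> \<omega> t) - pr (policy_gradient \<theta> t)" for pr :: "real \<times> real \<Rightarrow> real" and t \<omega>
  have J: "finite J" "card J = N" by (auto simp: J_def card_cartesian_product)
  have N0: "0 < real N" using N by simp
  have gr: "grad C \<theta> t = policy_gradient \<theta> t" if "t \<in> {1..T}" for t
    by (rule grad_eq_policy_gradient[OF \<theta> that nd])
  have pd: "(pdist T (g \<theta> \<omega>) (grad C \<theta>))\<^sup>2 = (\<Sum>t=1..T. (Z fst t \<omega>)\<^sup>2 + (Z snd t \<omega>)\<^sup>2)" for \<omega>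
    unfolding pdist_sq
    by (intro sum.cong) (auto simp: gr Z_def dist_norm norm_prod_sq)
  have pdi: "integrable (law C) (\<lambda>\<omega>. \<Sum>t=1..T. (Z fst t \<omega>)\<^sup>2 + (Z snd t \<omega>)\<^sup>2)"
    "(\<integral>\<omega>. (\<Sum>t=1..T. (Z fst t \<omega>)\<^sup>2 + (Z snd t \<omega>)\<^sup>2) \<partial>law C) \<le> \<sigma>\<^sup>2"
    using g \<theta> unfolding stochastic_gradient_def pd[symmetric] by auto
  have Z: "integrable (law C) (Z pr t)" "(\<integral>\<omega>. Z pr t \<omega> \<partial>law C) = 0" "integrable (law C) (\<lambda>\<omega>. (Z pr t \<omega>)\<^sup>2)"
    if t: "t \<in> {1..T}" and pr: "pr = fst \<or> pr = snd" for t pr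
  proof -
    have lin: "bounded_linear pr" using pr bounded_linear_fst bounded_linear_snd by auto
    have "has_bochner_integral (law C) (\<lambda>\<omega>. g \<theta> \<omega> t) (policy_gradient \<theta> t)"
      using g \<theta> t gr[OF t] unfolding stochastic_gradient_def by metis
    from has_bochner_integral_bounded_linear[OF lin this]
    have b: "has_bochner_integral (law C) (\<lambda>\<omega>. pr (g \<theta> \<omega> t)) (pr (policy_gradient \<theta> t))" .
    show i: "integrable (law C) (Z pr t)"
      unfolding Z_def[abs_def] using b by (intro Bochner_Integration.integrable_diff) (auto simp: has_bochner_integral_iff)
    show "(\<integral>\<omega>. Z pr t \<omega> \<partial>law C) = 0"
      unfolding Z_def using b by (simp add: has_bochner_integral_iff law.prob_space)
    show "integrable (law C) (\<lambda>\<omega>. (Z pr t \<omega>)\<^sup>2)"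
    proof (rule Bochner_Integration.integrable_bound[OF pdi(1)])
      show "(\<lambda>\<omega>. (Z pr t \<omega>)\<^sup>2) \<in> borel_measurable (law C)"
        using borel_measurable_integrable[OF i] by measurable
      have "(Z pr t \<omega>)\<^sup>2 \<le> (Z fst t \<omega>)\<^sup>2 + (Z snd t \<omega>)\<^sup>2" for \<omega> using pr by auto
      moreover have "(Z fst t \<omega>)\<^sup>2 + (Z snd t \<omega>)\<^sup>2 \<le> (\<Sum>t=1..T. (Z fst t \<omega>)\<^sup>2 + (Z snd t \<omega>)\<^sup>2)" for \<omega>
        using t by (intro member_le_sum) auto
      ultimately have "(Z pr t \<omega>)\<^sup>2 \<le> (\<Sum>t=1..T. (Z fst t \<omega>)\<^sup>2 + (Z snd t \<omega>)\<^sup>2)" for \<omega>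
        using order_trans by blast
      then show "AE \<omega> in law C. norm ((Z pr t \<omega>)\<^sup>2) \<le> norm (\<Sum>t=1..T. (Z fst t \<omega>)\<^sup>2 + (Z snd t \<omega>)\<^sup>2)"
        by (intro AE_I2) (simp add: sum_nonneg)
    qed
  qed
  note sq = pi_sum_sq_integral[OF law.prob_space_axioms J(1)]
  have eq: "(\<Sum>t=1..T. (norm ((1 / real N) *\<^sub>R (\<Sum>r=1..N. g \<theta> (y (j, r)) t) - policy_gradient \<theta> t))\<^sup>2)
      = (\<Sum>t=1..T. ((\<Sum>i\<in>J. Z fst t (y i))\<^sup>2 + (\<Sum>i\<in>J. Z snd t (y i))\<^sup>2) / (real N)\<^sup>2)" for y
  proof (rule sum.cong)
    fix t
    have sJ: "(\<Sum>i\<in>J. h (y i)) = (\<Sum>r=1..N. h (y (j, r)))" for h :: "trajectory \<Rightarrow> real"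
      unfolding J_def by (rule sum.reindex_cong[where l = "\<lambda>r. (j, r)"]) (auto simp: inj_on_def)
    have comp: "(1 / real N) * (\<Sum>r=1..N. h (y (j, r))) - c = (\<Sum>i\<in>J. h (y i) - c) / real N"
      for h :: "trajectory \<Rightarrow> real" and c
      using N0 sJ[of "\<lambda>\<omega>. h \<omega> - c"] by (simp add: sum_subtractf field_simps)
    show "(norm ((1 / real N) *\<^sub>R (\<Sum>r=1..N. g \<theta> (y (j, r)) t) - policy_gradient \<theta> t))\<^sup>2
      = ((\<Sum>i\<in>J. Z fst t (y i))\<^sup>2 + (\<Sum>i\<in>J. Z snd t (y i))\<^sup>2) / (real N)\<^sup>2"
      unfolding norm_prod_sq Z_def
      using comp[of "\<lambda>\<omega>. fst (g \<theta> \<omega> t)" "fst (policy_gradient \<theta> t)"] comp[of "\<lambda>\<omega>. snd (g \<theta> \<omega> t)" "snd (policy_gradient \<theta> t)"]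
      by (simp add: fst_sum snd_sum power_divide add_divide_distrib)
  qed simp
  have int: "integrable (\<Pi>\<^sub>M i\<in>J. law C) (\<lambda>y. ((\<Sum>i\<in>J. Z fst t (y i))\<^sup>2 + (\<Sum>i\<in>J. Z snd t (y i))\<^sup>2) / (real N)\<^sup>2)"
    if t: "t \<in> {1..T}" for t
    using sq(1)[OF Z(3,1,2)[OF t, of fst]] sq(1)[OF Z(3,1,2)[OF t, of snd]] by simp
  show "integrable (\<Pi>\<^sub>M i\<in>J. law C) (\<lambda>y. \<Sum>t=1..T. (norm ((1 / real N) *\<^sub>R (\<Sum>r=1..N. g \<theta> (y (j, r)) t) - policy_gradient \<theta> t))\<^sup>2)"
    unfolding eq by (intro Bochner_Integration.integrable_sum int)
  have "(\<integral>y. (\<Sum>t=1..T. (norm ((1 / real N) *\<^sub>R (\<Sum>r=1..N. g \<theta> (y (j, r)) t) - policy_gradient \<theta> t))\<^sup>2) \<partial>(\<Pi>\<^sub>M i\<in>J. law C))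
      = (\<Sum>t=1..T. (real N * (\<integral>\<omega>. (Z fst t \<omega>)\<^sup>2 \<partial>law C) + real N * (\<integral>\<omega>. (Z snd t \<omega>)\<^sup>2 \<partial>law C)) / (real N)\<^sup>2)"
    unfolding eq
  proof (subst Bochner_Integration.integral_sum[OF int], assumption, rule sum.cong)
    fix t assume t: "t \<in> {1..T}"
    show "(\<integral>y. ((\<Sum>i\<in>J. Z fst t (y i))\<^sup>2 + (\<Sum>i\<in>J. Z snd t (y i))\<^sup>2) / (real N)\<^sup>2 \<partial>(\<Pi>\<^sub>M i\<in>J. law C))
      = (real N * (\<integral>\<omega>. (Z fst t \<omega>)\<^sup>2 \<partial>law C) + real N * (\<integral>\<omega>. (Z snd t \<omega>)\<^sup>2 \<partial>law C)) / (real N)\<^sup>2"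
      using sq[OF Z(3,1,2)[OF t, of fst]] sq[OF Z(3,1,2)[OF t, of snd]] J(2) by simp
  qed simp
  also have "\<dots> = (\<Sum>t=1..T. (\<integral>\<omega>. (Z fst t \<omega>)\<^sup>2 \<partial>law C) + (\<integral>\<omega>. (Z snd t \<omega>)\<^sup>2 \<partial>law C)) / real N"
    unfolding sum_divide_distrib using N0 by (intro sum.cong) (auto simp: power2_eq_square field_simps)
  also have "(\<Sum>t=1..T. (\<integral>\<omega>. (Z fst t \<omega>)\<^sup>2 \<partial>law C) + (\<integral>\<omega>. (Z snd t \<omega>)\<^sup>2 \<partial>law C))
      = (\<integral>\<omega>. (\<Sum>t=1..T. (Z fst t \<omega>)\<^sup>2 + (Z snd t \<omega>)\<^sup>2) \<partial>law C)"
    using Z(3) by (subst Bochner_Integration.integral_sum) auto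
  also have "\<dots> / real N \<le> \<sigma>\<^sup>2 / real N"
    using pdi(2) N0 by (intro divide_right_mono) auto
  finally show "(\<integral>y. (\<Sum>t=1..T. (norm ((1 / real N) *\<^sub>R (\<Sum>r=1..N. g \<theta> (y (j, r)) t) - policy_gradient \<theta> t))\<^sup>2) \<partial>(\<Pi>\<^sub>M i\<in>J. law C))
      \<le> \<sigma>\<^sup>2 / real N" .
qed

lemma expected_step:
  fixes j :: nat
  assumes nd: "B\<^sub>l < B\<^sub>u" and g: "stochastic_gradient C g \<sigma>" and \<theta>: "\<theta> \<in> Theta C" and N: "1 \<le> N"
    and S: "0 < S" "3 * A\<^sub>g \<le> S" "real T * L\<^sub>g\<^sup>2 \<le> S\<^sup>2"
  shows "(\<integral>y. regret (proj_Theta C (\<lambda>t\<in>{1..T}. \<theta> t - (1 / S) *\<^sub>R ((1 / real N) *\<^sub>R (\<Sum>r=1..N. g \<theta> (y (j, r)) t))))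
      \<partial>(\<Pi>\<^sub>M i\<in>{j} \<times> {1..N}. law C)) \<le> (regret \<theta> + \<sigma>\<^sup>2 / (real N * S)) / (1 + rate S)"
proof -
  interpret P: prob_space "\<Pi>\<^sub>M i\<in>{j} \<times> {1..N}. law C"
    by (intro prob_space_PiM) (rule law.prob_space_axioms)
  let ?gh = "\<lambda>y t. (1 / real N) *\<^sub>R (\<Sum>r=1..N. g \<theta> (y (j, r)) t)"
  let ?E = "\<lambda>y. \<Sum>t=1..T. (norm (?gh y t - policy_gradient \<theta> t))\<^sup>2"
  let ?next = "\<lambda>y. proj_Theta C (\<lambda>t\<in>{1..T}. \<theta> t - (1 / S) *\<^sub>R ?gh y t)"
  note bv = batch_variance[OF nd g \<theta> N, of j]
  have rate: "0 < 1 + rate S" using S(1) C\<^sub>K_pos by (auto simp: rate_def intro!: add_pos_nonneg)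
  have "(\<integral>y. regret (?next y) \<partial>(\<Pi>\<^sub>M i\<in>{j} \<times> {1..N}. law C))
      \<le> (\<integral>y. (regret \<theta> + ?E y / S) / (1 + rate S) \<partial>(\<Pi>\<^sub>M i\<in>{j} \<times> {1..N}. law C))"
  \<comment> \<open>In this form of monotonicity integrability is asked of the nonnegative majorant
    only.\<close>
  proof (rule integral_mono')
    show "integrable (\<Pi>\<^sub>M i\<in>{j} \<times> {1..N}. law C) (\<lambda>y. (regret \<theta> + ?E y / S) / (1 + rate S))"
      by (intro integrable_divide Bochner_Integration.integrable_add bv(1) P.integrable_const)
    fix y
    have "0 \<le> ?E y" by (intro sum_nonneg) auto
    then show "0 \<le> (regret \<theta> + ?E y / S) / (1 + rate S)"
      using regret_nonneg[OF \<theta>] rate S(1) by (intro divide_nonneg_pos add_nonneg_nonneg) auto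
    have "(1 + 1 / (18 * S * C\<^sub>K)) * regret (?next y) \<le> regret \<theta> + ?E y / S"
      by (rule projected_step[OF \<theta> proj_Theta_in_Theta _ S]) (simp add: proj_Theta_eq[OF bounds])
    then show "regret (?next y) \<le> (regret \<theta> + ?E y / S) / (1 + rate S)"
      using rate by (simp add: rate_def field_simps)
  qed
  also have "\<dots> = (regret \<theta> + (\<integral>y. ?E y \<partial>(\<Pi>\<^sub>M i\<in>{j} \<times> {1..N}. law C)) / S) / (1 + rate S)"
    by (simp only: integral_divide_zero lebesgue_integral_const P.prob_space scaleR_one
        Bochner_Integration.integral_add[OF P.integrable_const integrable_divide[OF bv(1)]])
  also have "\<dots> \<le> (regret \<theta> + (\<sigma>\<^sup>2 / real N) / S) / (1 + rate S)"
    using bv(2) rate S(1) by (intro divide_right_mono add_left_mono) auto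
  finally show ?thesis by simp
qed

lemma regret_spg_integrable:
  assumes g: "stochastic_gradient C g \<sigma>" and \<theta>\<^sub>0: "\<theta>\<^sub>0 \<in> Theta C" and I: "{..<j} \<times> {1..N} \<subseteq> I"
  shows "integrable (\<Pi>\<^sub>M i\<in>I. law C) (\<lambda>\<xi>. regret (spg_iterate C g \<gamma> N \<theta>\<^sub>0 \<xi> j))"
proof -
  interpret P: prob_space "\<Pi>\<^sub>M i\<in>I. law C"
    by (intro prob_space_PiM) (rule law.prob_space_axioms)
  have "objective C \<in> borel_measurable (restrict_space (\<Pi>\<^sub>M t\<in>{1..T}. borel) (Theta C))"
    by (intro measurable_restrict_space1 objective_measurable)
  from measurable_compose[OF spg_iterate_measurable[OF g \<theta>\<^sub>0 I] this]
  have [measurable]: "(\<lambda>\<xi>. objective C (spg_iterate C g \<gamma> N \<theta>\<^sub>0 \<xi> j)) \<in> borel_measurable (\<Pi>\<^sub>M i\<in>I. law C)" .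
  show ?thesis
    by (rule P.integrable_const_bound[where B = \<Delta>], rule AE_I2)
      (use regret_le[OF spg_iterate_in_Theta[OF \<theta>\<^sub>0]] regret_nonneg[OF spg_iterate_in_Theta[OF \<theta>\<^sub>0]] in auto)
qed

text \<open>The trajectories of the new iteration are independent of those that determine the
  current iterate. After splitting the product measure accordingly, the inner integral is
  \<open>expected_step\<close> at a fixed parameter.\<close>

lemma expected_regret_step:
  assumes nd: "B\<^sub>l < B\<^sub>u" and g: "stochastic_gradient C g \<sigma>" and \<theta>\<^sub>0: "\<theta>\<^sub>0 \<in> Theta C" and N: "1 \<le> N"
    and S: "0 < S" "3 * A\<^sub>g \<le> S" "real T * L\<^sub>g\<^sup>2 \<le> S\<^sup>2"
  shows "(\<integral>\<xi>. regret (spg_iterate C g (1 / S) N \<theta>\<^sub>0 \<xi> (Suc j)) \<partial>fresh_trajectories C N (Suc j))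
    \<le> ((\<integral>\<xi>. regret (spg_iterate C g (1 / S) N \<theta>\<^sub>0 \<xi> j) \<partial>fresh_trajectories C N j) + \<sigma>\<^sup>2 / (real N * S)) / (1 + rate S)"
proof -
  let ?I = "{..<j} \<times> {1..N}" and ?J = "{j} \<times> {1..N}"
  let ?it = "\<lambda>\<xi> j. spg_iterate C g (1 / S) N \<theta>\<^sub>0 \<xi> j"
  interpret product_sigma_finite "\<lambda>_ :: nat \<times> nat. law C"
    by standard
  interpret P: prob_space "\<Pi>\<^sub>M i\<in>?I. law C"
    by (intro prob_space_PiM) (rule law.prob_space_axioms)
  have un: "{..<Suc j} \<times> {1..N} = ?I \<union> ?J" by auto
  have rate: "0 < 1 + rate S" using S(1) C\<^sub>K_pos by (auto simp: rate_def intro!: add_pos_nonneg)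
  have "(\<integral>\<xi>. regret (?it \<xi> (Suc j)) \<partial>fresh_trajectories C N (Suc j))
      = (\<integral>x. (\<integral>y. regret (?it (merge ?I ?J (x, y)) (Suc j)) \<partial>(\<Pi>\<^sub>M i\<in>?J. law C)) \<partial>(\<Pi>\<^sub>M i\<in>?I. law C))"
    unfolding fresh_trajectories_def un
    by (intro product_integral_fold regret_spg_integrable[OF g \<theta>\<^sub>0]) auto
  also have "\<dots> \<le> (\<integral>x. (regret (?it x j) + \<sigma>\<^sup>2 / (real N * S)) / (1 + rate S) \<partial>(\<Pi>\<^sub>M i\<in>?I. law C))"
  proof (rule integral_mono')
    show "integrable (\<Pi>\<^sub>M i\<in>?I. law C) (\<lambda>x. (regret (?it x j) + \<sigma>\<^sup>2 / (real N * S)) / (1 + rate S))"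
      by (intro integrable_divide Bochner_Integration.integrable_add regret_spg_integrable[OF g \<theta>\<^sub>0] P.integrable_const order_refl)
    fix x
    show "0 \<le> (regret (?it x j) + \<sigma>\<^sup>2 / (real N * S)) / (1 + rate S)"
    proof (rule divide_nonneg_pos[OF add_nonneg_nonneg rate])
      show "0 \<le> regret (?it x j)" by (rule regret_nonneg[OF spg_iterate_in_Theta[OF \<theta>\<^sub>0]])
      show "0 \<le> \<sigma>\<^sup>2 / (real N * S)" using S(1) by simp
    qed
    have it: "?it (merge ?I ?J (x, y)) (Suc j)
        = proj_Theta C (\<lambda>t\<in>{1..T}. ?it x j t - (1 / S) *\<^sub>R ((1 / real N) *\<^sub>R (\<Sum>r=1..N. g (?it x j) (y (j, r)) t)))" for y
    proof -
      have "?it (merge ?I ?J (x, y)) j = ?it x j"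
        by (rule spg_iterate_cong) (auto simp: merge_def)
      moreover have "(\<Sum>r=1..N. g \<theta> (merge ?I ?J (x, y) (j, r)) t) = (\<Sum>r=1..N. g \<theta> (y (j, r)) t)" for \<theta> t
        by (intro sum.cong) (auto simp: merge_def)
      ultimately show ?thesis by (simp only: spg_iterate.simps Let_def)
    qed
    show "(\<integral>y. regret (?it (merge ?I ?J (x, y)) (Suc j)) \<partial>(\<Pi>\<^sub>M i\<in>?J. law C))
      \<le> (regret (?it x j) + \<sigma>\<^sup>2 / (real N * S)) / (1 + rate S)"
      unfolding it by (rule expected_step[OF nd g spg_iterate_in_Theta[OF \<theta>\<^sub>0] N S])
  qed
  also have "\<dots> = ((\<integral>\<xi>. regret (?it \<xi> j) \<partial>fresh_trajectories C N j) + \<sigma>\<^sup>2 / (real N * S)) / (1 + rate S)"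
    unfolding fresh_trajectories_def
    by (simp only: integral_divide_zero lebesgue_integral_const P.prob_space scaleR_one
        Bochner_Integration.integral_add[OF regret_spg_integrable[OF g \<theta>\<^sub>0 order_refl] P.integrable_const])
  finally show ?thesis .
qed

text \<open>\<open>18 * C\<^sub>K * \<sigma>\<^sup>2 / real N\<close> is the fixed point of the
  noise recursion: the contribution \<open>\<sigma>\<^sup>2 / (real N * S)\<close> of one step is
  \<open>rate S\<close> times it.\<close>

lemma expected_regret:
  assumes nd: "B\<^sub>l < B\<^sub>u" and g: "stochastic_gradient C g \<sigma>" and \<theta>\<^sub>0: "\<theta>\<^sub>0 \<in> Theta C" and N: "1 \<le> N"
    and S: "0 < S" "3 * A\<^sub>g \<le> S" "real T * L\<^sub>g\<^sup>2 \<le> S\<^sup>2"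
  shows "(\<integral>\<xi>. regret (spg_iterate C g (1 / S) N \<theta>\<^sub>0 \<xi> j) \<partial>fresh_trajectories C N j)
    \<le> \<Delta> / (1 + rate S) ^ j + 18 * C\<^sub>K * \<sigma>\<^sup>2 / real N"
proof (induction j)
  case 0
  interpret P: prob_space "fresh_trajectories C N 0"
    unfolding fresh_trajectories_def by (intro prob_space_PiM) (rule law.prob_space_axioms)
  have "0 \<le> 18 * C\<^sub>K * \<sigma>\<^sup>2 / real N" using C\<^sub>K_pos by simp
  then show ?case using regret_le[OF \<theta>\<^sub>0] P.prob_space by simp
next
  case (Suc j)
  let ?v = "18 * C\<^sub>K * \<sigma>\<^sup>2 / real N"
  have rate: "0 < rate S" using S(1) C\<^sub>K_pos by (auto simp: rate_def)
  have var: "\<sigma>\<^sup>2 / (real N * S) = rate S * ?v"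
    using S(1) C\<^sub>K_pos by (simp add: rate_def)
  have "(\<integral>\<xi>. regret (spg_iterate C g (1 / S) N \<theta>\<^sub>0 \<xi> (Suc j)) \<partial>fresh_trajectories C N (Suc j))
    \<le> ((\<integral>\<xi>. regret (spg_iterate C g (1 / S) N \<theta>\<^sub>0 \<xi> j) \<partial>fresh_trajectories C N j) + \<sigma>\<^sup>2 / (real N * S)) / (1 + rate S)"
    by (rule expected_regret_step[OF nd g \<theta>\<^sub>0 N S])
  also have "\<dots> \<le> (\<Delta> / (1 + rate S) ^ j + ?v + rate S * ?v) / (1 + rate S)"
    using Suc.IH rate unfolding var by (intro divide_right_mono) auto
  also have "\<dots> = \<Delta> / (1 + rate S) ^ Suc j + ?v"
  proof -
    have "(a + v + c * v) / (1 + c) = a / (1 + c) + v" if "0 < c" for a c v :: real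
      using that by (simp add: field_simps)
    from this[OF rate, of "\<Delta> / (1 + rate S) ^ j" ?v] show ?thesis by (simp add: mult.commute)
  qed
  finally show ?case .
qed

section \<open>Choice of stepsize, batch size and number of iterations\<close>

definition "S\<^sub>g = 1 + 3 * A\<^sub>g + real T * L\<^sub>g\<^sup>2"

lemma S\<^sub>g_bounds: "0 < S\<^sub>g" "3 * A\<^sub>g \<le> S\<^sub>g" "real T * L\<^sub>g\<^sup>2 \<le> S\<^sub>g\<^sup>2"
proof -
  have 1: "1 \<le> S\<^sub>g" "3 * A\<^sub>g \<le> S\<^sub>g" "real T * L\<^sub>g\<^sup>2 \<le> S\<^sub>g"
    \<comment> \<open>A sum in place of a maximum, without square roots, keeps
      \<open>S\<^sub>g\<close> polynomial in the horizon; its summand 1 is what makes it at most its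
      own square.\<close>
    using A\<^sub>g_nonneg by (auto simp: S\<^sub>g_def)
  have "S\<^sub>g \<le> S\<^sub>g\<^sup>2"
    using mult_left_mono[of 1 "S\<^sub>g" "S\<^sub>g"] 1 by (simp add: power2_eq_square)
  then show "0 < S\<^sub>g" "3 * A\<^sub>g \<le> S\<^sub>g" "real T * L\<^sub>g\<^sup>2 \<le> S\<^sub>g\<^sup>2"
    using 1 by linarith+
qed

text \<open>The first factor bounds \<open>\<epsilon>\<close> times the batch size, the second the
  number of iterations divided by \<open>ln (1 / \<epsilon>)\<close>.\<close>

definition complexity :: "real \<Rightarrow> real" where
  "complexity v = (36 * C\<^sub>K * v + 1) * ((18 * S\<^sub>g * C\<^sub>K + 1) * (4 * (\<Delta> + 1) + 1) + 2)"

lemma \<Delta>_nonneg: "0 \<le> \<Delta>"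
  using \<kappa>_pos by (simp add: \<Delta>_def)

lemma complexity_nonneg: "0 \<le> v \<Longrightarrow> 0 \<le> complexity v"
  using C\<^sub>K_pos S\<^sub>g_bounds(1) \<Delta>_nonneg by (simp add: complexity_def)

lemma sample_complexity_nondegenerate:
  assumes nd: "B\<^sub>l < B\<^sub>u" and g: "stochastic_gradient C g \<sigma>" and \<theta>\<^sub>0: "\<theta>\<^sub>0 \<in> Theta C"
    and \<epsilon>: "0 < \<epsilon>" "\<epsilon> \<le> 1/2"
  shows "\<exists>\<gamma>>0. \<exists>N\<ge>1. \<exists>K. real (N * K) \<le> complexity (\<sigma>\<^sup>2) * (1 / \<epsilon>) * ln (1 / \<epsilon>) \<and>
    integrable (fresh_trajectories C N K) (\<lambda>\<xi>. objective C (spg_iterate C g \<gamma> N \<theta>\<^sub>0 \<xi> K)) \<and>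
    (\<integral>\<xi>. objective C (spg_iterate C g \<gamma> N \<theta>\<^sub>0 \<xi> K) \<partial>fresh_trajectories C N K) - objective C \<theta>\<^sub>s \<le> \<epsilon>"
proof -
  define l where "l = ln (1 / \<epsilon>)"
  \<comment> \<open>\<open>W\<close> is the reciprocal of
    \<open>rate S\<^sub>g / (1 + rate S\<^sub>g)\<close>, a lower bound of
    \<open>ln (1 + rate S\<^sub>g)\<close>; hence \<open>W * x\<close> iterations reduce the initial
    regret by a factor of at least \<open>exp x\<close>.\<close>
  define W where "W = 18 * S\<^sub>g * C\<^sub>K + 1"
  \<comment> \<open>Large enough for the stationary noise to be at most
    \<open>\<epsilon> / 2\<close>; \<open>Suc\<close> keeps the batch nonempty when
    \<open>\<sigma>\<close> is zero.\<close>
  define N where "N = Suc (nat \<lceil>36 * C\<^sub>K * \<sigma>\<^sup>2 / \<epsilon>\<rceil>)"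
  define K where "K = nat \<lceil>W * (ln (2 * (\<Delta> + 1)) + l)\<rceil>"
  note S = S\<^sub>g_bounds
  have SC: "0 < S\<^sub>g * C\<^sub>K" using S(1) C\<^sub>K_pos by simp
  have W1: "1 \<le> W" using SC by (simp add: W_def)
  \<comment> \<open>Because \<open>\<epsilon>\<close> is at most 1/2, the logarithm is bounded below
    and additive constants can be absorbed into it.\<close>
  have l: "1 / 2 \<le> l"
  proof -
    have "ln (1 / 2) \<le> 1 / 2 - (1 :: real)" by (rule ln_le_minus_one) simp
    then have "1 / 2 \<le> ln (2 :: real)" by (simp add: ln_div)
    also have "\<dots> \<le> l" unfolding l_def using \<epsilon> by (subst ln_le_cancel_iff) (auto simp: field_simps)
    finally show ?thesis .
  qed
  have ln\<Delta>: "0 \<le> ln (2 * (\<Delta> + 1))" "ln (2 * (\<Delta> + 1)) \<le> 2 * (\<Delta> + 1)"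
    using \<Delta>_nonneg ln_le_minus_one[of "2 * (\<Delta> + 1)"] by auto
  have N1: "1 \<le> N" by (simp add: N_def)
  have v0: "0 \<le> 36 * C\<^sub>K * \<sigma>\<^sup>2 / \<epsilon>" using C\<^sub>K_pos \<epsilon> by simp
  have N_ge: "36 * C\<^sub>K * \<sigma>\<^sup>2 / \<epsilon> \<le> real N"
    unfolding N_def using v0 by linarith
  have N_le: "real N \<le> (36 * C\<^sub>K * \<sigma>\<^sup>2 + 1) / \<epsilon>"
  proof -
    have "real N \<le> 36 * C\<^sub>K * \<sigma>\<^sup>2 / \<epsilon> + 2" unfolding N_def using v0 by linarith
    also have "2 \<le> 1 / \<epsilon>" using \<epsilon> by (simp add: field_simps)
    finally show ?thesis by (simp add: add_divide_distrib)
  qed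
  have K0: "0 \<le> W * (ln (2 * (\<Delta> + 1)) + l)" using W1 ln\<Delta> l by simp
  have K_ge: "W * (ln (2 * (\<Delta> + 1)) + l) \<le> real K" unfolding K_def using K0 by linarith
  have K_le: "real K \<le> (W * (4 * (\<Delta> + 1) + 1) + 2) * l"
  proof -
    have "real K \<le> W * (ln (2 * (\<Delta> + 1)) + l) + 1" unfolding K_def using K0 by linarith
    also have "\<dots> \<le> W * (4 * (\<Delta> + 1) * l + l) + 2 * l"
    proof (intro add_mono mult_left_mono)
      have "2 * (\<Delta> + 1) * 1 \<le> 2 * (\<Delta> + 1) * (2 * l)" using l \<Delta>_nonneg by (intro mult_left_mono) auto
      then show "ln (2 * (\<Delta> + 1)) \<le> 4 * (\<Delta> + 1) * l" using ln\<Delta>(2) by linarith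
    qed (use W1 l in auto)
    finally show ?thesis by (simp add: algebra_simps)
  qed
  have "real (N * K) \<le> (36 * C\<^sub>K * \<sigma>\<^sup>2 + 1) / \<epsilon> * ((W * (4 * (\<Delta> + 1) + 1) + 2) * l)"
    unfolding of_nat_mult using N_le K_le C\<^sub>K_pos \<epsilon> by (intro mult_mono) auto
  then have NK: "real (N * K) \<le> complexity (\<sigma>\<^sup>2) * (1 / \<epsilon>) * ln (1 / \<epsilon>)"
    by (simp add: complexity_def W_def l_def)
  interpret P: prob_space "fresh_trajectories C N K"
    unfolding fresh_trajectories_def by (intro prob_space_PiM) (rule law.prob_space_axioms)
  have int: "integrable (fresh_trajectories C N K) (\<lambda>\<xi>. regret (spg_iterate C g (1 / S\<^sub>g) N \<theta>\<^sub>0 \<xi> K))"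
    unfolding fresh_trajectories_def by (rule regret_spg_integrable[OF g \<theta>\<^sub>0 order_refl])
  have int': "integrable (fresh_trajectories C N K) (\<lambda>\<xi>. objective C (spg_iterate C g (1 / S\<^sub>g) N \<theta>\<^sub>0 \<xi> K))"
    using Bochner_Integration.integrable_add[OF int P.integrable_const[of "objective C \<theta>\<^sub>s"]] by simp
  have rate: "0 < rate S\<^sub>g" using SC by (simp add: rate_def)
  have decay: "2 * (\<Delta> + 1) / \<epsilon> \<le> (1 + rate S\<^sub>g) ^ K"
  proof -
    have "ln (1 / (1 + rate S\<^sub>g)) \<le> 1 / (1 + rate S\<^sub>g) - 1" using rate by (intro ln_le_minus_one) simp
    then have lnr: "rate S\<^sub>g / (1 + rate S\<^sub>g) \<le> ln (1 + rate S\<^sub>g)" using rate by (simp add: ln_div field_simps)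
    have Wr: "W * (rate S\<^sub>g / (1 + rate S\<^sub>g)) = 1"
    proof -
      have "(x + 1) * (1 / x / (1 + 1 / x)) = 1" if "0 < x" for x :: real
      proof -
        have "x + 1 \<noteq> 0" and "1 + 1 / x = (x + 1) / x" using that by (auto simp: field_simps)
        then show ?thesis using that by simp
      qed
      from this[of "18 * S\<^sub>g * C\<^sub>K"] SC show ?thesis by (simp add: W_def rate_def mult.assoc)
    qed
    have "ln (2 * (\<Delta> + 1)) + l = W * (ln (2 * (\<Delta> + 1)) + l) * (rate S\<^sub>g / (1 + rate S\<^sub>g))"
    proof -
      have "W * (ln (2 * (\<Delta> + 1)) + l) * (rate S\<^sub>g / (1 + rate S\<^sub>g))
          = (W * (rate S\<^sub>g / (1 + rate S\<^sub>g))) * (ln (2 * (\<Delta> + 1)) + l)" by (simp only: ac_simps)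
      then show ?thesis unfolding Wr by simp
    qed
    also have "\<dots> \<le> real K * ln (1 + rate S\<^sub>g)"
      using K_ge K0 lnr rate by (intro mult_mono) auto
    finally have "exp (ln (2 * (\<Delta> + 1)) + l) \<le> exp (real K * ln (1 + rate S\<^sub>g))" by simp
    moreover have "exp (ln (2 * (\<Delta> + 1)) + l) = 2 * (\<Delta> + 1) / \<epsilon>"
      using \<Delta>_nonneg \<epsilon> by (simp add: exp_add l_def)
    moreover have "exp (real K * ln (1 + rate S\<^sub>g)) = (1 + rate S\<^sub>g) ^ K"
      using rate by (simp add: exp_of_nat_mult)
    ultimately show ?thesis by simp
  qed
  have "(\<integral>\<xi>. objective C (spg_iterate C g (1 / S\<^sub>g) N \<theta>\<^sub>0 \<xi> K) \<partial>fresh_trajectories C N K) - objective C \<theta>\<^sub>s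
      = (\<integral>\<xi>. regret (spg_iterate C g (1 / S\<^sub>g) N \<theta>\<^sub>0 \<xi> K) \<partial>fresh_trajectories C N K)"
    using int' by (simp add: P.prob_space)
  also have "\<dots> \<le> \<Delta> / (1 + rate S\<^sub>g) ^ K + 18 * C\<^sub>K * \<sigma>\<^sup>2 / real N"
    by (rule expected_regret[OF nd g \<theta>\<^sub>0 N1 S])
  also have "\<dots> \<le> \<epsilon> / 2 + \<epsilon> / 2"
  proof (rule add_mono)
    have "0 < (1 + rate S\<^sub>g) ^ K" "0 < 2 * (\<Delta> + 1) / \<epsilon>" using rate \<Delta>_nonneg \<epsilon> by auto
    then have "\<Delta> / (1 + rate S\<^sub>g) ^ K \<le> \<Delta> / (2 * (\<Delta> + 1) / \<epsilon>)"
      by (intro divide_left_mono decay \<Delta>_nonneg mult_pos_pos)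
    also have "\<dots> \<le> \<epsilon> / 2" using \<Delta>_nonneg \<epsilon> by (simp add: field_simps)
    finally show "\<Delta> / (1 + rate S\<^sub>g) ^ K \<le> \<epsilon> / 2" .
    show "18 * C\<^sub>K * \<sigma>\<^sup>2 / real N \<le> \<epsilon> / 2"
      using N_ge N1 \<epsilon> by (simp add: field_simps)
  qed
  finally have "(\<integral>\<xi>. objective C (spg_iterate C g (1 / S\<^sub>g) N \<theta>\<^sub>0 \<xi> K) \<partial>fresh_trajectories C N K) - objective C \<theta>\<^sub>s \<le> \<epsilon>"
    by simp
  then have "\<exists>K. real (N * K) \<le> complexity (\<sigma>\<^sup>2) * (1 / \<epsilon>) * ln (1 / \<epsilon>) \<and>
    integrable (fresh_trajectories C N K) (\<lambda>\<xi>. objective C (spg_iterate C g (1 / S\<^sub>g) N \<theta>\<^sub>0 \<xi> K)) \<and>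
    (\<integral>\<xi>. objective C (spg_iterate C g (1 / S\<^sub>g) N \<theta>\<^sub>0 \<xi> K) \<partial>fresh_trajectories C N K) - objective C \<theta>\<^sub>s \<le> \<epsilon>"
    using NK int' by blast
  moreover have "0 < 1 / S\<^sub>g" using S(1) by simp
  ultimately show ?thesis using N1 by blast
qed

lemma sample_complexity:
  assumes g: "stochastic_gradient C g \<sigma>" and \<theta>\<^sub>0: "\<theta>\<^sub>0 \<in> Theta C" and \<epsilon>: "0 < \<epsilon>" "\<epsilon> \<le> 1/2"
  shows "\<exists>\<gamma>>0. \<exists>N\<ge>1. \<exists>K. real (N * K) \<le> complexity (\<sigma>\<^sup>2) * (1 / \<epsilon>) * ln (1 / \<epsilon>) \<and>
    integrable (fresh_trajectories C N K) (\<lambda>\<xi>. objective C (spg_iterate C g \<gamma> N \<theta>\<^sub>0 \<xi> K)) \<and>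
    (\<integral>\<xi>. objective C (spg_iterate C g \<gamma> N \<theta>\<^sub>0 \<xi> K) \<partial>fresh_trajectories C N K) - objective C \<theta>\<^sub>s \<le> \<epsilon>"
proof (cases "B\<^sub>l < B\<^sub>u")
  case True
  then show ?thesis using sample_complexity_nondegenerate[OF _ assms] by blast
next
  case False
  \<comment> \<open>\<open>Theta C\<close> is a singleton and \<open>grad\<close> an arbitrary choice, but the initial point is already optimal.\<close>
  have "\<theta>\<^sub>0 = \<theta>\<^sub>s"
  proof (rule ext)
    fix t
    show "\<theta>\<^sub>0 t = \<theta>\<^sub>s t"
    proof (cases "t \<in> {1..T}")
      case True
      then show ?thesis
        using Theta_D[OF \<theta>\<^sub>0 True] Theta_D[OF \<theta>\<^sub>s_Theta True] False by (intro prod_eqI) auto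
    next
      case False
      then show ?thesis using \<theta>\<^sub>0 \<theta>\<^sub>s_Theta by (auto simp: Theta_def PiE_iff extensional_def)
    qed
  qed
  interpret P: prob_space "fresh_trajectories C 1 0"
    unfolding fresh_trajectories_def by (intro prob_space_PiM) (rule law.prob_space_axioms)
  have "0 \<le> complexity (\<sigma>\<^sup>2) * (1 / \<epsilon>) * ln (1 / \<epsilon>)"
    using complexity_nonneg[of "\<sigma>\<^sup>2"] \<epsilon> by (intro mult_nonneg_nonneg) auto
  then have "real (1 * 0) \<le> complexity (\<sigma>\<^sup>2) * (1 / \<epsilon>) * ln (1 / \<epsilon>) \<and>
    integrable (fresh_trajectories C 1 0) (\<lambda>\<xi>. objective C (spg_iterate C g 1 1 \<theta>\<^sub>0 \<xi> 0)) \<and>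
    (\<integral>\<xi>. objective C (spg_iterate C g 1 1 \<theta>\<^sub>0 \<xi> 0) \<partial>fresh_trajectories C 1 0) - objective C \<theta>\<^sub>s \<le> \<epsilon>"
    using \<epsilon> P.prob_space \<open>\<theta>\<^sub>0 = \<theta>\<^sub>s\<close> P.integrable_const[of "objective C \<theta>\<^sub>s"] by simp
  moreover have "(0 :: real) < 1" "(1 :: nat) \<le> 1" by simp_all
  ultimately show ?thesis by blast
qed

end

section \<open>Bivariate polynomials\<close>

text \<open>Closure under sums, products, powers and division by constants lets the polynomial be
  obtained from the shape of the bound, without writing down coefficients.\<close>

definition poly2_fun :: "(real \<Rightarrow> real \<Rightarrow> real) \<Rightarrow> bool" where
  "poly2_fun h \<longleftrightarrow> (\<exists>p. \<forall>x y. poly2 p x y = h x y)"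

lemma poly2_fun_const: "poly2_fun (\<lambda>x y. c)"
  unfolding poly2_fun_def by (rule exI[of _ "[:[:c:]:]"]) (simp add: poly2_def)

lemma poly2_fun_fst: "poly2_fun (\<lambda>x y. x)"
  unfolding poly2_fun_def by (rule exI[of _ "[:[:0, 1:]:]"]) (simp add: poly2_def)

lemma poly2_fun_snd: "poly2_fun (\<lambda>x y. y)"
  unfolding poly2_fun_def by (rule exI[of _ "[:0, 1:]"]) (simp add: poly2_def)

lemma poly2_fun_add:
  assumes "poly2_fun f" "poly2_fun g" shows "poly2_fun (\<lambda>x y. f x y + g x y)"
proof -
  obtain p r where "\<And>x y. poly2 p x y = f x y" "\<And>x y. poly2 r x y = g x y"
    using assms unfolding poly2_fun_def by blast
  then show ?thesis unfolding poly2_fun_def by (intro exI[of _ "p + r"]) (simp add: poly2_def)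
qed

lemma poly2_fun_mult:
  assumes "poly2_fun f" "poly2_fun g" shows "poly2_fun (\<lambda>x y. f x y * g x y)"
proof -
  obtain p r where "\<And>x y. poly2 p x y = f x y" "\<And>x y. poly2 r x y = g x y"
    using assms unfolding poly2_fun_def by blast
  then show ?thesis unfolding poly2_fun_def by (intro exI[of _ "p * r"]) (simp add: poly2_def)
qed

lemma poly2_fun_power: "poly2_fun f \<Longrightarrow> poly2_fun (\<lambda>x y. f x y ^ n)"
  by (induction n) (auto intro: poly2_fun_const poly2_fun_mult)

lemma poly2_fun_divide: "poly2_fun f \<Longrightarrow> poly2_fun (\<lambda>x y. f x y / c)"
  unfolding divide_inverse by (intro poly2_fun_mult poly2_fun_const)

lemmas poly2_fun_intros =
  poly2_fun_fst poly2_fun_snd poly2_fun_add poly2_fun_mult poly2_fun_power poly2_fun_divide poly2_fun_const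

theorem mainTheorem8:
  fixes B\<^sub>l B\<^sub>u \<alpha> \<mu>\<^sub>D L\<^sub>D L\<^sub>\<rho> k q m M :: real
  shows "\<exists>p :: real poly poly.
    \<forall>(C :: cash_problem) (\<rho> :: real \<Rightarrow> real) (F\<^sub>D :: real \<Rightarrow> real) (V :: nat \<Rightarrow> real \<Rightarrow> real)
      (\<theta>\<^sub>s :: params) (g :: params \<Rightarrow> trajectory \<Rightarrow> params) (\<sigma> :: real).
      lo_bound C = B\<^sub>l \<and> hi_bound C = B\<^sub>u \<and> up_cost C = k \<and> down_cost C = q \<and>
      cash_model C \<rho> F\<^sub>D \<and>
      Min ((\<lambda>t. holding C t + backlog C t) ` {1..horizon C}) = m \<and>
      Max ((\<lambda>t. max (holding C t) (backlog C t)) ` {1..horizon C}) = M \<and>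
      finite_expectations C V \<and> optimal_value C V \<and> optimal_params C V \<theta>\<^sub>s \<and>
      assumption_B1 C \<and> assumption_B2 \<rho> F\<^sub>D L\<^sub>\<rho> L\<^sub>D \<and> assumption_B3 C \<rho> \<alpha> \<and> assumption_B4 C \<mu>\<^sub>D \<and>
      stochastic_gradient C g \<sigma> \<longrightarrow>
      (\<forall>\<epsilon> \<theta>\<^sub>0. 0 < \<epsilon> \<and> \<epsilon> \<le> 1/2 \<and> \<theta>\<^sub>0 \<in> Theta C \<longrightarrow>
        (\<exists>\<gamma>>0. \<exists>N\<ge>1. \<exists>K.
          real (N * K) \<le> poly2 p (real (horizon C)) (\<sigma>\<^sup>2) * (1 / \<epsilon>) * ln (1 / \<epsilon>) \<and>
          integrable (fresh_trajectories C N K)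
            (\<lambda>\<xi>. objective C (spg_iterate C g \<gamma> N \<theta>\<^sub>0 \<xi> K)) \<and>
          (\<integral>\<xi>. objective C (spg_iterate C g \<gamma> N \<theta>\<^sub>0 \<xi> K) \<partial>fresh_trajectories C N K)
            - objective C \<theta>\<^sub>s \<le> \<epsilon>))"
proof -
  \<comment> \<open>The polynomial has to be fixed before the problem \<open>C\<close> is known, so
    the constants of the locales are restated as functions of a free variable \<open>x\<close> in
    place of the horizon; the divisors contain model parameters only.\<close>
  define c where "c = 4 * L\<^sub>D / (m * \<mu>\<^sub>D * \<alpha>\<^sup>2)"
  define \<Phi>\<^sub>p where "\<Phi>\<^sub>p x = \<bar>k\<bar> + \<bar>q\<bar> + x * M" for x
  define \<Lambda>\<^sub>p where "\<Lambda>\<^sub>p x = x * (6 * \<Phi>\<^sub>p x * L\<^sub>D)" for x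
  define A where "A x = x * (\<Lambda>\<^sub>p x + 12 * \<Phi>\<^sub>p x * (L\<^sub>\<rho> + L\<^sub>D))" for x
  define G where "G x = 4 * \<Lambda>\<^sub>p x + 8 * \<Phi>\<^sub>p x * (L\<^sub>\<rho> + L\<^sub>D)" for x
  define S where "S x = 1 + 3 * A x + x * (G x)\<^sup>2" for x
  define KL where "KL x = 8 / (m * \<mu>\<^sub>D * \<alpha>\<^sup>2) + 32 * (\<Phi>\<^sub>p x)\<^sup>2 * c\<^sup>2 * x\<^sup>2 / (m * \<mu>\<^sub>D)" for x
  define \<Delta>\<^sub>p where "\<Delta>\<^sub>p x = 8 * (\<Phi>\<^sub>p x)\<^sup>2 * x / (m * \<mu>\<^sub>D)" for x
  have "poly2_fun (\<lambda>x y. (36 * KL x * y + 1) * ((18 * S x * KL x + 1) * (4 * (\<Delta>\<^sub>p x + 1) + 1) + 2))"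
    unfolding \<Delta>\<^sub>p_def KL_def S_def G_def A_def \<Lambda>\<^sub>p_def \<Phi>\<^sub>p_def by (intro poly2_fun_intros)
  then obtain p where p: "\<And>x y. poly2 p x y = (36 * KL x * y + 1) * ((18 * S x * KL x + 1) * (4 * (\<Delta>\<^sub>p x + 1) + 1) + 2)"
    unfolding poly2_fun_def by blast
  show ?thesis
  proof (intro exI[of _ p] allI impI, elim conjE)
    fix C :: cash_problem and \<rho> F\<^sub>D :: "real \<Rightarrow> real" and V \<theta>\<^sub>s g and \<sigma> \<epsilon> :: real and \<theta>\<^sub>0
    assume eqs: "lo_bound C = B\<^sub>l" "hi_bound C = B\<^sub>u" "up_cost C = k" "down_cost C = q"
      and model: "cash_model C \<rho> F\<^sub>D"
      and m: "Min ((\<lambda>t. holding C t + backlog C t) ` {1..horizon C}) = m"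
      and M: "Max ((\<lambda>t. max (holding C t) (backlog C t)) ` {1..horizon C}) = M"
      and fin: "finite_expectations C V" and opt: "optimal_value C V" "optimal_params C V \<theta>\<^sub>s"
      and B1: "assumption_B1 C" and B2: "assumption_B2 \<rho> F\<^sub>D L\<^sub>\<rho> L\<^sub>D"
      and B3: "assumption_B3 C \<rho> \<alpha>" and B4: "assumption_B4 C \<mu>\<^sub>D"
      and g: "stochastic_gradient C g \<sigma>"
      and \<epsilon>: "0 < \<epsilon>" "\<epsilon> \<le> 1/2" and \<theta>\<^sub>0: "\<theta>\<^sub>0 \<in> Theta C"
    have T: "1 \<in> {1..horizon C}" "1 \<le> horizon C" using model by (auto simp: cash_model_def)
    have ne: "{1..horizon C} \<noteq> {}" using T by auto
    have cdfs: "cdf (distr (law C) borel (\<lambda>\<omega>. \<omega> 0)) = \<rho>"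
      "\<And>t. t \<in> {1..horizon C} \<Longrightarrow> cdf (distr (law C) borel (\<lambda>\<omega>. \<omega> t)) = F\<^sub>D"
      using model by (auto simp: cash_model_def)
    have hb: "0 \<le> holding C t" "0 \<le> backlog C t" "0 < holding C t + backlog C t"
      if "t \<in> {1..horizon C}" for t
      using model that by (auto simp: cash_model_def)
    interpret cash_balance C L\<^sub>D L\<^sub>\<rho> M
    proof (rule cash_balance.intro)
      show "prob_space (law C)" "sets (law C) = sets (\<Pi>\<^sub>M i\<in>{0..horizon C}. (borel :: real measure))"
        "0 \<le> up_cost C + down_cost C" "1 \<le> horizon C"
        using model by (auto simp: cash_model_def)
      show "cdf (distr (law C) borel (\<lambda>\<omega>. \<omega> t)) = cdf (distr (law C) borel (\<lambda>\<omega>. \<omega> 1))"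
        if "t \<in> {1..horizon C}" for t
        using cdfs(2)[OF that] cdfs(2)[OF T(1)] by simp
      show "lipschitz_on L\<^sub>D UNIV (cdf (distr (law C) borel (\<lambda>\<omega>. \<omega> 1)))"
        using B2 cdfs(2)[OF T(1)] by (simp add: assumption_B2_def)
      show "lipschitz_on L\<^sub>\<rho> UNIV (cdf (distr (law C) borel (\<lambda>\<omega>. \<omega> 0)))"
        using B2 cdfs(1) by (simp add: assumption_B2_def)
      show "0 \<le> holding C t \<and> holding C t \<le> M \<and> 0 \<le> backlog C t \<and> backlog C t \<le> M"
        if t: "t \<in> {1..horizon C}" for t
      proof -
        have "max (holding C t) (backlog C t) \<le> M"
          unfolding M[symmetric] using t by (intro Max_ge) auto
        then show ?thesis using hb[OF t] by simp
      qed
      show "prob_space.indep_vars (law C) (\<lambda>_. borel) (\<lambda>i \<omega>. \<omega> i) {0..horizon C}"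
        using B1 by (simp add: assumption_B1_def)
      \<comment> \<open>The optimal parameters witness that the admissible interval is
        nonempty.\<close>
      have "\<theta>\<^sub>s 1 \<in> Theta_stage C" using opt(2) T(1) by (auto simp: optimal_params_def Theta_def)
      then show "lo_bound C \<le> hi_bound C" by (auto simp: Theta_stage_def)
      show "integrable (law C) (\<lambda>\<omega>. mismatch_cost C t y (\<omega> t))" if "t \<in> {1..horizon C}" for t y
        using fin that by (simp add: finite_expectations_def)
      show "integrable (law C) (\<lambda>\<omega>. stage_cost C \<theta> \<omega> t)" if "t \<in> {1..horizon C}" "\<theta> \<in> Theta C" for t \<theta>
        using fin that by (simp add: finite_expectations_def)
    qed
    interpret optimal_cash_balance C L\<^sub>D L\<^sub>\<rho> M V \<theta>\<^sub>s \<alpha> m \<mu>\<^sub>D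
    proof (rule optimal_cash_balance.intro[OF cash_balance_axioms optimal_cash_balance_axioms.intro])
      show "optimal_value C V" "optimal_params C V \<theta>\<^sub>s" by fact+
      show "0 < \<alpha>" "\<alpha> \<le> cdf (distr (law C) borel (\<lambda>\<omega>. \<omega> 0)) (lo_bound C)"
        "cdf (distr (law C) borel (\<lambda>\<omega>. \<omega> 0)) (hi_bound C) \<le> 1 - \<alpha>"
        using B3 cdfs(1) by (auto simp: assumption_B3_def)
      show "\<alpha> \<le> \<P>(\<omega> in law C. \<omega> 1 \<ge> hi_bound C - lo_bound C)"
        "\<alpha> \<le> \<P>(\<omega> in law C. \<omega> 1 \<le> lo_bound C - hi_bound C)"
        using B3 T(1) unfolding assumption_B3_def by blast+
      show "m \<le> holding C t + backlog C t" if "t \<in> {1..horizon C}" for t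
        unfolding m[symmetric] using that by (intro Min_le) auto
      have "m \<in> (\<lambda>t. holding C t + backlog C t) ` {1..horizon C}"
        unfolding m[symmetric] using ne by (intro Min_in) auto
      then show "0 < m" using hb by auto
      show "0 < \<mu>\<^sub>D" using B4 by (simp add: assumption_B4_def)
      show "\<exists>f. distributed (law C) lborel (\<lambda>\<omega>. \<omega> 1) f \<and> (\<forall>x\<in>{lo_bound C..hi_bound C}. ennreal \<mu>\<^sub>D \<le> f x)"
        using B4 T(1) unfolding assumption_B4_def by blast
    qed
    have "poly2 p (real (horizon C)) (\<sigma>\<^sup>2) = complexity (\<sigma>\<^sup>2)"
      unfolding p complexity_def C\<^sub>K_def S\<^sub>g_def \<Delta>_def A\<^sub>g_def L\<^sub>g_def \<Lambda>_def \<Phi>_def L\<^sub>s_def c\<^sub>e_def \<kappa>_def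
        KL_def S_def A_def G_def c_def \<Delta>\<^sub>p_def \<Lambda>\<^sub>p_def \<Phi>\<^sub>p_def eqs ..
    then show "\<exists>\<gamma>>0. \<exists>N\<ge>1. \<exists>K.
          real (N * K) \<le> poly2 p (real (horizon C)) (\<sigma>\<^sup>2) * (1 / \<epsilon>) * ln (1 / \<epsilon>) \<and>
          integrable (fresh_trajectories C N K)
            (\<lambda>\<xi>. objective C (spg_iterate C g \<gamma> N \<theta>\<^sub>0 \<xi> K)) \<and>
          (\<integral>\<xi>. objective C (spg_iterate C g \<gamma> N \<theta>\<^sub>0 \<xi> K) \<partial>fresh_trajectories C N K)
            - objective C \<theta>\<^sub>s \<le> \<epsilon>"
      using sample_complexity[OF g \<theta>\<^sub>0 \<epsilon>] by simp
  qed
qed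

end
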